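(* Let $d<0$ be any square-free integer, $\mathbb{K}=\mathbb{Q}(\sqrt{d})$, and $\mathcal{O}_{\mathbb{K}}$ its ring of integers. Then there exists a sequence of (possibly scaled) lattices, of dimension $N\to\infty$, each obtained by Construction A over $\mathcal{O}_{\mathbb{K}}$, that is Poltyrev-good and good for MSE quantization.
   Context: For square-free $d<0$, $\mathcal{O}_{\mathbb{K}}=\mathbb{Z}[\xi]$ with $\xi=\sqrt{d}$ if $d\equiv 2,3 \pmod 4$ and $\xi=(1+\sqrt{d})/2$ if $d\equiv 1\pmod 4$. Construction A over $\mathcal{O}_{\mathbb{K}}$: take a prime ideal $\mathfrak{p}$ of $\mathcal{O}_{\mathbb{K}}$ lying above a rational prime $p$ with $\mathcal{O}_{\mathbb{K}}/\mathfrak{p}\cong\mathbb{F}_{p^f}$, a ring isomorphism $\mathcal{M}:\mathbb{F}_{p^f}\to\mathcal{O}_{\mathbb{K}}/\mathfrak{p}$, integers $n\le N$, and an $N\times n$ matrix $\mathbf{G}$ over $\mathbb{F}_{p^f}$ generating the linear code $C=\{\mathbf{G}\mathbf{y}:\mathbf{y}\in\mathbb{F}_{p^f}^n\}$; the lattice is $\Lambda=\{\boldsymbol\lambda\in\mathcal{O}_{\mathbb{K}}^N:(\lambda_i+\mathfrak{p})_{i}\in\mathcal{M}(C)\}\subseteq\mathbb{C}^N\cong\mathbb{R}^{2N}$ (scaled versions $\gamma\Lambda$, $\gamma>0$, are allowed). For a lattice $\Lambda\subset\mathbb{R}^{m}$ ($m=2N$) with Voronoi region $\mathcal{V}_\Lambda$: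 the sequence is Poltyrev-good if, for i.i.d. Gaussian noise $\mathbf{Z}\sim\mathcal{N}(0,\sigma_Z^2 I_m)$ with $\mathrm{Vol}(\mathcal{V}_\Lambda)^{2/m}/(2\pi e\sigma_Z^2)$ fixed and greater than $1$, $\Pr(\mathbf{Z}\notin\mathcal{V}_\Lambda)\to0$ as $m\to\infty$; it is good for MSE quantization if the normalized second moment $G(\Lambda)=\sigma^2(\Lambda)/\mathrm{Vol}(\mathcal{V}_\Lambda)^{2/m}$ tends to $1/(2\pi e)$, where $\sigma^2(\Lambda)=\frac{1}{m}\mathbb{E}\|\mathbf{U}\|^2$ with $\mathbf{U}$ uniform on $\mathcal{V}_\Lambda$. *)

theory Defs
  imports "HOL-Probability.Probability" "HOL-Computational_Algebra.Squarefree"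
begin

definition xi :: "int \<Rightarrow> complex" where
  "xi d = (if d mod 4 = 1 then (1 + Complex 0 (sqrt (real_of_int (- d)))) / 2
           else Complex 0 (sqrt (real_of_int (- d))))"

definition OK :: "int \<Rightarrow> complex set" where
  "OK d = {of_int a + of_int b * xi d | a b. True}"

definition is_ideal_OK :: "int \<Rightarrow> complex set \<Rightarrow> bool" where
  "is_ideal_OK d P \<longleftrightarrow> P \<subseteq> OK d \<and> 0 \<in> P \<and>
     (\<forall>x\<in>P. \<forall>y\<in>P. x + y \<in> P) \<and> (\<forall>x\<in>P. - x \<in> P) \<and>
     (\<forall>a\<in>OK d. \<forall>x\<in>P. a * x \<in> P)"

definition prime_ideal_above :: "int \<Rightarrow> complex set \<Rightarrow> int \<Rightarrow> bool" where
  "prime_ideal_above d P p \<longleftrightarrow> is_ideal_OK d P \<and> 1 \<notin> P \<and>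
     (\<forall>a\<in>OK d. \<forall>b\<in>OK d. a * b \<in> P \<longrightarrow> a \<in> P \<or> b \<in> P) \<and>
     prime p \<and> of_int p \<in> P"

text \<open>Vectors of C^N are functions nat => complex, only indices i < N matter.
  The code C = {G y} over F_{p^f}, transported by the ring isomorphism M to
  O_K/P, is the image mod P of a lift G (entries in O_K) of the generator
  matrix; so lambda is in Lambda iff lambda = G y mod P componentwise for
  some y in O_K^n.\<close>

definition constrA ::
  "int \<Rightarrow> complex set \<Rightarrow> nat \<Rightarrow> nat \<Rightarrow> (nat \<Rightarrow> nat \<Rightarrow> complex) \<Rightarrow> (nat \<Rightarrow> complex) set" where
  "constrA d P N n G = {lam. (\<forall>i<N. lam i \<in> OK d) \<and> (\<forall>i. N \<le> i \<longrightarrow> lam i = 0) \<and>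
      (\<exists>y. (\<forall>j<n. y j \<in> OK d) \<and> (\<forall>i<N. lam i - (\<Sum>j<n. G i j * y j) \<in> P))}"

definition is_constrA_lattice :: "int \<Rightarrow> nat \<Rightarrow> (nat \<Rightarrow> complex) set \<Rightarrow> bool" where
  "is_constrA_lattice d N L \<longleftrightarrow>
     (\<exists>P p n G (\<gamma>::real). prime_ideal_above d P p \<and> n \<le> N \<and>
        (\<forall>i<N. \<forall>j<n. G i j \<in> OK d) \<and> \<gamma> > 0 \<and>
        L = (\<lambda>lam. \<lambda>i. complex_of_real \<gamma> * lam i) ` constrA d P N n G)"

definition vnorm :: "nat \<Rightarrow> (nat \<Rightarrow> complex) \<Rightarrow> real" where
  "vnorm N x = sqrt (\<Sum>i<N. (cmod (x i))\<^sup>2)"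

definition Leb :: "nat \<Rightarrow> (nat \<Rightarrow> complex) measure" where
  "Leb N = PiM {..<N} (\<lambda>_. lborel)"

definition voronoi :: "nat \<Rightarrow> (nat \<Rightarrow> complex) set \<Rightarrow> (nat \<Rightarrow> complex) set" where
  "voronoi N L = {x \<in> space (Leb N). \<forall>lam\<in>L. vnorm N x \<le> vnorm N (x - lam)}"

definition vol_vor :: "nat \<Rightarrow> (nat \<Rightarrow> complex) set \<Rightarrow> real" where
  "vol_vor N L = measure (Leb N) (voronoi N L)"

text \<open>Law of i.i.d. N(0, s2) noise on the 2N real coordinates.\<close>
definition gauss_C :: "real \<Rightarrow> complex \<Rightarrow> real" where
  "gauss_C s2 z = exp (- (cmod z)\<^sup>2 / (2 * s2)) / (2 * pi * s2)"

definition gauss_noise :: "nat \<Rightarrow> real \<Rightarrow> (nat \<Rightarrow> complex) measure" where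
  "gauss_noise N s2 = PiM {..<N} (\<lambda>_. density lborel (\<lambda>z. ennreal (gauss_C s2 z)))"

definition err_prob :: "nat \<Rightarrow> (nat \<Rightarrow> complex) set \<Rightarrow> real \<Rightarrow> real" where
  "err_prob N L s2 = measure (gauss_noise N s2) (space (gauss_noise N s2) - voronoi N L)"

definition second_moment :: "nat \<Rightarrow> (nat \<Rightarrow> complex) set \<Rightarrow> real" where
  "second_moment N L =
     (1 / real (2 * N)) * ((\<integral>x\<in>voronoi N L. (vnorm N x)\<^sup>2 \<partial>Leb N) / vol_vor N L)"

definition nsm :: "nat \<Rightarrow> (nat \<Rightarrow> complex) set \<Rightarrow> real" where
  "nsm N L = second_moment N L / vol_vor N L powr (2 / real (2 * N))"

definition poltyrev_good :: "(nat \<Rightarrow> nat) \<Rightarrow> (nat \<Rightarrow> (nat \<Rightarrow> complex) set) \<Rightarrow> bool" where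
  "poltyrev_good N L \<longleftrightarrow> (\<forall>\<mu>::real. \<mu> > 1 \<longrightarrow>
     (\<lambda>k. err_prob (N k) (L k)
            (vol_vor (N k) (L k) powr (2 / real (2 * N k)) / (2 * pi * exp 1 * \<mu>)))
     \<longlonglongrightarrow> 0)"

definition mse_good :: "(nat \<Rightarrow> nat) \<Rightarrow> (nat \<Rightarrow> (nat \<Rightarrow> complex) set) \<Rightarrow> bool" where
  "mse_good N L \<longleftrightarrow> (\<lambda>k. nsm (N k) (L k)) \<longlonglongrightarrow> 1 / (2 * pi * exp 1)"

end

theory Submission
  imports Defs "HOL-Library.Function_Algebras" "HOL-Real_Asymp.Real_Asymp"
begin

text \<open>
  The lattices come from one-dimensional codes. Take a prime \<open>p\<close> modulo which the minimal polynomial of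
  \<open>xi d\<close> has a root, let \<open>P\<close> be the corresponding prime ideal of index \<open>p\<close>, and consider the codes spanned
  by a vector \<open>g\<close> with \<open>g 0 = 1\<close> and the other entries in \<open>{0..<p}\<close>. A vector of \<open>OK d\<close>-integers lying outside
  \<open>P\<close> in some coordinate belongs to at most one of these \<open>p ^ (N - 1)\<close> lattices, and the nonzero vectors with
  all coordinates in \<open>P\<close> have norm at least \<open>sqrt p\<close>. So averaging over \<open>g\<close> bounds sums of short-range functions
  over the nonzero lattice vectors by the corresponding sums over all integer vectors (a Minkowski-Hlawka bound).

  This average is applied once, to the sum of two overlap functions. One is the Lebesgue measure of
  the intersection of a ball slightly larger than the Voronoi cell with its translates: it is the second moment of
  the number of lattice points near a uniform point of the cell, and by Chebyshev's inequality almost all of the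
  cell lies in that ball. The other is the Gaussian measure of the intersections of a ball slightly
  smaller than the cell, and gives a union bound for the error probability. The prime is taken about as large
  as \<open>N ^ (2 * N)\<close>: then \<open>p powr (1 / N)\<close> is polynomial in \<open>N\<close>, so that the crude covering radius does no harm
  against exponentially small probabilities, but is still large enough to keep \<open>sqrt p\<close> above the diameter of the balls.
  Ball volumes are only ever compared with Gaussian integrals.
\<close>

section \<open>Lebesgue and Gaussian measure on complex vectors\<close>

text \<open>One lattice has to serve both purposes, yet after normalisation the Lebesgue overlap sum
  is about 1 on average while the Gaussian one is about 0, so a bound on their total does not by
  itself make the Gaussian part small. Chebyshev's inequality also supplies the missing lower bound:
  since the part of the cell inside the larger ball has at most the volume of the cell, the Lebesgue
  sum is nearly 1 or more for every lattice of the family. An upper bound of the form 1 plus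
  something small on the total therefore controls both excesses at once. A second obstacle is that
  Poltyrev goodness asks for every fixed noise margin above 1, whereas one application of the
  average treats one margin. The margin is taken as \<open>exp (2 * \<beta>)\<close> with
  \<open>\<beta>\<close> tending to 0 along the sequence, and all other margins follow because the
  error probability is monotone in the noise variance.\<close>

lemma nn_integral_gaussian_real:
  assumes "0 < (s::real)"
  shows "(\<integral>\<^sup>+x. ennreal (exp (- (s * x\<^sup>2))) \<partial>lborel) = ennreal (sqrt (pi / s))"
proof -
  define \<sigma> where "\<sigma> = sqrt (1 / (2 * s))"
  have sg: "\<sigma> > 0" "\<sigma>\<^sup>2 = 1 / (2 * s)" using assms by (auto simp: \<sigma>_def)
  interpret prob_space "density lborel (normal_density 0 \<sigma>)"
    by (rule prob_space_normal_density[OF sg(1)])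
  have 1: "(\<integral>\<^sup>+x. ennreal (normal_density 0 \<sigma> x) \<partial>lborel) = 1"
    using emeasure_space_1 by (simp add: emeasure_density)
  have nd: "normal_density 0 \<sigma> x = sqrt (s / pi) * exp (- (s * x\<^sup>2))" for x
    using assms by (simp add: normal_density_def sg(2) real_sqrt_divide field_simps)
  have "(\<integral>\<^sup>+x. ennreal (exp (- (s * x\<^sup>2))) \<partial>lborel)
      = (\<integral>\<^sup>+x. ennreal (sqrt (pi / s)) * ennreal (normal_density 0 \<sigma> x) \<partial>lborel)"
    using assms by (intro nn_integral_cong)
      (simp add: nd ennreal_mult[symmetric] mult.assoc[symmetric] real_sqrt_mult[symmetric])
  also have "\<dots> = ennreal (sqrt (pi / s))"
    by (subst nn_integral_cmult) (auto simp: 1)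
  finally show ?thesis .
qed

lemma nn_integral_gaussian_complex:
  assumes "0 < (s::real)"
  shows "(\<integral>\<^sup>+z. ennreal (exp (- (s * (cmod z)\<^sup>2))) \<partial>lborel) = ennreal (pi / s)"
proof -
  have "(\<integral>\<^sup>+z. ennreal (exp (- (s * (cmod z)\<^sup>2))) \<partial>lborel)
     = (\<integral>\<^sup>+z. (\<Prod>b\<in>(Basis::complex set). ennreal (exp (- (s * (inner z b)\<^sup>2)))) \<partial>lborel)"
  proof (intro nn_integral_cong)
    fix z :: complex
    have "exp (- (s * (cmod z)\<^sup>2)) = exp (- (s * (Re z)\<^sup>2)) * exp (- (s * (Im z)\<^sup>2))"
      by (simp add: cmod_power2 exp_add[symmetric] algebra_simps)
    then show "ennreal (exp (- (s * (cmod z)\<^sup>2))) = (\<Prod>b\<in>Basis. ennreal (exp (- (s * (inner z b)\<^sup>2))))"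
      by (simp add: Basis_complex_def ennreal_mult)
  qed
  also have "\<dots> = (\<Prod>b\<in>(Basis::complex set). ennreal (sqrt (pi / s)))"
    by (subst nn_integral_lborel_prod) (auto simp: nn_integral_gaussian_real[OF assms])
  also have "\<dots> = ennreal (pi / s)"
    using assms by (simp add: Basis_complex_def ennreal_mult[symmetric] power2_eq_square)
  finally show ?thesis .
qed

interpretation Leb: product_sigma_finite "\<lambda>_::nat. lborel :: complex measure"
  by standard

lemma space_Leb: "space (Leb N) = {..<N} \<rightarrow>\<^sub>E UNIV"
  by (simp add: Leb_def space_PiM)

lemma measurable_Leb_component [measurable]: "i < N \<Longrightarrow> (\<lambda>x. x i) \<in> borel_measurable (Leb N)"
  unfolding Leb_def using measurable_component_singleton[of i "{..<N}" "\<lambda>_. lborel"] by simp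

lemma measurable_vnorm [measurable]: "vnorm N \<in> borel_measurable (Leb N)"
  unfolding vnorm_def by measurable

lemma measurable_vnorm_diff [measurable]: "(\<lambda>x. vnorm N (x - l)) \<in> borel_measurable (Leb N)"
  unfolding vnorm_def fun_diff_def by measurable

lemma measurable_Leb_affine [measurable]:
  "(\<lambda>x. \<lambda>i\<in>{..<N}. l i + c * x i) \<in> measurable (Leb N) (Leb N)"
proof -
  have "(\<lambda>x. \<lambda>i\<in>{..<N}. l i + c * x i) \<in> measurable (Leb N) (PiM {..<N} (\<lambda>_. lborel))"
  proof (rule measurable_restrict)
    fix i assume "i \<in> {..<N}"
    then have [measurable]: "(\<lambda>x. x i) \<in> borel_measurable (Leb N)"
      by (simp add: measurable_Leb_component)
    show "(\<lambda>x. l i + c * x i) \<in> measurable (Leb N) lborel" by simp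
  qed
  then show ?thesis by (simp add: Leb_def)
qed

text \<open>Uniqueness of product measures reduces the claim to boxes, where each complex coordinate
  contributes the factor \<open>t\<^sup>2\<close> of a dilation of the plane.\<close>

lemma Leb_affine:
  assumes "0 < (t::real)"
  shows "Leb N = density (distr (Leb N) (Leb N) (\<lambda>x. \<lambda>i\<in>{..<N}. l i + of_real t * x i))
                   (\<lambda>_. ennreal (t ^ (2 * N)))"
proof -
  have "density (distr (Leb N) (Leb N) (\<lambda>x. \<lambda>i\<in>{..<N}. l i + of_real t * x i))
                   (\<lambda>_. ennreal (t ^ (2 * N))) = PiM {..<N} (\<lambda>_. lborel)"
  proof (rule Leb.PiM_eqI)
    let ?f = "\<lambda>x. \<lambda>i\<in>{..<N}. l i + of_real t * x i"
    fix A :: "nat \<Rightarrow> complex set" assume A: "\<And>i. i \<in> {..<N} \<Longrightarrow> A i \<in> sets lborel"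
    define B where "B i = (\<lambda>z. l i + of_real t * z) -` A i" for i
    have mB: "i < N \<Longrightarrow> B i \<in> sets lborel" for i
      unfolding B_def using A[of i] by (auto intro!: measurable_sets_borel[where M=borel])
    have setA: "Pi\<^sub>E {..<N} A \<in> sets (Leb N)"
      unfolding Leb_def using A by (intro sets_PiM_I_finite) auto
    have vim: "?f -` Pi\<^sub>E {..<N} A \<inter> space (Leb N) = Pi\<^sub>E {..<N} B"
    proof (intro set_eqI)
      fix x
      show "x \<in> ?f -` Pi\<^sub>E {..<N} A \<inter> space (Leb N) \<longleftrightarrow> x \<in> Pi\<^sub>E {..<N} B"
        unfolding space_Leb B_def PiE_iff vimage_def Int_iff mem_Collect_eq restrict_extensional by auto
    qed
    have one: "ennreal (t\<^sup>2) * emeasure lborel (B i) = emeasure lborel (A i)" if "i < N" for i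
    proof -
      have "emeasure lborel (A i) =
         emeasure (density (distr lborel borel (\<lambda>x. l i + t *\<^sub>R x)) (\<lambda>_. \<bar>t\<bar>^DIM(complex))) (A i)"
        using lborel_affine[of t "l i"] assms by simp
      also have "\<dots> = ennreal (t\<^sup>2) * emeasure lborel (B i)"
        using A[of i] that assms
        by (simp add: emeasure_density nn_integral_cmult emeasure_distr
              B_def scaleR_conv_of_real)
      finally show ?thesis by simp
    qed
    have "emeasure (density (distr (Leb N) (Leb N) ?f) (\<lambda>_. ennreal (t ^ (2 * N)))) (Pi\<^sub>E {..<N} A)
       = ennreal (t ^ (2 * N)) * emeasure (Leb N) (Pi\<^sub>E {..<N} B)"
      using setA by (simp add: emeasure_density nn_integral_cmult emeasure_distr
              vim)
    also have "\<dots> = (\<Prod>i<N. ennreal (t\<^sup>2) * emeasure lborel (B i))"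
      using assms mB Leb.emeasure_PiM[of "{..<N}" B]
      by (simp add: Leb_def prod.distrib power_mult ennreal_power)
    also have "\<dots> = (\<Prod>i\<in>{..<N}. emeasure lborel (A i))"
      by (intro prod.cong) (auto simp: one)
    finally show "emeasure (density (distr (Leb N) (Leb N) ?f) (\<lambda>_. ennreal (t ^ (2 * N)))) (Pi\<^sub>E {..<N} A)
       = (\<Prod>i\<in>{..<N}. emeasure lborel (A i))" .
  qed (auto simp: Leb_def)
  then show ?thesis by (simp add: Leb_def)
qed

lemma nn_integral_Leb_affine:
  assumes "0 < (t::real)" and [measurable]: "f \<in> borel_measurable (Leb N)"
  shows "(\<integral>\<^sup>+x. f x \<partial>Leb N)
       = ennreal (t ^ (2 * N)) * (\<integral>\<^sup>+x. f (\<lambda>i\<in>{..<N}. l i + of_real t * x i) \<partial>Leb N)"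
proof -
  have "(\<integral>\<^sup>+x. f x \<partial>Leb N) =
     (\<integral>\<^sup>+x. f x \<partial>density (distr (Leb N) (Leb N) (\<lambda>x. \<lambda>i\<in>{..<N}. l i + of_real t * x i))
                   (\<lambda>_. ennreal (t ^ (2 * N))))"
    using Leb_affine[OF assms(1)] by simp
  also have "\<dots> = ennreal (t ^ (2 * N)) * (\<integral>\<^sup>+x. f (\<lambda>i\<in>{..<N}. l i + of_real t * x i) \<partial>Leb N)"
    by (simp add: nn_integral_density nn_integral_cmult nn_integral_distr)
  finally show ?thesis .
qed

lemma nn_integral_Leb_scale:
  assumes "0 < (t::real)" and "f \<in> borel_measurable (Leb N)"
  shows "(\<integral>\<^sup>+x. f x \<partial>Leb N)
       = ennreal (t ^ (2 * N)) * (\<integral>\<^sup>+x. f (\<lambda>i\<in>{..<N}. of_real t * x i) \<partial>Leb N)"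
  using nn_integral_Leb_affine[OF assms, of "\<lambda>_. 0"] by simp

text \<open>Points of \<open>space (Leb N)\<close> are \<open>undefined\<close> from index
  \<open>N\<close> on, while lattice vectors are 0 there. Subtracting a lattice vector therefore
  stays in the space, so pointwise subtraction can serve as translation.\<close>

lemma Leb_translate_eq:
  assumes "\<And>i. N \<le> i \<Longrightarrow> l i = 0" "x \<in> space (Leb N)"
  shows "x - l = (\<lambda>i\<in>{..<N}. - l i + of_real 1 * x i)"
  using assms by (fastforce simp: space_Leb PiE_iff extensional_def)

lemma Leb_translate_space:
  assumes "\<And>i. N \<le> i \<Longrightarrow> l i = 0" "x \<in> space (Leb N)"
  shows "x - l \<in> space (Leb N)"
  by (subst Leb_translate_eq[OF assms]) (auto simp: space_Leb)

lemma measurable_Leb_translate [measurable]: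
  assumes "\<And>i. N \<le> i \<Longrightarrow> l i = 0"
  shows "(\<lambda>x. x - l) \<in> measurable (Leb N) (Leb N)"
proof -
  have "(\<lambda>x. \<lambda>i\<in>{..<N}. - l i + of_real 1 * x i) \<in> measurable (Leb N) (Leb N)"
    using measurable_Leb_affine[where l="\<lambda>i. - l i" and c="of_real 1"] by simp
  then show ?thesis
    by (subst measurable_cong[OF Leb_translate_eq[OF assms]]) auto
qed

lemma nn_integral_Leb_translate:
  assumes l: "\<And>i. N \<le> i \<Longrightarrow> l i = 0" and f: "f \<in> borel_measurable (Leb N)"
  shows "(\<integral>\<^sup>+x. f (x - l) \<partial>Leb N) = (\<integral>\<^sup>+x. f x \<partial>Leb N)"
proof -
  have "(\<integral>\<^sup>+x. f (x - l) \<partial>Leb N) = (\<integral>\<^sup>+x. f (\<lambda>i\<in>{..<N}. - l i + of_real 1 * x i) \<partial>Leb N)"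
    using Leb_translate_eq[OF l] by (intro nn_integral_cong) simp
  also have "\<dots> = (\<integral>\<^sup>+x. f x \<partial>Leb N)"
    using nn_integral_Leb_affine[OF zero_less_one f, of "\<lambda>i. - l i"] by simp
  finally show ?thesis .
qed

lemma vnorm_nonneg [simp]: "0 \<le> vnorm N x"
  by (simp add: vnorm_def sum_nonneg)

lemma vnorm_sq: "(vnorm N x)\<^sup>2 = (\<Sum>i<N. (cmod (x i))\<^sup>2)"
  by (simp add: vnorm_def sum_nonneg)

lemma vnorm_L2: "vnorm N x = L2_set (\<lambda>i. cmod (x i)) {..<N}"
  by (simp add: vnorm_def L2_set_def)

lemma vnorm_triangle: "vnorm N (x + y) \<le> vnorm N x + vnorm N y"
proof -
  have "vnorm N (x + y) \<le> L2_set (\<lambda>i. cmod (x i) + cmod (y i)) {..<N}"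
    unfolding vnorm_L2 by (intro L2_set_mono) (auto simp: norm_triangle_ineq)
  also have "\<dots> \<le> vnorm N x + vnorm N y" unfolding vnorm_L2 by (rule L2_set_triangle_ineq)
  finally show ?thesis .
qed

lemma vnorm_minus_commute: "vnorm N (x - y) = vnorm N (y - x)"
  by (simp add: vnorm_def norm_minus_commute)

lemma vnorm_diff_triangle: "vnorm N (x - z) \<le> vnorm N (x - y) + vnorm N (y - z)"
  using vnorm_triangle[of N "x - y" "y - z"] by simp

lemma vnorm_scale:
  assumes "0 \<le> t"
  shows "vnorm N (\<lambda>i\<in>{..<N}. of_real t * x i) = t * vnorm N x"
proof -
  have "(\<Sum>i<N. (cmod ((\<lambda>i\<in>{..<N}. of_real t * x i) i))\<^sup>2) = t\<^sup>2 * (\<Sum>i<N. (cmod (x i))\<^sup>2)"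
    by (simp add: norm_mult power_mult_distrib sum_distrib_left)
  then show ?thesis using assms by (simp add: vnorm_def real_sqrt_mult)
qed

lemma nn_integral_gaussian_Leb:
  assumes "0 < (s::real)"
  shows "(\<integral>\<^sup>+x. ennreal (exp (- (s * (vnorm N x)\<^sup>2))) \<partial>Leb N) = ennreal ((pi / s) ^ N)"
proof -
  have "(\<integral>\<^sup>+x. ennreal (exp (- (s * (vnorm N x)\<^sup>2))) \<partial>Leb N)
     = (\<integral>\<^sup>+x. (\<Prod>i<N. ennreal (exp (- (s * (cmod (x i))\<^sup>2)))) \<partial>Leb N)"
    by (intro nn_integral_cong)
       (simp add: vnorm_sq sum_distrib_left exp_sum[symmetric] sum_negf[symmetric] prod_ennreal)
  also have "\<dots> = (\<Prod>i<N. ennreal (pi / s))"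
    unfolding Leb_def by (subst Leb.product_nn_integral_prod) (auto simp: nn_integral_gaussian_complex[OF assms])
  finally show ?thesis using assms by (simp add: ennreal_power)
qed

text \<open>With one radial density against \<open>Leb N\<close>, Gaussian and Lebesgue estimates
  can share the same sets and the same integrals.\<close>

lemma gauss_noise_density:
  assumes "0 < s2"
  shows "gauss_noise N s2 = density (Leb N)
     (\<lambda>x. ennreal (exp (- (vnorm N x)\<^sup>2 / (2 * s2)) / (2 * pi * s2) ^ N))"
proof -
  have [measurable]: "gauss_C s2 \<in> borel_measurable borel"
    unfolding gauss_C_def by measurable
  have fin: "(\<integral>\<^sup>+z. ennreal (gauss_C s2 z) \<partial>lborel) = 1"
  proof -
    have "(\<integral>\<^sup>+z. ennreal (gauss_C s2 z) \<partial>lborel)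
      = (\<integral>\<^sup>+z. ennreal (1 / (2 * pi * s2)) * ennreal (exp (- ((1 / (2 * s2)) * (cmod z)\<^sup>2))) \<partial>lborel)"
      using assms by (intro nn_integral_cong) (simp add: gauss_C_def ennreal_mult[symmetric])
    also have "\<dots> = 1"
      using assms nn_integral_gaussian_complex[of "1 / (2 * s2)"]
      by (subst nn_integral_cmult) (auto simp: ennreal_mult[symmetric] simp del: times_divide_eq_left,
          simp add: field_simps)
    finally show ?thesis .
  qed
  interpret G: prob_space "density lborel (\<lambda>z. ennreal (gauss_C s2 z))"
    by standard (simp add: emeasure_density fin)
  interpret G: product_sigma_finite "\<lambda>_::nat. density lborel (\<lambda>z. ennreal (gauss_C s2 z))"
    by standard
  have prodeq: "ennreal (exp (- (vnorm N x)\<^sup>2 / (2 * s2)) / (2 * pi * s2) ^ N)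
      = (\<Prod>i<N. ennreal (gauss_C s2 (x i)))" for x
    using assms by (simp add: gauss_C_def prod_ennreal vnorm_sq prod_dividef exp_sum[symmetric] sum_negf
        sum_divide_distrib)
  have "density (Leb N) (\<lambda>x. \<Prod>i<N. ennreal (gauss_C s2 (x i))) = gauss_noise N s2"
    unfolding gauss_noise_def
  proof (rule G.PiM_eqI)
    fix A :: "nat \<Rightarrow> complex set"
    assume "\<And>i. i \<in> {..<N} \<Longrightarrow> A i \<in> sets (density lborel (\<lambda>z. ennreal (gauss_C s2 z)))"
    then have A: "\<And>i. i < N \<Longrightarrow> A i \<in> sets borel" by simp
    have setA: "Pi\<^sub>E {..<N} A \<in> sets (Leb N)"
      unfolding Leb_def using A by (intro sets_PiM_I_finite) auto
    have "emeasure (density (Leb N) (\<lambda>x. \<Prod>i<N. ennreal (gauss_C s2 (x i)))) (Pi\<^sub>E {..<N} A)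
       = (\<integral>\<^sup>+x. (\<Prod>i<N. ennreal (gauss_C s2 (x i))) * indicator (Pi\<^sub>E {..<N} A) x \<partial>Leb N)"
      by (subst emeasure_density) (use setA in measurable)
    also have "\<dots> = (\<integral>\<^sup>+x. (\<Prod>i<N. ennreal (gauss_C s2 (x i)) * indicator (A i) (x i)) \<partial>Leb N)"
    proof (intro nn_integral_cong)
      fix x assume "x \<in> space (Leb N)"
      then have "x \<in> Pi\<^sub>E {..<N} A \<longleftrightarrow> (\<forall>i<N. x i \<in> A i)"
        by (auto simp: space_Leb PiE_iff)
      then have "indicator (Pi\<^sub>E {..<N} A) x = (\<Prod>i<N. indicator (A i) (x i) :: ennreal)"
        by (cases "\<forall>i<N. x i \<in> A i")
           (auto intro!: prod_zero[symmetric] simp: indicator_def)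
      then show "(\<Prod>i<N. ennreal (gauss_C s2 (x i))) * indicator (Pi\<^sub>E {..<N} A) x =
        (\<Prod>i<N. ennreal (gauss_C s2 (x i)) * indicator (A i) (x i))"
        by (simp add: prod.distrib)
    qed
    also have "\<dots> = (\<Prod>i<N. \<integral>\<^sup>+z. ennreal (gauss_C s2 z) * indicator (A i) z \<partial>lborel)"
      unfolding Leb_def using A by (subst Leb.product_nn_integral_prod) auto
    also have "\<dots> = (\<Prod>i\<in>{..<N}. emeasure (density lborel (\<lambda>z. ennreal (gauss_C s2 z))) (A i))"
      using A by (intro prod.cong) (auto simp: emeasure_density)
    finally show "emeasure (density (Leb N) (\<lambda>x. \<Prod>i<N. ennreal (gauss_C s2 (x i)))) (Pi\<^sub>E {..<N} A)
      = (\<Prod>i\<in>{..<N}. emeasure (density lborel (\<lambda>z. ennreal (gauss_C s2 z))) (A i))" .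
  qed (auto simp: Leb_def cong: sets_PiM_cong)
  then show ?thesis unfolding prodeq by (rule sym)
qed

section \<open>Ball volumes and Gaussian tails\<close>

definition cballN :: "nat \<Rightarrow> real \<Rightarrow> (nat \<Rightarrow> complex) set" where
  "cballN N r = {x \<in> space (Leb N). vnorm N x \<le> r}"

lemma sets_cballN [measurable]: "cballN N r \<in> sets (Leb N)"
  unfolding cballN_def by measurable

lemma indicator_translate_measurable [measurable]:
  "(\<lambda>x. indicator (cballN N r) (x - l) :: ennreal) \<in> borel_measurable (Leb N)"
  if "\<And>i. N \<le> i \<Longrightarrow> l i = 0"
  using measurable_compose[OF measurable_Leb_translate[OF that] borel_measurable_indicator[OF sets_cballN]] .

definition bvol :: "nat \<Rightarrow> real \<Rightarrow> real" where
  "bvol N r = measure (Leb N) (cballN N r)"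

text \<open>On the ball \<open>exp (s * (r\<^sup>2 - (vnorm N x)\<^sup>2))\<close> is at least 1,
  and its integral over the whole space is Gaussian.\<close>

lemma emeasure_cballN_le:
  assumes "0 < s"
  shows "emeasure (Leb N) (cballN N r) \<le> ennreal (exp (s * r\<^sup>2) * (pi / s) ^ N)"
proof -
  have "emeasure (Leb N) (cballN N r) = (\<integral>\<^sup>+x. indicator (cballN N r) x \<partial>Leb N)"
    by simp
  also have "\<dots> \<le> (\<integral>\<^sup>+x. ennreal (exp (s * r\<^sup>2)) * ennreal (exp (- (s * (vnorm N x)\<^sup>2))) \<partial>Leb N)"
  proof (intro nn_integral_mono)
    fix x
    have "s * (vnorm N x)\<^sup>2 \<le> s * r\<^sup>2" if "vnorm N x \<le> r"
      using that assms by (intro mult_left_mono power_mono) auto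
    then show "indicator (cballN N r) x \<le> ennreal (exp (s * r\<^sup>2)) * ennreal (exp (- (s * (vnorm N x)\<^sup>2)))"
      by (auto simp: indicator_def cballN_def ennreal_mult[symmetric] exp_add[symmetric])
  qed
  also have "\<dots> = ennreal (exp (s * r\<^sup>2)) * ennreal ((pi / s) ^ N)"
    by (subst nn_integral_cmult) (auto simp: nn_integral_gaussian_Leb[OF assms])
  finally show ?thesis using assms by (simp add: ennreal_mult)
qed

lemma emeasure_cballN: "emeasure (Leb N) (cballN N r) = ennreal (bvol N r)"
proof -
  have "emeasure (Leb N) (cballN N r) < \<top>"
    by (rule le_less_trans[OF emeasure_cballN_le[OF zero_less_one]]) simp
  then show ?thesis unfolding bvol_def by (intro emeasure_eq_ennreal_measure) auto
qed

lemma bvol_nonneg [simp]: "0 \<le> bvol N r"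
  by (simp add: bvol_def)

lemma bvol_mono: "r \<le> r' \<Longrightarrow> bvol N r \<le> bvol N r'"
proof -
  assume "r \<le> r'"
  then have "emeasure (Leb N) (cballN N r) \<le> emeasure (Leb N) (cballN N r')"
    by (intro emeasure_mono) (auto simp: cballN_def)
  then show ?thesis by (simp add: emeasure_cballN)
qed

lemma bvol_upper:
  assumes "0 < N" "0 < r"
  shows "bvol N r \<le> (pi * exp 1 * r\<^sup>2 / real N) ^ N"
proof -
  \<comment> \<open>Minimises \<open>exp (s * r\<^sup>2) * (pi / s) ^ N\<close> over
    \<open>s\<close>.\<close>
  define s where "s = real N / r\<^sup>2"
  have s: "0 < s" using assms by (simp add: s_def)
  have "ennreal (bvol N r) \<le> ennreal (exp (s * r\<^sup>2) * (pi / s) ^ N)"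
    using emeasure_cballN_le[OF s] by (simp add: emeasure_cballN)
  then have "bvol N r \<le> exp (s * r\<^sup>2) * (pi / s) ^ N"
    using s by (simp add: ennreal_le_iff)
  also have "\<dots> = (pi * exp 1 * r\<^sup>2 / real N) ^ N"
    using assms by (simp add: s_def exp_of_nat_mult[symmetric] power_mult_distrib power_divide)
  finally show ?thesis .
qed

lemma bvol_scale:
  assumes "0 < t"
  shows "bvol N (t * r) = t ^ (2 * N) * bvol N r"
proof -
  have "emeasure (Leb N) (cballN N (t * r)) = (\<integral>\<^sup>+x. indicator (cballN N (t * r)) x \<partial>Leb N)"
    by simp
  also have "\<dots> = ennreal (t ^ (2 * N)) * (\<integral>\<^sup>+x. indicator (cballN N (t * r)) (\<lambda>i\<in>{..<N}. of_real t * x i) \<partial>Leb N)"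
    by (rule nn_integral_Leb_scale[OF assms]) simp
  also have "(\<integral>\<^sup>+x. indicator (cballN N (t * r)) (\<lambda>i\<in>{..<N}. of_real t * x i) \<partial>Leb N)
     = (\<integral>\<^sup>+x. indicator (cballN N r) x \<partial>Leb N)"
    using assms vnorm_scale[of t N]
    by (intro nn_integral_cong) (auto simp: indicator_def cballN_def space_Leb)
  finally show ?thesis
    using assms by (simp add: emeasure_cballN ennreal_mult[symmetric])
qed

text \<open>Change of variance: on \<open>S\<close> the density of variance \<open>s2\<close> is at
  most \<open>(x * exp (1 - x)) ^ N\<close> times the density of variance \<open>s2 * x\<close>,
  which has total mass 1. The sign condition \<open>dir\<close> covers both tails: outside the ball
  of squared radius \<open>2 * real N * s2 * x\<close> for \<open>x > 1\<close>, inside it for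
  \<open>x < 1\<close>.\<close>

lemma gauss_noise_chernoff:
  assumes s2: "0 < s2" and x: "0 < x" and S: "S \<in> sets (Leb N)"
    and dir: "\<And>y. y \<in> S \<Longrightarrow> 0 \<le> (1 - 1 / x) * ((vnorm N y)\<^sup>2 - 2 * real N * s2 * x)"
  shows "emeasure (gauss_noise N s2) S \<le> ennreal ((x * exp (1 - x)) ^ N)"
proof -
  let ?g = "\<lambda>y. exp (- (vnorm N y)\<^sup>2 / (2 * s2)) / (2 * pi * s2) ^ N"
  define c where "c = exp (- (real N * (x - 1))) / (2 * pi * s2) ^ N"
  define u where "u = 1 / (2 * s2 * x)"
  have pos: "0 < u" "0 \<le> c" using assms by (auto simp: u_def c_def)
  have "emeasure (gauss_noise N s2) S = (\<integral>\<^sup>+y. ennreal (?g y) * indicator S y \<partial>Leb N)"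
    unfolding gauss_noise_density[OF s2] by (rule emeasure_density) (use S in measurable)
  also have "\<dots> \<le> (\<integral>\<^sup>+y. ennreal c * ennreal (exp (- (u * (vnorm N y)\<^sup>2))) \<partial>Leb N)"
  proof (intro nn_integral_mono)
    fix y
    have "?g y \<le> c * exp (- (u * (vnorm N y)\<^sup>2))" if "y \<in> S"
    proof -
      have "0 \<le> (1 - 1 / x) * ((vnorm N y)\<^sup>2 - 2 * real N * s2 * x) / (2 * s2)"
        using dir[OF that] s2 by simp
      also have "\<dots> = (vnorm N y)\<^sup>2 / (2 * s2) - u * (vnorm N y)\<^sup>2 - real N * (x - 1)"
        using s2 x by (simp add: u_def field_simps)
      finally have "- (vnorm N y)\<^sup>2 / (2 * s2) \<le> - (real N * (x - 1)) - (u * (vnorm N y)\<^sup>2)" by simp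
      then have "exp (- (vnorm N y)\<^sup>2 / (2 * s2)) \<le> exp (- (real N * (x - 1))) * exp (- (u * (vnorm N y)\<^sup>2))"
        by (simp add: exp_add[symmetric])
      then show ?thesis using s2 by (simp add: c_def divide_right_mono)
    qed
    then show "ennreal (?g y) * indicator S y \<le> ennreal c * ennreal (exp (- (u * (vnorm N y)\<^sup>2)))"
      using pos by (auto simp: indicator_def ennreal_mult[symmetric] intro!: ennreal_leI)
  qed
  also have "\<dots> = ennreal (c * (pi / u) ^ N)"
    using pos by (subst nn_integral_cmult) (auto simp: nn_integral_gaussian_Leb ennreal_mult)
  also have "c * (pi / u) ^ N = (x * exp (1 - x)) ^ N"
  proof -
    have "exp (- (real N * (x - 1))) = exp (1 - x) ^ N"
      by (simp add: exp_of_nat_mult[symmetric] algebra_simps)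
    moreover have "(pi / u) ^ N = (2 * pi * s2) ^ N * x ^ N"
      by (simp add: u_def power_mult_distrib)
    ultimately show ?thesis using s2 by (simp add: c_def power_mult_distrib)
  qed
  finally show ?thesis .
qed

lemma prob_space_gauss_noise:
  assumes s2: "0 < s2" shows "prob_space (gauss_noise N s2)"
proof
  have "emeasure (gauss_noise N s2) (space (gauss_noise N s2))
    = (\<integral>\<^sup>+y. ennreal (1 / (2 * pi * s2) ^ N) * ennreal (exp (- ((1 / (2 * s2)) * (vnorm N y)\<^sup>2))) \<partial>Leb N)"
    unfolding gauss_noise_density[OF s2] using s2
    by (subst emeasure_density) (auto intro!: nn_integral_cong simp: ennreal_mult[symmetric])
  also have "\<dots> = 1"
    using s2 nn_integral_gaussian_Leb[of "1 / (2 * s2)" N]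
    by (subst nn_integral_cmult)
      (auto simp: ennreal_mult[symmetric] simp del: times_divide_eq_left, simp add: field_simps)
  finally show "emeasure (gauss_noise N s2) (space (gauss_noise N s2)) = 1" .
qed

lemma sets_gauss_noise: "0 < s2 \<Longrightarrow> sets (gauss_noise N s2) = sets (Leb N)"
  and space_gauss_noise: "0 < s2 \<Longrightarrow> space (gauss_noise N s2) = space (Leb N)"
  by (simp_all add: gauss_noise_density)

text \<open>Gaussian mass concentrates in the shell \<open>1 - \<delta> \<le> (vnorm N y)\<^sup>2 / (2 N s2) \<le> 1 + \<delta>\<close>, on which
  the density is almost constant.\<close>
lemma bvol_lower:
  assumes N: "0 < N" and r: "0 < r" and d: "0 < \<delta>" "\<delta> < 1"
    and half: "((1 + \<delta>) * exp (- \<delta>)) ^ N + ((1 - \<delta>) * exp \<delta>) ^ N \<le> 1 / 2"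
  shows "(pi * exp (1 - \<delta>) * r\<^sup>2 / (real N * (1 + \<delta>))) ^ N / 2 \<le> bvol N r"
proof -
  \<comment> \<open>The variance for which the outer radius of the shell is exactly
    \<open>r\<close>, so that the shell lies in the ball.\<close>
  define s2 where "s2 = r\<^sup>2 / (2 * real N * (1 + \<delta>))"
  have s2: "0 < s2" using assms by (simp add: s2_def)
  have r2: "r\<^sup>2 = 2 * real N * s2 * (1 + \<delta>)" using assms by (simp add: s2_def)
  let ?G = "gauss_noise N s2"
  let ?g = "\<lambda>y. exp (- (vnorm N y)\<^sup>2 / (2 * s2)) / (2 * pi * s2) ^ N"
  interpret G: prob_space ?G by (rule prob_space_gauss_noise[OF s2])
  define A where "A = {y \<in> space (Leb N). (vnorm N y)\<^sup>2 > 2 * real N * s2 * (1 + \<delta>)}"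
  define B where "B = {y \<in> space (Leb N). (vnorm N y)\<^sup>2 < 2 * real N * s2 * (1 - \<delta>)}"
  define C where "C = space (Leb N) - A - B"
  have m [measurable]: "A \<in> sets (Leb N)" "B \<in> sets (Leb N)" "C \<in> sets (Leb N)"
    unfolding A_def B_def C_def by measurable
  have eA: "emeasure ?G A \<le> ennreal (((1 + \<delta>) * exp (- \<delta>)) ^ N)"
    using gauss_noise_chernoff[OF s2, of "1 + \<delta>" A] d by (auto simp: A_def)
  have eB: "emeasure ?G B \<le> ennreal (((1 - \<delta>) * exp \<delta>) ^ N)"
  proof -
    have 1: "1 - 1 / (1 - \<delta>) \<le> 0" using d by (simp add: field_simps)
    have "emeasure ?G B \<le> ennreal (((1 - \<delta>) * exp (1 - (1 - \<delta>))) ^ N)"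
      by (rule gauss_noise_chernoff[OF s2 _ m(2)], use d in simp, rule mult_nonpos_nonpos[OF 1])
         (simp add: B_def)
    then show ?thesis by simp
  qed
  let ?a = "((1 + \<delta>) * exp (- \<delta>)) ^ N" and ?b = "((1 - \<delta>) * exp \<delta>) ^ N"
  have "A \<union> B \<union> C = space ?G"
    unfolding space_gauss_noise[OF s2] by (auto simp: A_def B_def C_def)
  then have "1 = emeasure ?G (A \<union> B \<union> C)"
    using G.emeasure_space_1 by simp
  also have "\<dots> \<le> emeasure ?G (A \<union> B) + emeasure ?G C"
    by (rule emeasure_subadditive) (auto simp: sets_gauss_noise[OF s2])
  also have "\<dots> \<le> (emeasure ?G A + emeasure ?G B) + emeasure ?G C"
    by (intro add_right_mono emeasure_subadditive) (auto simp: sets_gauss_noise[OF s2])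
  also have "\<dots> \<le> (ennreal ?a + ennreal ?b) + emeasure ?G C"
    by (intro add_mono eA eB order_refl)
  also have "ennreal ?a + ennreal ?b = ennreal (?a + ?b)"
    using d by (intro ennreal_plus[symmetric]) auto
  finally have 1: "1 \<le> ennreal (1 / 2) + emeasure ?G C"
    using add_right_mono[OF ennreal_leI[OF half]] by (rule order_trans)
  have "emeasure ?G C = (\<integral>\<^sup>+y. ennreal (?g y) * indicator C y \<partial>Leb N)"
    unfolding gauss_noise_density[OF s2] by (rule emeasure_density) measurable
  also have "\<dots> \<le> (\<integral>\<^sup>+y. ennreal (exp (- (real N * (1 - \<delta>))) / (2 * pi * s2) ^ N) * indicator (cballN N r) y \<partial>Leb N)"
  proof (intro nn_integral_mono)
    fix y
    have "?g y \<le> exp (- (real N * (1 - \<delta>))) / (2 * pi * s2) ^ N \<and> y \<in> cballN N r" if "y \<in> C"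
    proof
      have y: "(vnorm N y)\<^sup>2 \<le> r\<^sup>2" "2 * real N * s2 * (1 - \<delta>) \<le> (vnorm N y)\<^sup>2" "y \<in> space (Leb N)"
        using that by (auto simp: A_def B_def C_def r2)
      then show "y \<in> cballN N r" using r by (auto simp: cballN_def intro: power2_le_imp_le)
      \<comment> \<open>The density is largest at the inner radius; a mass of at least 1/2 under
        this ceiling forces volume.\<close>
      have "real N * (1 - \<delta>) \<le> (vnorm N y)\<^sup>2 / (2 * s2)"
        using y(2) s2 by (simp add: field_simps)
      then show "?g y \<le> exp (- (real N * (1 - \<delta>))) / (2 * pi * s2) ^ N"
        using s2 by (intro divide_right_mono) auto
    qed
    then show "ennreal (?g y) * indicator C y
      \<le> ennreal (exp (- (real N * (1 - \<delta>))) / (2 * pi * s2) ^ N) * indicator (cballN N r) y"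
      by (auto simp: indicator_def intro!: ennreal_leI)
  qed
  also have "\<dots> = ennreal (exp (- (real N * (1 - \<delta>))) / (2 * pi * s2) ^ N * bvol N r)"
    using s2 by (subst nn_integral_cmult) (auto simp: emeasure_cballN ennreal_mult[symmetric])
  finally have "1 \<le> ennreal (1 / 2) + ennreal (exp (- (real N * (1 - \<delta>))) / (2 * pi * s2) ^ N * bvol N r)"
    using 1 by (meson add_left_mono order_trans)
  also have "\<dots> = ennreal (1 / 2 + exp (- (real N * (1 - \<delta>))) / (2 * pi * s2) ^ N * bvol N r)"
    using s2 by (intro ennreal_plus[symmetric]) auto
  finally have "1 \<le> 1 / 2 + exp (- (real N * (1 - \<delta>))) / (2 * pi * s2) ^ N * bvol N r"
    using s2 by (simp del: ennreal_plus)
  then have "1 / 2 \<le> exp (- (real N * (1 - \<delta>))) / (2 * pi * s2) ^ N * bvol N r"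
    by linarith
  moreover have "a * q / 2 \<le> b" if "1 / 2 \<le> inverse a / q * b" "0 < a" "0 < q" for a q b :: real
    using that by (simp add: field_simps)
  ultimately have "exp (real N * (1 - \<delta>)) * (2 * pi * s2) ^ N / 2 \<le> bvol N r"
    using s2 unfolding exp_minus by simp
  also have "exp (real N * (1 - \<delta>)) * (2 * pi * s2) ^ N = (exp (1 - \<delta>) * (2 * pi * s2)) ^ N"
    by (simp only: exp_of_nat_mult power_mult_distrib)
  also have "exp (1 - \<delta>) * (2 * pi * s2) = pi * exp (1 - \<delta>) * r\<^sup>2 / (real N * (1 + \<delta>))"
    by (simp add: s2_def)
  finally show ?thesis .
qed

section \<open>Lattices and Voronoi cells\<close>

text \<open>Discreteness is stated as finiteness in balls, the form that yields countability and the
  existence of nearest lattice points.\<close>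

locale vec_lattice =
  fixes N :: nat and \<Lambda> :: "(nat \<Rightarrow> complex) set"
  assumes zero_mem: "0 \<in> \<Lambda>"
    and diff_mem: "\<And>l l'. l \<in> \<Lambda> \<Longrightarrow> l' \<in> \<Lambda> \<Longrightarrow> l - l' \<in> \<Lambda>"
    and supp: "\<And>l i. l \<in> \<Lambda> \<Longrightarrow> N \<le> i \<Longrightarrow> l i = 0"
    and locally_finite: "\<And>\<rho>. finite {l \<in> \<Lambda>. vnorm N l \<le> \<rho>}"
begin

lemma neg_mem: "l \<in> \<Lambda> \<Longrightarrow> - l \<in> \<Lambda>"
  using diff_mem[OF zero_mem, of l] by simp

lemma add_mem: "l \<in> \<Lambda> \<Longrightarrow> l' \<in> \<Lambda> \<Longrightarrow> l + l' \<in> \<Lambda>"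
  using diff_mem[of l "- l'"] neg_mem[of l'] by simp

lemma countable_mem: "countable \<Lambda>"
proof -
  have "\<Lambda> = (\<Union>k::nat. {l \<in> \<Lambda>. vnorm N l \<le> real k})"
  proof (intro equalityI subsetI)
    fix l assume "l \<in> \<Lambda>"
    moreover obtain k :: nat where "vnorm N l \<le> real k" using real_arch_simple by blast
    ultimately show "l \<in> (\<Union>k::nat. {l \<in> \<Lambda>. vnorm N l \<le> real k})" by auto
  qed auto
  also have "countable \<dots>"
    by (rule countable_UN) (auto intro!: countable_finite locally_finite)
  finally show ?thesis .
qed

lemma vnorm_pos: "l \<in> \<Lambda> \<Longrightarrow> l \<noteq> 0 \<Longrightarrow> 0 < vnorm N l"
proof -
  assume l: "l \<in> \<Lambda>" "l \<noteq> 0"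
  then obtain i where i: "l i \<noteq> 0" by (auto simp: fun_eq_iff)
  with supp[OF l(1)] have "i < N" by (meson not_le_imp_less)
  with i have "0 < (\<Sum>i<N. (cmod (l i))\<^sup>2)"
    by (intro sum_pos2[of _ i]) auto
  then show ?thesis by (simp add: vnorm_def)
qed

lemma translate_space: "x \<in> space (Leb N) \<Longrightarrow> l \<in> \<Lambda> \<Longrightarrow> x - l \<in> space (Leb N)"
  by (rule Leb_translate_space) (auto intro: supp)

lemma translate_measurable: "l \<in> \<Lambda> \<Longrightarrow> (\<lambda>x. x - l) \<in> measurable (Leb N) (Leb N)"
  by (rule measurable_Leb_translate) (auto intro: supp)

lemma nn_integral_translate:
  "l \<in> \<Lambda> \<Longrightarrow> f \<in> borel_measurable (Leb N) \<Longrightarrow> (\<integral>\<^sup>+x. f (x - l) \<partial>Leb N) = (\<integral>\<^sup>+x. f x \<partial>Leb N)"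
  by (rule nn_integral_Leb_translate) (auto intro: supp)

lemma count_space_translate:
  assumes "l0 \<in> \<Lambda>"
  shows "(\<integral>\<^sup>+l. f (l0 + l) \<partial>count_space \<Lambda>) = (\<integral>\<^sup>+l. f l \<partial>count_space \<Lambda>)"
proof (rule nn_integral_bij_count_space)
  show "bij_betw (\<lambda>l. l0 + l) \<Lambda> \<Lambda>"
  proof (rule bij_betwI[where g="\<lambda>l. l - l0"])
  qed (use assms in \<open>auto intro: add_mem diff_mem\<close>)
qed

lemma count_space_minus:
  "(\<integral>\<^sup>+l. f (- l) \<partial>count_space \<Lambda>) = (\<integral>\<^sup>+l. f l \<partial>count_space \<Lambda>)"
proof (rule nn_integral_bij_count_space)
  show "bij_betw uminus \<Lambda> \<Lambda>"
    by (rule bij_betwI[where g=uminus]) (auto intro: neg_mem)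
qed

section \<open>Periodization over a lattice\<close>

text \<open>Packing and covering are kept apart because the closed Voronoi cell covers but may
  overlap its translates on the boundary, while the open one packs but may leave gaps.\<close>

definition packs :: "(nat \<Rightarrow> complex) set \<Rightarrow> bool" where
  "packs F \<longleftrightarrow> F \<in> sets (Leb N) \<and>
     (\<forall>x\<in>space (Leb N). \<forall>l\<in>\<Lambda>. \<forall>l'\<in>\<Lambda>. x - l \<in> F \<longrightarrow> x - l' \<in> F \<longrightarrow> l = l')"

definition covers :: "(nat \<Rightarrow> complex) set \<Rightarrow> bool" where
  "covers F \<longleftrightarrow> F \<in> sets (Leb N) \<and> (\<forall>x\<in>space (Leb N). \<exists>l\<in>\<Lambda>. x - l \<in> F)"

text \<open>For the indicator of a ball of radius \<open>r\<close> this counts the lattice points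
  within \<open>r\<close> of \<open>x\<close>. Summing by \<open>count_space\<close> in
  \<open>ennreal\<close> lets Tonelli apply without any convergence condition.\<close>

definition periodize :: "((nat \<Rightarrow> complex) \<Rightarrow> ennreal) \<Rightarrow> (nat \<Rightarrow> complex) \<Rightarrow> ennreal" where
  "periodize w x = (\<integral>\<^sup>+l. w (x - l) \<partial>count_space \<Lambda>)"

lemma periodize_measurable [measurable]:
  assumes "w \<in> borel_measurable (Leb N)"
  shows "periodize w \<in> borel_measurable (Leb N)"
proof -
  have m: "(\<lambda>x. w (x - l)) \<in> borel_measurable (Leb N)" if "l \<in> \<Lambda>" for l
    using measurable_compose[OF translate_measurable[OF that] assms] .
  have "(\<lambda>x. \<integral>\<^sup>+l. w (x - l) \<partial>count_space \<Lambda>) \<in> borel_measurable (Leb N)"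
  proof (rule sigma_finite_measure.borel_measurable_nn_integral)
    show "sigma_finite_measure (count_space \<Lambda>)"
      by (rule sigma_finite_measure_count_space_countable[OF countable_mem])
    show "(\<lambda>(x, l). w (x - l)) \<in> borel_measurable (Leb N \<Otimes>\<^sub>M count_space \<Lambda>)"
      by (subst measurable_pair_swap_iff)
         (auto intro!: measurable_pair_measure_countable1 countable_mem m)
  qed
  then show ?thesis unfolding periodize_def .
qed

lemma periodize_shift:
  assumes "l \<in> \<Lambda>" shows "periodize w (x - l) = periodize w x"
proof -
  have *: "x - l - k = x - (l + k)" for k by (simp add: diff_diff_eq)
  show ?thesis
    unfolding periodize_def * by (rule count_space_translate[OF assms, of "\<lambda>k. w (x - k)"])
qed

text \<open>Unfolding: Tonelli, a translation by \<open>l\<close> and the reflection of the lattice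
  in 0 move the periodization from one factor to the other.\<close>

lemma nn_integral_periodize:
  assumes F: "F \<in> sets (Leb N)" and w: "w \<in> borel_measurable (Leb N)"
  shows "(\<integral>\<^sup>+x. indicator F x * periodize w x \<partial>Leb N)
       = (\<integral>\<^sup>+x. periodize (indicator F) x * w x \<partial>Leb N)"
proof -
  have m: "(\<lambda>x. w (x - l)) \<in> borel_measurable (Leb N)" "(\<lambda>x. indicator F (x - l) :: ennreal) \<in> borel_measurable (Leb N)"
    if "l \<in> \<Lambda>" for l
    using measurable_compose[OF translate_measurable[OF that] w]
      measurable_compose[OF translate_measurable[OF that] borel_measurable_indicator[OF F]] by auto
  note [measurable] = F w
  have "(\<integral>\<^sup>+x. indicator F x * periodize w x \<partial>Leb N)
     = (\<integral>\<^sup>+x. \<integral>\<^sup>+l. indicator F x * w (x - l) \<partial>count_space \<Lambda> \<partial>Leb N)"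
    unfolding periodize_def by (simp add: nn_integral_cmult)
  also have "\<dots> = (\<integral>\<^sup>+l. \<integral>\<^sup>+x. indicator F x * w (x - l) \<partial>Leb N \<partial>count_space \<Lambda>)"
    using m(1) by (intro nn_integral_count_space_nn_integral countable_mem) auto
  also have "\<dots> = (\<integral>\<^sup>+l. \<integral>\<^sup>+x. indicator F (x - (- l)) * w x \<partial>Leb N \<partial>count_space \<Lambda>)"
  proof (rule nn_integral_cong)
    fix l assume "l \<in> space (count_space \<Lambda>)"
    then have l: "l \<in> \<Lambda>" by simp
    have "(\<lambda>x. indicator F (x - (- l)) * w x) \<in> borel_measurable (Leb N)"
      using m(2)[OF neg_mem[OF l]] w by (intro borel_measurable_times_ennreal)
    from nn_integral_translate[OF l this]
    show "(\<integral>\<^sup>+x. indicator F x * w (x - l) \<partial>Leb N) = (\<integral>\<^sup>+x. indicator F (x - (- l)) * w x \<partial>Leb N)"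
      by simp
  qed
  also have "\<dots> = (\<integral>\<^sup>+l. \<integral>\<^sup>+x. indicator F (x - l) * w x \<partial>Leb N \<partial>count_space \<Lambda>)"
    by (rule count_space_minus[where f="\<lambda>l. \<integral>\<^sup>+x. indicator F (x - l) * w x \<partial>Leb N"])
  also have "\<dots> = (\<integral>\<^sup>+x. \<integral>\<^sup>+l. indicator F (x - l) * w x \<partial>count_space \<Lambda> \<partial>Leb N)"
    using m(2) w by (intro nn_integral_count_space_nn_integral[symmetric] countable_mem borel_measurable_times_ennreal)
  also have "\<dots> = (\<integral>\<^sup>+x. periodize (indicator F) x * w x \<partial>Leb N)"
    unfolding periodize_def by (simp add: nn_integral_multc)
  finally show ?thesis .
qed

lemma periodize_packs:
  assumes "packs F" "x \<in> space (Leb N)"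
  shows "periodize (indicator F) x \<le> 1"
proof (cases "\<exists>l\<in>\<Lambda>. x - l \<in> F")
  case True
  then obtain l where l: "l \<in> \<Lambda>" "x - l \<in> F" by auto
  then have "periodize (indicator F) x = (\<integral>\<^sup>+k. indicator {l} k \<partial>count_space \<Lambda>)"
    using assms unfolding periodize_def packs_def
    by (intro nn_integral_cong) (auto simp: indicator_def)
  also have "\<dots> = 1" using l by simp
  finally show ?thesis by simp
next
  case False
  then have "periodize (indicator F) x = (\<integral>\<^sup>+k. 0 \<partial>count_space \<Lambda>)"
    unfolding periodize_def by (intro nn_integral_cong) (auto simp: indicator_def)
  then show ?thesis by simp
qed

lemma periodize_ge:
  assumes "l \<in> \<Lambda>" shows "w (x - l) \<le> periodize w x"
  unfolding periodize_def by (rule nn_integral_ge_point) (use assms in auto)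

lemma periodize_covers:
  assumes "covers F" "x \<in> space (Leb N)"
  shows "1 \<le> periodize (indicator F) x"
proof -
  obtain l where "l \<in> \<Lambda>" "x - l \<in> F" using assms by (auto simp: covers_def)
  with periodize_ge[of l "indicator F" x] show ?thesis by simp
qed

lemma nn_integral_periodize_packs:
  assumes "packs F" "w \<in> borel_measurable (Leb N)"
  shows "(\<integral>\<^sup>+x. indicator F x * periodize w x \<partial>Leb N) \<le> (\<integral>\<^sup>+x. w x \<partial>Leb N)"
proof -
  have F: "F \<in> sets (Leb N)" using assms by (simp add: packs_def)
  show ?thesis unfolding nn_integral_periodize[OF F assms(2)]
    using mult_right_mono[OF periodize_packs[OF assms(1)]] by (intro nn_integral_mono) fastforce
qed

lemma nn_integral_periodize_covers:
  assumes "covers F" "w \<in> borel_measurable (Leb N)"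
  shows "(\<integral>\<^sup>+x. w x \<partial>Leb N) \<le> (\<integral>\<^sup>+x. indicator F x * periodize w x \<partial>Leb N)"
proof -
  have F: "F \<in> sets (Leb N)" using assms by (simp add: covers_def)
  show ?thesis unfolding nn_integral_periodize[OF F assms(2)]
    using mult_right_mono[OF periodize_covers[OF assms(1)]] by (intro nn_integral_mono) fastforce
qed

text \<open>Integrate over \<open>F\<close> the number of translates of \<open>V\<close> above each
  point: the result is at least the volume of \<open>V\<close> because \<open>F\<close> covers, and
  at most that of \<open>F\<close> because \<open>V\<close> packs. Used in both directions it gives
  the volume of a Voronoi cell from any explicit fundamental domain.\<close>

lemma emeasure_packs_le_covers:
  assumes V: "packs V" and F: "covers F"
  shows "emeasure (Leb N) V \<le> emeasure (Leb N) F"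
proof -
  have s: "V \<in> sets (Leb N)" "F \<in> sets (Leb N)" using assms by (auto simp: packs_def covers_def)
  have "emeasure (Leb N) V = (\<integral>\<^sup>+x. indicator V x \<partial>Leb N)" using s by simp
  also have "\<dots> \<le> (\<integral>\<^sup>+x. indicator F x * periodize (indicator V) x \<partial>Leb N)"
    using s by (intro nn_integral_periodize_covers[OF F]) simp
  also have "\<dots> \<le> (\<integral>\<^sup>+x. indicator F x \<partial>Leb N)"
    using mult_left_mono[OF periodize_packs[OF V]] by (intro nn_integral_mono) fastforce
  finally show ?thesis using s by simp
qed

section \<open>Voronoi cells\<close>

definition open_voronoi :: "(nat \<Rightarrow> complex) set" where
  "open_voronoi = {x \<in> space (Leb N). \<forall>l\<in>\<Lambda> - {0}. vnorm N x < vnorm N (x - l)}"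

lemma sets_voronoi [measurable]: "voronoi N \<Lambda> \<in> sets (Leb N)"
proof -
  have "voronoi N \<Lambda> = (\<Inter>l\<in>\<Lambda>. {x \<in> space (Leb N). vnorm N x \<le> vnorm N (x - l)})"
    using zero_mem by (auto simp: voronoi_def)
  also have "\<dots> \<in> sets (Leb N)"
    using zero_mem by (intro sets.countable_INT' countable_mem) auto
  finally show ?thesis .
qed

lemma sets_open_voronoi [measurable]: "open_voronoi \<in> sets (Leb N)"
proof -
  have "open_voronoi = (\<Inter>l\<in>\<Lambda>. {x \<in> space (Leb N). l \<noteq> 0 \<longrightarrow> vnorm N x < vnorm N (x - l)})"
    using zero_mem by (auto simp: open_voronoi_def)
  also have "\<dots> \<in> sets (Leb N)"
    using zero_mem by (intro sets.countable_INT' countable_mem) auto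
  finally show ?thesis .
qed

lemma open_voronoi_subset: "open_voronoi \<subseteq> voronoi N \<Lambda>"
  by (force simp: open_voronoi_def voronoi_def)

text \<open>A nearest lattice point exists because the lattice points at least as close to
  \<open>x\<close> as 0 form a finite nonempty set.\<close>

lemma covers_voronoi: "covers (voronoi N \<Lambda>)"
  unfolding covers_def
proof (intro conjI ballI)
  fix x assume x: "x \<in> space (Leb N)"
  define S where "S = {l \<in> \<Lambda>. vnorm N (x - l) \<le> vnorm N x}"
  have "S \<subseteq> {l \<in> \<Lambda>. vnorm N l \<le> 2 * vnorm N x}"
  proof
    fix l assume "l \<in> S"
    moreover have "vnorm N l \<le> vnorm N (l - x) + vnorm N x"
      using vnorm_triangle[of N "l - x" x] by simp
    ultimately show "l \<in> {l \<in> \<Lambda>. vnorm N l \<le> 2 * vnorm N x}"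
      by (auto simp: S_def vnorm_minus_commute[of N l])
  qed
  then have "finite S" using locally_finite finite_subset by blast
  moreover have "S \<noteq> {}" using zero_mem by (force simp: S_def)
  ultimately obtain l where l: "l \<in> S" "\<And>k. k \<in> S \<Longrightarrow> vnorm N (x - l) \<le> vnorm N (x - k)"
    using ex_is_arg_min_if_finite[of S "\<lambda>l. vnorm N (x - l)"]
    by (auto simp: is_arg_min_linorder)
  have lL: "l \<in> \<Lambda>" and lx: "vnorm N (x - l) \<le> vnorm N x" using l(1) by (auto simp: S_def)
  have "vnorm N (x - l) \<le> vnorm N (x - l - k)" if "k \<in> \<Lambda>" for k
  proof -
    have eq: "x - l - k = x - (l + k)" by (simp add: diff_diff_eq)
    show ?thesis
    proof (cases "l + k \<in> S")
      case True then show ?thesis unfolding eq by (rule l(2))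
    next
      case False
      then have "vnorm N x < vnorm N (x - (l + k))"
        using add_mem[OF lL that] by (auto simp: S_def)
      then show ?thesis using lx unfolding eq by linarith
    qed
  qed
  then show "\<exists>l\<in>\<Lambda>. x - l \<in> voronoi N \<Lambda>"
    using lL x by (auto simp: voronoi_def translate_space)
qed simp

lemma packs_open_voronoi: "packs open_voronoi"
  unfolding packs_def
proof (intro conjI ballI impI, simp, rule ccontr)
  fix x l l'
  assume *: "l \<in> \<Lambda>" "l' \<in> \<Lambda>" "x - l \<in> open_voronoi" "x - l' \<in> open_voronoi" "l \<noteq> l'"
  have "vnorm N (x - l) < vnorm N (x - l - (l' - l))" "vnorm N (x - l') < vnorm N (x - l' - (l - l'))"
    using *(3,4) diff_mem[OF *(2,1)] diff_mem[OF *(1,2)] *(5)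
    unfolding open_voronoi_def mem_Collect_eq by (metis (no_types, lifting) Diff_iff right_minus_eq singletonD)+
  then show False by simp
qed

text \<open>The gap of squared distances satisfies \<open>|t x - l|^2 - |t x|^2 = t (|x - l|^2 -
  |x|^2) + (1 - t) |l|^2\<close>, and the last term is positive for nonzero \<open>l\<close>. This
  contraction shows that the boundary has no volume, and later that the error probability grows with
  the noise.\<close>

lemma shrink_voronoi:
  assumes x: "x \<in> voronoi N \<Lambda>" and t: "0 \<le> t" "t < (1::real)"
  shows "(\<lambda>i\<in>{..<N}. of_real t * x i) \<in> open_voronoi"
proof -
  let ?y = "\<lambda>i\<in>{..<N}. of_real t * x i"
  have "vnorm N ?y < vnorm N (?y - l)" if l: "l \<in> \<Lambda>" "l \<noteq> 0" for l
  proof -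
    have pt: "(cmod (of_real t * u - v))\<^sup>2
         = (cmod (of_real t * u))\<^sup>2 + t * ((cmod (u - v))\<^sup>2 - (cmod u)\<^sup>2) + (1 - t) * (cmod v)\<^sup>2" for u v
      unfolding cmod_power2 by (simp add: algebra_simps power2_eq_square)
    have "(vnorm N (?y - l))\<^sup>2 = (vnorm N ?y)\<^sup>2 + t * ((vnorm N (x - l))\<^sup>2 - (vnorm N x)\<^sup>2) + (1 - t) * (vnorm N l)\<^sup>2"
      by (simp add: vnorm_sq pt sum.distrib sum_distrib_left[symmetric] sum_subtractf)
    moreover have "0 \<le> (vnorm N (x - l))\<^sup>2 - (vnorm N x)\<^sup>2"
      using x l by (auto simp: voronoi_def intro!: power_mono)
    moreover have "0 < (1 - t) * (vnorm N l)\<^sup>2" using t vnorm_pos[OF l] by simp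
    ultimately have "(vnorm N ?y)\<^sup>2 < (vnorm N (?y - l))\<^sup>2" using t
      by (smt (verit) mult_nonneg_nonneg)
    then show ?thesis by (rule power2_less_imp_less) simp
  qed
  then show ?thesis by (auto simp: open_voronoi_def space_Leb)
qed

text \<open>Contraction by \<open>t < 1\<close> puts the closed cell into the open one at the cost
  of the factor \<open>t ^ (2 * N)\<close>, which tends to 1. The bisecting hyperplanes are never
  examined.\<close>

lemma emeasure_voronoi: "emeasure (Leb N) (voronoi N \<Lambda>) = emeasure (Leb N) open_voronoi"
proof (rule antisym)
  show "emeasure (Leb N) open_voronoi \<le> emeasure (Leb N) (voronoi N \<Lambda>)"
    by (rule emeasure_mono[OF open_voronoi_subset]) simp
  have *: "ennreal (t ^ (2 * N)) * emeasure (Leb N) (voronoi N \<Lambda>) \<le> emeasure (Leb N) open_voronoi"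
    if t: "0 < t" "t < 1" for t
  proof -
    have "emeasure (Leb N) (voronoi N \<Lambda>) \<le> (\<integral>\<^sup>+x. indicator open_voronoi (\<lambda>i\<in>{..<N}. of_real t * x i) \<partial>Leb N)"
      unfolding nn_integral_indicator[OF sets_voronoi, symmetric]
      using shrink_voronoi t by (intro nn_integral_mono) (auto simp: indicator_def)
    then show ?thesis
      using nn_integral_Leb_scale[OF t(1), of "indicator open_voronoi" N]
      by (simp add: mult_left_mono)
  qed
  show "emeasure (Leb N) (voronoi N \<Lambda>) \<le> emeasure (Leb N) open_voronoi"
  proof (rule tendsto_upperbound)
    have "((\<lambda>t. t ^ (2 * N)) \<longlongrightarrow> (1::real)) (at_left 1)"
      by (auto intro!: tendsto_eq_intros)
    then have "((\<lambda>t. ennreal (t ^ (2 * N))) \<longlongrightarrow> ennreal 1) (at_left (1::real))"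
      by (rule tendsto_ennrealI)
    then have "((\<lambda>t. ennreal (t ^ (2 * N)) * emeasure (Leb N) (voronoi N \<Lambda>)) \<longlongrightarrow> ennreal 1 * emeasure (Leb N) (voronoi N \<Lambda>)) (at_left (1::real))"
      by (intro tendsto_mult_ennreal tendsto_const) auto
    then show "((\<lambda>t. ennreal (t ^ (2 * N)) * emeasure (Leb N) (voronoi N \<Lambda>)) \<longlongrightarrow> emeasure (Leb N) (voronoi N \<Lambda>)) (at_left (1::real))"
      by simp
    show "\<forall>\<^sub>F t in at_left 1. ennreal (t ^ (2 * N)) * emeasure (Leb N) (voronoi N \<Lambda>) \<le> emeasure (Leb N) open_voronoi"
      using eventually_at_left_real[OF zero_less_one] by eventually_elim (rule *, auto)
  qed simp
qed

end

context vec_lattice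
begin

lemma nn_integral_voronoi:
  assumes fin: "emeasure (Leb N) (voronoi N \<Lambda>) < \<top>"
  shows "(\<integral>\<^sup>+x. indicator (voronoi N \<Lambda>) x * f x \<partial>Leb N) = (\<integral>\<^sup>+x. indicator open_voronoi x * f x \<partial>Leb N)"
proof (rule nn_integral_cong_AE)
  have "emeasure (Leb N) (voronoi N \<Lambda> - open_voronoi)
     = emeasure (Leb N) (voronoi N \<Lambda>) - emeasure (Leb N) open_voronoi"
    using fin by (intro emeasure_Diff) (auto simp: open_voronoi_subset emeasure_voronoi)
  also have "\<dots> = 0" using fin by (simp add: emeasure_voronoi)
  finally have "voronoi N \<Lambda> - open_voronoi \<in> null_sets (Leb N)" by auto
  from AE_not_in[OF this]
  show "AE x in Leb N. indicator (voronoi N \<Lambda>) x * f x = indicator open_voronoi x * f x"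
    using open_voronoi_subset by (auto elim!: eventually_mono simp: indicator_def)
qed

section \<open>Overlaps of a ball with its lattice translates\<close>

lemma overlap_measurable [measurable]:
  assumes "l \<in> \<Lambda>"
  shows "{x \<in> cballN N r. x - l \<in> cballN N r} \<in> sets (Leb N)"
proof -
  have "{x \<in> cballN N r. x - l \<in> cballN N r} = cballN N r \<inter> ((\<lambda>x. x - l) -` cballN N r \<inter> space (Leb N))"
    by (auto simp: cballN_def)
  also have "\<dots> \<in> sets (Leb N)"
    using measurable_sets[OF translate_measurable[OF assms] sets_cballN] by auto
  finally show ?thesis .
qed

text \<open>Tonelli turns the sum of overlaps into the integral over the ball of the number of
  nearby lattice points. \<open>M\<close> is general because both Lebesgue measure and the Gaussian
  law are inserted.\<close>

lemma nn_integral_overlap: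
  assumes sets: "sets M = sets (Leb N)"
  shows "(\<integral>\<^sup>+l. emeasure M {x \<in> cballN N r. x - l \<in> cballN N r} \<partial>count_space \<Lambda>)
       = (\<integral>\<^sup>+x. indicator (cballN N r) x * periodize (indicator (cballN N r)) x \<partial>M)"
proof -
  have sp: "space M = space (Leb N)" using sets by (rule sets_eq_imp_space_eq)
  have mM: "borel_measurable M = borel_measurable (Leb N)" by (rule measurable_cong_sets[OF sets refl])
  have mt: "(\<lambda>x. indicator (cballN N r) x * indicator (cballN N r) (x - l) :: ennreal) \<in> borel_measurable M" if "l \<in> \<Lambda>" for l
    unfolding mM using supp[OF that] by (intro borel_measurable_times_ennreal indicator_translate_measurable) auto
  have mt': "(\<lambda>l. indicator (cballN N r) (x - l) :: ennreal) \<in> borel_measurable (count_space \<Lambda>)" for x by simp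
  have "(\<integral>\<^sup>+l. emeasure M {x \<in> cballN N r. x - l \<in> cballN N r} \<partial>count_space \<Lambda>)
     = (\<integral>\<^sup>+l. \<integral>\<^sup>+x. indicator (cballN N r) x * indicator (cballN N r) (x - l) \<partial>M \<partial>count_space \<Lambda>)"
  proof (rule nn_integral_cong)
    fix l assume "l \<in> space (count_space \<Lambda>)"
    then have "{x \<in> cballN N r. x - l \<in> cballN N r} \<in> sets M" by (simp add: sets overlap_measurable)
    then have "emeasure M {x \<in> cballN N r. x - l \<in> cballN N r}
      = (\<integral>\<^sup>+x. indicator {x \<in> cballN N r. x - l \<in> cballN N r} x \<partial>M)" by simp
    also have "\<dots> = (\<integral>\<^sup>+x. indicator (cballN N r) x * indicator (cballN N r) (x - l) \<partial>M)"
      by (intro nn_integral_cong) (simp add: indicator_def)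
    finally show "emeasure M {x \<in> cballN N r. x - l \<in> cballN N r}
      = (\<integral>\<^sup>+x. indicator (cballN N r) x * indicator (cballN N r) (x - l) \<partial>M)" .
  qed
  also have "\<dots> = (\<integral>\<^sup>+x. \<integral>\<^sup>+l. indicator (cballN N r) x * indicator (cballN N r) (x - l) \<partial>count_space \<Lambda> \<partial>M)"
    using mt by (intro nn_integral_count_space_nn_integral[symmetric] countable_mem)
  also have "\<dots> = (\<integral>\<^sup>+x. indicator (cballN N r) x * periodize (indicator (cballN N r)) x \<partial>M)"
    unfolding periodize_def by (simp add: nn_integral_cmult)
  finally show ?thesis .
qed

lemma count_space_split_zero:
  "(\<integral>\<^sup>+l. f l \<partial>count_space \<Lambda>) = f 0 + (\<integral>\<^sup>+l. (if l = 0 then 0 else f l) \<partial>count_space \<Lambda>)"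
proof -
  have "(\<integral>\<^sup>+l. f l \<partial>count_space \<Lambda>)
     = (\<integral>\<^sup>+l. f 0 * indicator {0} l + (if l = 0 then 0 else f l) \<partial>count_space \<Lambda>)"
    by (intro nn_integral_cong) auto
  also have "\<dots> = (\<integral>\<^sup>+l. f 0 * indicator {0} l \<partial>count_space \<Lambda>) + (\<integral>\<^sup>+l. (if l = 0 then 0 else f l) \<partial>count_space \<Lambda>)"
    by (rule nn_integral_add) auto
  also have "(\<integral>\<^sup>+l. f 0 * indicator {0} l \<partial>count_space \<Lambda>) = f 0"
    using zero_mem by (subst nn_integral_cmult) auto
  finally show ?thesis .
qed

text \<open>Chebyshev's inequality for the number \<open>K\<close> of lattice points within \<open>r\<close> of a uniformly
  distributed point of the Voronoi cell, in the subtraction-free form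
  \<open>2 a K \<le> indicator (K > 0) + (a K)\<^sup>2\<close>.\<close>
lemma voronoi_chebyshev:
  assumes v: "emeasure (Leb N) (voronoi N \<Lambda>) = ennreal v" "0 < v" and b: "0 < bvol N r"
  shows "ennreal (2 * v) \<le> emeasure (Leb N) (voronoi N \<Lambda> \<inter> cballN N r)
     + ennreal ((v / bvol N r)\<^sup>2)
       * (\<integral>\<^sup>+l. emeasure (Leb N) {x \<in> cballN N r. x - l \<in> cballN N r} \<partial>count_space \<Lambda>)"
proof -
  let ?B = "cballN N r" and ?V = "voronoi N \<Lambda>"
  define K where "K = periodize (indicator ?B)"
  \<comment> \<open>Scales \<open>K\<close> to mean 1 over the cell, its own mean being
    \<open>bvol N r / v\<close>.\<close>
  define a where "a = v / bvol N r"
  have a: "0 < a" using v b by (simp add: a_def)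
  have [measurable]: "K \<in> borel_measurable (Leb N)" unfolding K_def by measurable
  define w where "w = (\<lambda>x. indicator ?B x * K x)"
  have [measurable]: "w \<in> borel_measurable (Leb N)" unfolding w_def by measurable
  \<comment> \<open>\<open>K\<close> is periodic, so periodizing \<open>w\<close> gives its square;
    the second moment over the cell thereby becomes an integral over the ball.\<close>
  have pw: "periodize w x = K x * K x" for x
  proof -
    have "periodize w x = (\<integral>\<^sup>+l. indicator ?B (x - l) * K x \<partial>count_space \<Lambda>)"
      unfolding periodize_def w_def by (intro nn_integral_cong) (simp add: K_def periodize_shift)
    also have "\<dots> = K x * K x" by (subst nn_integral_multc) (auto simp: K_def periodize_def)
    finally show ?thesis .
  qed
  have h1: "ennreal (bvol N r) \<le> (\<integral>\<^sup>+x. indicator ?V x * K x \<partial>Leb N)"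
    using nn_integral_periodize_covers[OF covers_voronoi, of "indicator ?B"]
    by (simp add: K_def emeasure_cballN)
  have "(\<integral>\<^sup>+x. indicator ?V x * (K x * K x) \<partial>Leb N) = (\<integral>\<^sup>+x. indicator open_voronoi x * periodize w x \<partial>Leb N)"
    unfolding pw by (rule nn_integral_voronoi) (simp add: v)
  also have "\<dots> \<le> (\<integral>\<^sup>+x. w x \<partial>Leb N)"
    by (rule nn_integral_periodize_packs[OF packs_open_voronoi]) simp
  also have "\<dots> = (\<integral>\<^sup>+l. emeasure (Leb N) {x \<in> ?B. x - l \<in> ?B} \<partial>count_space \<Lambda>)"
    unfolding w_def K_def by (rule nn_integral_overlap[symmetric]) simp
  finally have h2: "(\<integral>\<^sup>+x. indicator ?V x * (K x * K x) \<partial>Leb N)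
      \<le> (\<integral>\<^sup>+l. emeasure (Leb N) {x \<in> ?B. x - l \<in> ?B} \<partial>count_space \<Lambda>)" .
  have pt: "ennreal (2 * a) * (indicator ?V x * K x)
      \<le> indicator (?V \<inter> ?B) x + ennreal (a\<^sup>2) * (indicator ?V x * (K x * K x))" for x
  proof (cases "x \<in> ?V \<and> K x \<noteq> 0")
    case True
    have "\<exists>l\<in>\<Lambda>. x - l \<in> ?B"
    proof (rule ccontr)
      assume "\<not> ?thesis"
      then have "K x = (\<integral>\<^sup>+l. 0 \<partial>count_space \<Lambda>)"
        unfolding K_def periodize_def by (intro nn_integral_cong) (auto simp: indicator_def)
      then show False using True by simp
    qed
    then obtain l where "l \<in> \<Lambda>" "x - l \<in> ?B" by auto
    \<comment> \<open>0 is a nearest lattice point to \<open>x\<close>: if any lattice point lies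
      within \<open>r\<close>, then 0 does.\<close>
    then have xB: "x \<in> ?B" using True by (force simp: voronoi_def cballN_def)
    have "ennreal (2 * a) * K x \<le> 1 + ennreal (a\<^sup>2) * (K x * K x)"
    proof (cases "K x")
      case (real k)
      have "2 * a * k \<le> 1 + a\<^sup>2 * (k * k)"
        using zero_le_power2[of "a * k - 1"] by (simp add: power2_eq_square algebra_simps)
      then have "ennreal (2 * a * k) \<le> ennreal (1 + a\<^sup>2 * (k * k))" by (rule ennreal_leI)
      also have "\<dots> = 1 + ennreal (a\<^sup>2 * (k * k))" using real by (subst ennreal_plus) auto
      finally show ?thesis using real a by (simp add: ennreal_mult[symmetric])
    next
      case top
      then show ?thesis using a by (simp add: ennreal_mult_top)
    qed
    then show ?thesis using True xB by simp
  qed (auto simp: indicator_def)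
  have "ennreal (2 * v) = ennreal (2 * a) * ennreal (bvol N r)"
    using a b v by (simp add: ennreal_mult[symmetric] a_def)
  also have "\<dots> \<le> ennreal (2 * a) * (\<integral>\<^sup>+x. indicator ?V x * K x \<partial>Leb N)"
    by (intro mult_left_mono h1) simp
  also have "\<dots> = (\<integral>\<^sup>+x. ennreal (2 * a) * (indicator ?V x * K x) \<partial>Leb N)"
    by (rule nn_integral_cmult[symmetric]) measurable
  also have "\<dots> \<le> (\<integral>\<^sup>+x. indicator (?V \<inter> ?B) x + ennreal (a\<^sup>2) * (indicator ?V x * (K x * K x)) \<partial>Leb N)"
    by (intro nn_integral_mono pt)
  also have "\<dots> = emeasure (Leb N) (?V \<inter> ?B) + ennreal (a\<^sup>2) * (\<integral>\<^sup>+x. indicator ?V x * (K x * K x) \<partial>Leb N)"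
    by (subst nn_integral_add) (auto simp: nn_integral_cmult)
  also have "\<dots> \<le> emeasure (Leb N) (?V \<inter> ?B)
     + ennreal (a\<^sup>2) * (\<integral>\<^sup>+l. emeasure (Leb N) {x \<in> ?B. x - l \<in> ?B} \<partial>count_space \<Lambda>)"
    by (intro add_left_mono mult_left_mono h2) simp
  finally show ?thesis by (simp add: a_def)
qed

text \<open>If \<open>x\<close> is outside the cell, some \<open>l\<close> is strictly closer to
  \<open>x\<close> than 0 is; when moreover \<open>vnorm N x \<le> r\<close>, both \<open>x\<close>
  and \<open>x - l\<close> lie in the ball. Pairwise errors are thus bounded by ball overlaps, which
  vanish for long \<open>l\<close>, as the averaging requires.\<close>

lemma err_union_bound:
  assumes sets: "sets M = sets (Leb N)"
  shows "emeasure M (space M - voronoi N \<Lambda>) \<le> emeasure M {x \<in> space (Leb N). r < vnorm N x}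
     + (\<integral>\<^sup>+l. (if l = 0 then 0 else emeasure M {x \<in> cballN N r. x - l \<in> cballN N r}) \<partial>count_space \<Lambda>)"
proof -
  let ?B = "cballN N r" and ?T = "{x \<in> space (Leb N). r < vnorm N x}"
  have sp: "space M = space (Leb N)" using sets by (rule sets_eq_imp_space_eq)
  have mM: "borel_measurable M = borel_measurable (Leb N)" by (rule measurable_cong_sets[OF sets refl])
  define g where "g l x = (if l = 0 then 0 else indicator {x \<in> ?B. x - l \<in> ?B} x :: ennreal)" for l x
  have mg: "g l \<in> borel_measurable M" if "l \<in> \<Lambda>" for l
    unfolding mM g_def using overlap_measurable[OF that] by (cases "l = 0") auto
  have T: "?T \<in> sets M" unfolding sets by measurable
  have VM: "voronoi N \<Lambda> \<in> sets M" unfolding sets by simp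
  have "emeasure M (space M - voronoi N \<Lambda>) = (\<integral>\<^sup>+x. indicator (space M - voronoi N \<Lambda>) x \<partial>M)"
    using VM by simp
  also have "\<dots> \<le> (\<integral>\<^sup>+x. indicator ?T x + (\<integral>\<^sup>+l. g l x \<partial>count_space \<Lambda>) \<partial>M)"
  proof (rule nn_integral_mono)
    fix x assume x: "x \<in> space M"
    show "indicator (space M - voronoi N \<Lambda>) x \<le> indicator ?T x + (\<integral>\<^sup>+l. g l x \<partial>count_space \<Lambda>)"
    proof (cases "x \<in> voronoi N \<Lambda> \<or> r < vnorm N x")
      case True then show ?thesis using x by (auto simp: indicator_def sp)
    next
      case False
      then obtain l where l: "l \<in> \<Lambda>" "vnorm N (x - l) < vnorm N x" "vnorm N x \<le> r"
        using x by (auto simp: voronoi_def sp)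
      have "l \<noteq> 0" using l by auto
      moreover have "x \<in> ?B" "x - l \<in> ?B" using l x by (auto simp: cballN_def sp translate_space)
      ultimately have "1 = g l x" by (simp add: g_def)
      also have "\<dots> \<le> (\<integral>\<^sup>+l. g l x \<partial>count_space \<Lambda>)" by (rule nn_integral_ge_point[OF l(1)])
      finally show ?thesis by (auto simp: indicator_def intro: add_increasing)
    qed
  qed
  also have "\<dots> = emeasure M ?T + (\<integral>\<^sup>+x. \<integral>\<^sup>+l. g l x \<partial>count_space \<Lambda> \<partial>M)"
  proof -
    have "(\<lambda>x. \<integral>\<^sup>+l. g l x \<partial>count_space \<Lambda>) \<in> borel_measurable M"
    proof (rule sigma_finite_measure.borel_measurable_nn_integral)
      show "sigma_finite_measure (count_space \<Lambda>)"
        by (rule sigma_finite_measure_count_space_countable[OF countable_mem])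
      show "(\<lambda>(x, l). g l x) \<in> borel_measurable (M \<Otimes>\<^sub>M count_space \<Lambda>)"
        by (subst measurable_pair_swap_iff)
           (auto intro!: measurable_pair_measure_countable1 countable_mem mg)
    qed
    then show ?thesis using T by (subst nn_integral_add) auto
  qed
  also have "(\<integral>\<^sup>+x. \<integral>\<^sup>+l. g l x \<partial>count_space \<Lambda> \<partial>M) = (\<integral>\<^sup>+l. \<integral>\<^sup>+x. g l x \<partial>M \<partial>count_space \<Lambda>)"
    using mg by (intro nn_integral_count_space_nn_integral countable_mem)
  also have "\<dots> = (\<integral>\<^sup>+l. (if l = 0 then 0 else emeasure M {x \<in> ?B. x - l \<in> ?B}) \<partial>count_space \<Lambda>)"
    using overlap_measurable by (intro nn_integral_cong) (auto simp: g_def sets)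
  finally show ?thesis .
qed

text \<open>The translates of \<open>F\<close> by the lattice points within \<open>r\<close> of
  \<open>z\<close> are disjoint and lie in the ball of radius \<open>r + c\<close> around
  \<open>z\<close>; compare volumes.\<close>

lemma lattice_point_count:
  assumes F: "packs F" "F \<subseteq> cballN N c" and z: "z \<in> space (Leb N)"
  shows "emeasure (Leb N) F * periodize (indicator (cballN N r)) z \<le> ennreal (bvol N (r + c))"
proof -
  have Fs [measurable]: "F \<in> sets (Leb N)" using F by (simp add: packs_def)
  \<comment> \<open>\<open>z\<close> is \<open>undefined\<close> from index \<open>N\<close> on;
    with 0 there instead, subtracting it maps \<open>space (Leb N)\<close> into itself.\<close>
  define z0 where "z0 = (\<lambda>i. if i < N then z i else 0)"
  have vz: "vnorm N (x - z0) = vnorm N (x - z)" for x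
    unfolding vnorm_def z0_def by (intro arg_cong[where f=sqrt] sum.cong) auto
  have mF: "(\<lambda>x. indicator F (x - l) :: ennreal) \<in> borel_measurable (Leb N)" if "l \<in> \<Lambda>" for l
    using measurable_compose[OF translate_measurable[OF that] borel_measurable_indicator[OF Fs]] .
  have "emeasure (Leb N) F * periodize (indicator (cballN N r)) z
     = (\<integral>\<^sup>+l. emeasure (Leb N) F * indicator (cballN N r) (z - l) \<partial>count_space \<Lambda>)"
    unfolding periodize_def by (simp add: nn_integral_cmult)
  also have "\<dots> = (\<integral>\<^sup>+l. \<integral>\<^sup>+x. indicator (cballN N r) (z - l) * indicator F (x - l) \<partial>Leb N \<partial>count_space \<Lambda>)"
  proof (rule nn_integral_cong)
    fix l assume "l \<in> space (count_space \<Lambda>)"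
    then have l: "l \<in> \<Lambda>" by simp
    show "emeasure (Leb N) F * indicator (cballN N r) (z - l) = (\<integral>\<^sup>+x. indicator (cballN N r) (z - l) * indicator F (x - l) \<partial>Leb N)"
      using mF[OF l] nn_integral_translate[OF l, of "indicator F"]
      by (subst nn_integral_cmult) (auto simp: mult.commute)
  qed
  also have "\<dots> = (\<integral>\<^sup>+x. \<integral>\<^sup>+l. indicator (cballN N r) (z - l) * indicator F (x - l) \<partial>count_space \<Lambda> \<partial>Leb N)"
    using mF by (intro nn_integral_count_space_nn_integral[symmetric] countable_mem) auto
  also have "\<dots> \<le> (\<integral>\<^sup>+x. indicator (cballN N (r + c)) (x - z0) \<partial>Leb N)"
  proof (rule nn_integral_mono)
    fix x assume x: "x \<in> space (Leb N)"
    have "(\<integral>\<^sup>+l. indicator (cballN N r) (z - l) * indicator F (x - l) \<partial>count_space \<Lambda>)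
       \<le> (\<integral>\<^sup>+l. indicator (cballN N (r + c)) (x - z0) * indicator F (x - l) \<partial>count_space \<Lambda>)"
    proof (rule nn_integral_mono)
      fix l
      have "x - z0 \<in> cballN N (r + c)" if "z - l \<in> cballN N r" "x - l \<in> F"
      proof -
        have "vnorm N (x - z) \<le> vnorm N (x - l) + vnorm N (l - z)" by (rule vnorm_diff_triangle)
        also have "\<dots> \<le> c + r"
          using that F(2) by (intro add_mono) (auto simp: cballN_def vnorm_minus_commute[of N l])
        finally have "vnorm N (x - z0) \<le> r + c" by (simp add: vz add.commute)
        moreover have "x - z0 \<in> space (Leb N)"
          by (rule Leb_translate_space[OF _ x]) (simp add: z0_def)
        ultimately show ?thesis by (simp add: cballN_def)
      qed
      then show "indicator (cballN N r) (z - l) * indicator F (x - l)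
        \<le> (indicator (cballN N (r + c)) (x - z0) * indicator F (x - l) :: ennreal)"
        by (auto simp: indicator_def)
    qed
    also have "\<dots> = indicator (cballN N (r + c)) (x - z0) * periodize (indicator F) x"
      unfolding periodize_def by (simp add: nn_integral_cmult)
    also have "\<dots> \<le> indicator (cballN N (r + c)) (x - z0)"
      using mult_left_mono[OF periodize_packs[OF F(1) x]] by fastforce
    finally show "(\<integral>\<^sup>+l. indicator (cballN N r) (z - l) * indicator F (x - l) \<partial>count_space \<Lambda>)
      \<le> indicator (cballN N (r + c)) (x - z0)" .
  qed
  also have "\<dots> = ennreal (bvol N (r + c))"
    by (subst nn_integral_Leb_translate[of N z0 "indicator (cballN N (r + c))"])
       (auto simp: z0_def emeasure_cballN)
  finally show ?thesis .
qed

text \<open>Applied to the lattice of all integral vectors and its unit cell, this stands in for the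
  integral of the Minkowski-Hlawka theorem: passing from integral to sum costs only the enlargement
  of the radius by \<open>c\<close>.\<close>

lemma overlap_sum_le:
  assumes sets: "sets M = sets (Leb N)" and F: "packs F" "F \<subseteq> cballN N c"
  shows "emeasure (Leb N) F * (\<integral>\<^sup>+l. emeasure M {x \<in> cballN N r. x - l \<in> cballN N r} \<partial>count_space \<Lambda>)
       \<le> ennreal (bvol N (r + c)) * emeasure M (cballN N r)"
proof -
  let ?B = "cballN N r"
  have sp: "space M = space (Leb N)" using sets by (rule sets_eq_imp_space_eq)
  have mM: "borel_measurable M = borel_measurable (Leb N)" by (rule measurable_cong_sets[OF sets refl])
  have BM: "?B \<in> sets M" by (simp add: sets)
  have pm: "periodize (indicator ?B) \<in> borel_measurable M"
    unfolding mM by (rule periodize_measurable) simp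
  have "emeasure (Leb N) F * (\<integral>\<^sup>+x. indicator ?B x * periodize (indicator ?B) x \<partial>M)
     = (\<integral>\<^sup>+x. emeasure (Leb N) F * (indicator ?B x * periodize (indicator ?B) x) \<partial>M)"
    using BM pm by (intro nn_integral_cmult[symmetric] borel_measurable_times_ennreal borel_measurable_indicator)
  also have "\<dots> \<le> (\<integral>\<^sup>+x. ennreal (bvol N (r + c)) * indicator ?B x \<partial>M)"
  proof (rule nn_integral_mono)
    fix x assume "x \<in> space M"
    from lattice_point_count[OF F, of x r] this
    show "emeasure (Leb N) F * (indicator ?B x * periodize (indicator ?B) x) \<le> ennreal (bvol N (r + c)) * indicator ?B x"
      by (auto simp: indicator_def sp)
  qed
  also have "\<dots> = ennreal (bvol N (r + c)) * emeasure M ?B"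
    using BM by (subst nn_integral_cmult_indicator) auto
  finally show ?thesis unfolding nn_integral_overlap[OF sets] .
qed

end

section \<open>Rings of integers\<close>

text \<open>With \<open>xi_norm\<close>, the coefficients of the minimal polynomial
  \<open>X^2 - xi_trace d * X + xi_norm d\<close> of \<open>xi d\<close>; they let both shapes of
  the ring be treated uniformly.\<close>

definition xi_trace :: "int \<Rightarrow> int" where
  "xi_trace d = (if d mod 4 = 1 then 1 else 0)"

definition xi_norm :: "int \<Rightarrow> int" where
  "xi_norm d = (if d mod 4 = 1 then (1 - d) div 4 else - d)"

lemma xi_norm_mod1: "d mod 4 = 1 \<Longrightarrow> 4 * xi_norm d = 1 - d"
  unfolding xi_norm_def by presburger

lemma Im_xi_pos: "d < 0 \<Longrightarrow> 0 < Im (xi d)"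
  by (simp add: xi_def)

lemma Re_xi: "2 * Re (xi d) = of_int (xi_trace d)"
  by (simp add: xi_def xi_trace_def)

lemma cmod_xi_sq:
  assumes "d < 0" shows "(cmod (xi d))\<^sup>2 = of_int (xi_norm d)"
proof (cases "d mod 4 = 1")
  case True
  have "real_of_int (4 * xi_norm d) = real_of_int (1 - d)" by (simp only: xi_norm_mod1[OF True])
  then have "real_of_int (xi_norm d) = (1 - real_of_int d) / 4" by simp
  then show ?thesis using assms True unfolding cmod_power2
    by (simp add: xi_def power_divide power2_eq_square)
next
  case False
  then show ?thesis using assms unfolding cmod_power2 by (simp add: xi_def xi_norm_def)
qed

lemma xi_sq:
  assumes "d < 0" shows "xi d * xi d = of_int (xi_trace d) * xi d - of_int (xi_norm d)"
proof (rule complex_eqI)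
  have 1: "Re (xi d) * Re (xi d) + Im (xi d) * Im (xi d) = of_int (xi_norm d)"
    using cmod_xi_sq[OF assms] unfolding cmod_power2 by (simp add: power2_eq_square)
  show "Re (xi d * xi d) = Re (of_int (xi_trace d) * xi d - of_int (xi_norm d))"
    using 1 by (simp add: Re_xi[symmetric] algebra_simps)
  show "Im (xi d * xi d) = Im (of_int (xi_trace d) * xi d - of_int (xi_norm d))"
    by (simp add: Re_xi[symmetric])
qed

definition ok_elt :: "int \<Rightarrow> int \<Rightarrow> int \<Rightarrow> complex" where
  "ok_elt d a b = of_int a + of_int b * xi d"

lemma OK_def': "OK d = {ok_elt d a b | a b. True}"
  by (simp add: OK_def ok_elt_def)

lemma ok_elt_add: "ok_elt d a b + ok_elt d a' b' = ok_elt d (a + a') (b + b')"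
  and ok_elt_diff: "ok_elt d a b - ok_elt d a' b' = ok_elt d (a - a') (b - b')"
  and of_int_ok_elt: "of_int k = ok_elt d k 0"
  by (simp_all add: ok_elt_def algebra_simps)

lemma ok_elt_0: "ok_elt d 0 0 = 0" and ok_elt_1: "ok_elt d 1 0 = 1"
  by (simp_all add: ok_elt_def)

lemma ok_elt_mult:
  assumes "d < 0"
  shows "ok_elt d a b * ok_elt d a' b'
       = ok_elt d (a * a' - b * b' * xi_norm d) (a * b' + b * a' + b * b' * xi_trace d)"
proof -
  have "ok_elt d a b * ok_elt d a' b' = of_int (a * a') + of_int (a * b' + b * a') * xi d + of_int (b * b') * (xi d * xi d)"
    by (simp add: ok_elt_def algebra_simps)
  also have "\<dots> = ok_elt d (a * a' - b * b' * xi_norm d) (a * b' + b * a' + b * b' * xi_trace d)"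
    unfolding xi_sq[OF assms] by (simp add: ok_elt_def algebra_simps)
  finally show ?thesis .
qed

lemma cmod_ok_elt_sq:
  assumes "d < 0"
  shows "(cmod (ok_elt d a b))\<^sup>2 = of_int (a * a + xi_trace d * a * b + xi_norm d * b * b)"
proof -
  have 1: "Re (xi d) * Re (xi d) + Im (xi d) * Im (xi d) = of_int (xi_norm d)"
    using cmod_xi_sq[OF assms] unfolding cmod_power2 by (simp add: power2_eq_square)
  have "(cmod (ok_elt d a b))\<^sup>2 = of_int a * of_int a + of_int a * of_int b * (2 * Re (xi d))
      + of_int b * of_int b * (Re (xi d) * Re (xi d) + Im (xi d) * Im (xi d))"
    unfolding cmod_power2 by (simp add: ok_elt_def power2_eq_square algebra_simps)
  then show ?thesis unfolding 1 Re_xi by (simp add: algebra_simps)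
qed

text \<open>Coordinates with respect to the real basis \<open>1, xi d\<close>.\<close>
definition crd1 :: "int \<Rightarrow> complex \<Rightarrow> real" where
  "crd1 d z = Re z - Im z * Re (xi d) / Im (xi d)"
definition crd2 :: "int \<Rightarrow> complex \<Rightarrow> real" where
  "crd2 d z = Im z / Im (xi d)"

lemma crd_eq: "d < 0 \<Longrightarrow> z = of_real (crd1 d z) + of_real (crd2 d z) * xi d"
  using Im_xi_pos[of d] by (simp add: crd1_def crd2_def complex_eq_iff)

lemma crd_diff: "crd1 d (z - w) = crd1 d z - crd1 d w" "crd2 d (z - w) = crd2 d z - crd2 d w"
  by (simp_all add: crd1_def crd2_def diff_divide_distrib algebra_simps)

lemma crd_ok_elt: "d < 0 \<Longrightarrow> crd1 d (ok_elt d a b) = of_int a" "d < 0 \<Longrightarrow> crd2 d (ok_elt d a b) = of_int b"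
  using Im_xi_pos[of d] by (simp_all add: crd1_def crd2_def ok_elt_def)

lemma ok_elt_inject: "d < 0 \<Longrightarrow> ok_elt d a b = ok_elt d a' b' \<longleftrightarrow> a = a' \<and> b = b'"
  by (metis crd_ok_elt of_int_eq_iff)

text \<open>Half-open, so that the translates by \<open>OK d\<close> tile the plane exactly and
  rounding by \<open>ok_floor\<close> is unique.\<close>

definition cell :: "int \<Rightarrow> complex set" where
  "cell d = {z. 0 \<le> crd1 d z \<and> crd1 d z < 1 \<and> 0 \<le> crd2 d z \<and> crd2 d z < 1}"

definition ok_floor :: "int \<Rightarrow> complex \<Rightarrow> complex" where
  "ok_floor d z = ok_elt d \<lfloor>crd1 d z\<rfloor> \<lfloor>crd2 d z\<rfloor>"

lemma ok_floor_mem: "ok_floor d z \<in> OK d"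
  by (auto simp: ok_floor_def OK_def')

lemma cell_iff: "d < 0 \<Longrightarrow> w \<in> OK d \<Longrightarrow> z - w \<in> cell d \<longleftrightarrow> w = ok_floor d z"
  by (auto simp: OK_def' cell_def crd_diff crd_ok_elt ok_floor_def ok_elt_inject; linarith)

lemma cell_bound: "d < 0 \<Longrightarrow> z \<in> cell d \<Longrightarrow> cmod z \<le> 1 + cmod (xi d)"
proof -
  assume d: "d < 0" and z: "z \<in> cell d"
  have "cmod z \<le> cmod (of_real (crd1 d z)) + cmod (of_real (crd2 d z) * xi d)"
    by (subst crd_eq[OF d, of z]) (rule norm_triangle_ineq)
  also have "\<dots> \<le> 1 + 1 * cmod (xi d)"
    using z unfolding norm_mult by (intro add_mono mult_right_mono) (auto simp: cell_def)
  finally show ?thesis by simp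
qed

lemma crd_continuous: "continuous_on UNIV (crd1 d)" "continuous_on UNIV (crd2 d)"
  unfolding crd1_def crd2_def divide_inverse by (intro continuous_intros)+

lemma crd_measurable [measurable]: "crd1 d \<in> borel_measurable borel" "crd2 d \<in> borel_measurable borel"
  unfolding crd1_def crd2_def divide_inverse by measurable

lemma cell_sets [measurable]: "cell d \<in> sets borel"
  unfolding cell_def by measurable

definition covol :: "int \<Rightarrow> real" where
  "covol d = measure lborel (cell d)"

lemma emeasure_cell: "d < 0 \<Longrightarrow> emeasure lborel (cell d) = ennreal (covol d)"
proof -
  assume d: "d < 0"
  have "bounded (cell d)" using cell_bound[OF d] by (auto simp: bounded_iff)
  then have "emeasure lborel (cell d) < \<infinity>" by (rule emeasure_bounded_finite)
  then show ?thesis unfolding covol_def by (intro emeasure_eq_ennreal_measure) auto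
qed

lemma covol_pos: "d < 0 \<Longrightarrow> 0 < covol d"
proof -
  assume d: "d < 0"
  define U where "U = {z. 0 < crd1 d z \<and> crd1 d z < 1 \<and> 0 < crd2 d z \<and> crd2 d z < 1}"
  have "open U" unfolding U_def
    by (intro open_Collect_conj open_Collect_less continuous_on_const crd_continuous)
  moreover have "of_real (1 / 2) + of_real (1 / 2) * xi d \<in> U"
    using Im_xi_pos[OF d] by (simp add: U_def crd1_def crd2_def)
  ultimately have "\<not> negligible U" using open_not_negligible by blast
  then have "\<not> negligible (cell d)" by (rule contrapos_nn) (rule negligible_subset, auto simp: U_def cell_def)
  then have "emeasure lborel (cell d) \<noteq> 0"
    by (auto simp: negligible_iff_null_sets intro!: null_sets_completionI)
  then show ?thesis unfolding emeasure_cell[OF d] by (simp add: covol_def less_le)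
qed

lemma emeasure_lborel_translate:
  fixes A :: "complex set"
  assumes "A \<in> sets borel"
  shows "emeasure lborel {z. z - w \<in> A} = emeasure lborel A"
proof -
  have "emeasure lborel A = emeasure (distr lborel borel ((+) (- w))) A"
    by (simp add: lborel_distr_plus)
  also have "\<dots> = emeasure lborel {z. z - w \<in> A}"
    using assms by (subst emeasure_distr) (auto simp: vimage_def)
  finally show ?thesis by simp
qed

text \<open>The ambient lattice to which averaged lattice sums are compared; every lattice of the
  family is a sublattice.\<close>

definition ok_vecs :: "int \<Rightarrow> nat \<Rightarrow> (nat \<Rightarrow> complex) set" where
  "ok_vecs d N = {l. (\<forall>i<N. l i \<in> OK d) \<and> (\<forall>i. N \<le> i \<longrightarrow> l i = 0)}"

lemma OK_diff: "x \<in> OK d \<Longrightarrow> y \<in> OK d \<Longrightarrow> x - y \<in> OK d"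
  and OK_add: "x \<in> OK d \<Longrightarrow> y \<in> OK d \<Longrightarrow> x + y \<in> OK d"
  and OK_0: "0 \<in> OK d" and OK_of_int: "of_int k \<in> OK d"
  unfolding OK_def' using ok_elt_diff ok_elt_add ok_elt_0 of_int_ok_elt by (blast, blast, metis (mono_tags, lifting) mem_Collect_eq, blast)

lemma OK_mult: "d < 0 \<Longrightarrow> x \<in> OK d \<Longrightarrow> y \<in> OK d \<Longrightarrow> x * y \<in> OK d"
  unfolding OK_def' using ok_elt_mult by blast

lemma finite_OK_bounded:
  assumes d: "d < 0" shows "finite {x \<in> OK d. cmod x \<le> \<rho>}"
proof -
  define B where "B = \<rho> / Im (xi d)"
  define A where "A = \<rho> + \<bar>B\<bar> * cmod (xi d)"
  have "{x \<in> OK d. cmod x \<le> \<rho>} \<subseteq> (\<lambda>(a, b). ok_elt d a b) ` ({-\<lceil>A\<rceil>..\<lceil>A\<rceil>} \<times> {-\<lceil>B\<rceil>..\<lceil>B\<rceil>})"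
  proof
    fix x assume "x \<in> {x \<in> OK d. cmod x \<le> \<rho>}"
    then obtain a b where x: "x = ok_elt d a b" and n: "cmod x \<le> \<rho>" by (auto simp: OK_def')
    have "\<bar>of_int b\<bar> * Im (xi d) = \<bar>Im x\<bar>" using Im_xi_pos[OF d] by (simp add: x ok_elt_def abs_mult)
    also have "\<dots> \<le> \<rho>" using abs_Im_le_cmod[of x] n by linarith
    finally have b: "\<bar>real_of_int b\<bar> \<le> B" using Im_xi_pos[OF d] by (simp add: B_def field_simps)
    have "cmod (of_int a :: complex) \<le> cmod x + cmod (of_int b * xi d)"
      using norm_triangle_ineq4[of x "of_int b * xi d"] by (simp add: x ok_elt_def)
    also have "\<dots> \<le> \<rho> + \<bar>B\<bar> * cmod (xi d)"
      using n b unfolding norm_mult by (intro add_mono mult_right_mono) auto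
    finally have a: "\<bar>real_of_int a\<bar> \<le> A" by (simp add: A_def)
    have "a \<in> {-\<lceil>A\<rceil>..\<lceil>A\<rceil>}" "b \<in> {-\<lceil>B\<rceil>..\<lceil>B\<rceil>}" using a b by (auto; linarith)+
    then show "x \<in> (\<lambda>(a, b). ok_elt d a b) ` ({-\<lceil>A\<rceil>..\<lceil>A\<rceil>} \<times> {-\<lceil>B\<rceil>..\<lceil>B\<rceil>})" by (auto simp: x)
  qed
  then show ?thesis by (rule finite_subset) auto
qed

lemma cmod_le_vnorm: "i < N \<Longrightarrow> cmod (x i) \<le> vnorm N x"
  unfolding vnorm_L2 by (rule member_le_L2_set) auto

lemma vec_lattice_ok_vecs:
  assumes d: "d < 0" shows "vec_lattice N (ok_vecs d N)"
proof
  fix \<rho>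
  let ?S = "{x \<in> OK d. cmod x \<le> \<rho>}"
  have "{l \<in> ok_vecs d N. vnorm N l \<le> \<rho>} \<subseteq> (\<lambda>g i. if i < N then g i else 0) ` ({..<N} \<rightarrow>\<^sub>E ?S)"
  proof
    fix l assume l: "l \<in> {l \<in> ok_vecs d N. vnorm N l \<le> \<rho>}"
    have "l i \<in> ?S" if "i < N" for i
      using that l cmod_le_vnorm[OF that, of l] by (auto simp: ok_vecs_def)
    then have "restrict l {..<N} \<in> {..<N} \<rightarrow>\<^sub>E ?S" by (simp add: restrict_PiE_iff)
    moreover have "l = (\<lambda>i. if i < N then restrict l {..<N} i else 0)"
      by (rule ext) (use l in \<open>simp add: ok_vecs_def\<close>)
    ultimately show "l \<in> (\<lambda>g i. if i < N then g i else 0) ` ({..<N} \<rightarrow>\<^sub>E ?S)"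
      unfolding image_iff by (intro bexI[where x="restrict l {..<N}"])
  qed
  then show "finite {l \<in> ok_vecs d N. vnorm N l \<le> \<rho>}"
    by (rule finite_subset) (intro finite_imageI finite_PiE finite_OK_bounded[OF d] finite_lessThan)
qed (auto simp: ok_vecs_def OK_0 OK_diff)

lemma vec_lattice_subset:
  assumes "vec_lattice N M" "L \<subseteq> M" "0 \<in> L" "\<And>l l'. l \<in> L \<Longrightarrow> l' \<in> L \<Longrightarrow> l - l' \<in> L"
  shows "vec_lattice N L"
proof -
  interpret vec_lattice N M by fact
  show ?thesis
  proof
    fix \<rho> show "finite {l \<in> L. vnorm N l \<le> \<rho>}"
      using assms(2) by (intro finite_subset[OF _ locally_finite[of \<rho>]]) auto
  qed (use assms supp in auto)
qed

definition ok_cell :: "int \<Rightarrow> nat \<Rightarrow> (nat \<Rightarrow> complex) set" where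
  "ok_cell d N = Pi\<^sub>E {..<N} (\<lambda>_. cell d)"

lemma packs_ok_cell:
  assumes d: "d < 0" shows "vec_lattice.packs N (ok_vecs d N) (ok_cell d N)"
proof -
  interpret vec_lattice N "ok_vecs d N" by (rule vec_lattice_ok_vecs[OF d])
  show ?thesis unfolding packs_def
  proof (intro conjI ballI impI)
    show "ok_cell d N \<in> sets (Leb N)" unfolding ok_cell_def Leb_def by (intro sets_PiM_I_finite) auto
    fix x l l' assume l: "l \<in> ok_vecs d N" "l' \<in> ok_vecs d N"
      and x: "x - l \<in> ok_cell d N" "x - l' \<in> ok_cell d N"
    show "l = l'"
    proof
      fix i show "l i = l' i"
      proof (cases "i < N")
        case True
        then have "x i - l i \<in> cell d" "x i - l' i \<in> cell d" "l i \<in> OK d" "l' i \<in> OK d"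
          using x l by (auto simp: ok_cell_def ok_vecs_def PiE_iff)
        then show ?thesis using cell_iff[OF d] by metis
      qed (use l in \<open>auto simp: ok_vecs_def\<close>)
    qed
  qed
qed

lemma emeasure_ok_cell: "d < 0 \<Longrightarrow> emeasure (Leb N) (ok_cell d N) = ennreal (covol d ^ N)"
  unfolding ok_cell_def Leb_def by (subst Leb.emeasure_PiM) (auto simp: emeasure_cell ennreal_power covol_def)

lemma ok_cell_bound:
  assumes d: "d < 0"
  shows "ok_cell d N \<subseteq> cballN N (sqrt (real N) * (1 + cmod (xi d)))"
proof
  fix x assume x: "x \<in> ok_cell d N"
  have "(vnorm N x)\<^sup>2 \<le> (\<Sum>i<N. (1 + cmod (xi d))\<^sup>2)"
    unfolding vnorm_sq using x cell_bound[OF d] by (intro sum_mono power_mono) (auto simp: ok_cell_def PiE_iff)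
  also have "\<dots> = (sqrt (real N) * (1 + cmod (xi d)))\<^sup>2" by (simp add: power_mult_distrib)
  finally have "vnorm N x \<le> sqrt (real N) * (1 + cmod (xi d))" by (rule power2_le_imp_le) simp
  then show "x \<in> cballN N (sqrt (real N) * (1 + cmod (xi d)))"
    using x by (auto simp: cballN_def space_Leb ok_cell_def PiE_iff)
qed

section \<open>Construction A at a split prime\<close>

text \<open>A rational prime \<open>p\<close> for which the minimal polynomial of \<open>xi d\<close> has a root \<open>\<rho>\<close> modulo \<open>p\<close>, so that
  \<open>a + b xi \<mapsto> a + b \<rho>\<close> maps \<open>OK d\<close> onto the prime field.\<close>
locale split_prime =
  fixes d p \<rho> :: int
  assumes d_neg: "d < 0" and p_prime: "prime p"
    and root: "p dvd \<rho> * \<rho> - xi_trace d * \<rho> + xi_norm d"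
begin

lemma p_pos: "0 < p" using p_prime by (simp add: prime_gt_0_int)

definition P :: "complex set" where
  "P = {ok_elt d a b | a b. p dvd a + b * \<rho>}"

lemma ok_elt_P: "ok_elt d a b \<in> P \<longleftrightarrow> p dvd a + b * \<rho>"
  by (auto simp: P_def ok_elt_inject[OF d_neg])

lemma of_int_P: "of_int k \<in> P \<longleftrightarrow> p dvd k"
  unfolding of_int_ok_elt[of k d] ok_elt_P by simp

lemma P_subset: "P \<subseteq> OK d"
  by (auto simp: P_def OK_def')

lemma P_elt: "x \<in> P \<Longrightarrow> \<exists>a b. x = ok_elt d a b \<and> p dvd a + b * \<rho>"
  by (auto simp: P_def)

text \<open>The reduction sending \<open>xi d\<close> to \<open>\<rho>\<close> is multiplicative
  modulo \<open>p\<close>, the defect being \<open>b * b'\<close> times the minimal polynomial at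
  \<open>\<rho>\<close>. Closure of \<open>P\<close> under multiplication by \<open>OK d\<close> and
  primality are both read off from this.\<close>

lemma mult_mem_P:
  "ok_elt d a b * ok_elt d a' b' \<in> P \<longleftrightarrow> p dvd (a + b * \<rho>) * (a' + b' * \<rho>)"
proof -
  have "(a * a' - b * b' * xi_norm d) + (a * b' + b * a' + b * b' * xi_trace d) * \<rho>
     = (a + b * \<rho>) * (a' + b' * \<rho>) - b * b' * (\<rho> * \<rho> - xi_trace d * \<rho> + xi_norm d)"
    by (simp add: algebra_simps)
  then show ?thesis
    unfolding ok_elt_mult[OF d_neg] ok_elt_P by (simp add: dvd_diff_left_iff root)
qed

lemma P_0: "0 \<in> P" using ok_elt_P[of 0 0] by (simp add: ok_elt_0)

lemma P_diff: "x \<in> P \<Longrightarrow> y \<in> P \<Longrightarrow> x - y \<in> P"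
proof -
  assume "x \<in> P" "y \<in> P"
  then obtain a b a' b' where *: "x = ok_elt d a b" "p dvd a + b * \<rho>" "y = ok_elt d a' b'" "p dvd a' + b' * \<rho>"
    by (meson P_elt)
  have "p dvd (a + b * \<rho>) - (a' + b' * \<rho>)" using * by (intro dvd_diff)
  then show ?thesis by (simp add: * ok_elt_diff ok_elt_P algebra_simps)
qed

lemma P_neg: "x \<in> P \<Longrightarrow> - x \<in> P" using P_diff[OF P_0] by fastforce

lemma P_add: "x \<in> P \<Longrightarrow> y \<in> P \<Longrightarrow> x + y \<in> P" using P_diff[OF _ P_neg, of x y] by simp

lemma P_mult: "a \<in> OK d \<Longrightarrow> x \<in> P \<Longrightarrow> a * x \<in> P"
  by (auto simp: OK_def' dest!: P_elt simp: mult_mem_P)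

lemma P_prime: "a \<in> OK d \<Longrightarrow> b \<in> OK d \<Longrightarrow> a * b \<in> P \<Longrightarrow> a \<in> P \<or> b \<in> P"
  using p_prime by (auto simp: OK_def' mult_mem_P ok_elt_P prime_dvd_mult_iff)

lemma prime_ideal_P: "prime_ideal_above d P p"
proof -
  have "1 \<notin> P" using of_int_P[of 1] p_prime by auto
  then show ?thesis
    unfolding prime_ideal_above_def is_ideal_OK_def
    using P_subset P_0 P_add P_neg P_mult P_prime p_prime of_int_P[of p] by simp
qed

text \<open>The squared modulus is the norm of \<open>x\<close>, a positive integer divisible by
  \<open>p\<close>.\<close>

lemma P_min_norm:
  assumes "x \<in> P" "x \<noteq> 0" shows "of_int p \<le> (cmod x)\<^sup>2"
proof -
  obtain a b where x: "x = ok_elt d a b" "p dvd a + b * \<rho>" using assms P_elt by blast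
  let ?n = "a * a + xi_trace d * a * b + xi_norm d * b * b"
  \<comment> \<open>The image of \<open>x\<close> times the image of its conjugate, in which
    \<open>xi_trace d - \<rho>\<close> replaces \<open>\<rho>\<close>, up to a multiple of the
    polynomial at \<open>\<rho>\<close>.\<close>
  have "?n = (a + b * \<rho>) * (a - b * \<rho> + xi_trace d * b) + b * b * (\<rho> * \<rho> - xi_trace d * \<rho> + xi_norm d)"
    by (simp add: algebra_simps)
  then have "p dvd ?n" using x(2) root by (metis dvd_add dvd_mult dvd_mult2)
  moreover have "0 < real_of_int ?n" using assms cmod_ok_elt_sq[OF d_neg, of a b] x
    by (metis norm_eq_zero zero_less_power2)
  then have "0 < ?n" by (simp only: of_int_0_less_iff)
  ultimately have "p \<le> ?n" by (rule zdvd_imp_le)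
  then show ?thesis unfolding x cmod_ok_elt_sq[OF d_neg] by (simp only: of_int_le_iff)
qed

text \<open>Thue's pigeonhole argument: more than \<open>p\<close> pairs have entries in
  \<open>{0..s}\<close>, so two of them share a residue, and their difference lies in
  \<open>P\<close>. The vector serves to bound the Voronoi cells.\<close>

lemma P_short_vector: "\<exists>x\<in>P. x \<noteq> 0 \<and> cmod x \<le> sqrt (of_int p) * (1 + cmod (xi d))"
proof -
  define s where "s = \<lfloor>sqrt (real_of_int p)\<rfloor>"
  have s0: "0 \<le> s" using p_pos by (simp add: s_def)
  have s1: "of_int s \<le> sqrt (real_of_int p)" "sqrt (real_of_int p) < of_int s + 1"
    unfolding s_def by linarith+
  have "real_of_int p = (sqrt (real_of_int p))\<^sup>2" using p_pos by simp
  also have "\<dots> < (of_int s + 1)\<^sup>2" using s1(2) p_pos by (intro power_strict_mono) auto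
  finally have "real_of_int p < real_of_int ((s + 1) * (s + 1))" by (simp add: power2_eq_square)
  then have lt: "p < (s + 1) * (s + 1)" by (simp only: of_int_less_iff)
  let ?A = "{0..s} \<times> {0..s}" and ?f = "\<lambda>(a, b). (a + b * \<rho>) mod p"
  have "\<not> inj_on ?f ?A"
  proof
    assume "inj_on ?f ?A"
    moreover have "?f ` ?A \<subseteq> {0..<p}" using p_pos by auto
    ultimately have "card ?A \<le> card {0..<p}" by (rule card_inj_on_le) simp
    then have "nat (s + 1) * nat (s + 1) \<le> nat p" using s0 by (simp add: card_cartesian_product)
    then have "nat ((s + 1) * (s + 1)) \<le> nat p" using s0 by (simp add: nat_mult_distrib)
    then show False using lt p_pos by linarith
  qed
  then obtain a b a' b' where ab: "(a, b) \<in> ?A" "(a', b') \<in> ?A" "(a, b) \<noteq> (a', b')"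
      "(a + b * \<rho>) mod p = (a' + b' * \<rho>) mod p"
    by (auto simp: inj_on_def)
  let ?x = "ok_elt d (a - a') (b - b')"
  have "p dvd (a + b * \<rho>) - (a' + b' * \<rho>)" using ab(4) by (simp add: mod_eq_dvd_iff)
  then have "?x \<in> P" by (simp add: ok_elt_P algebra_simps)
  moreover have "?x \<noteq> 0"
    using ab(3) ok_elt_inject[OF d_neg, of "a - a'" "b - b'" 0 0] by (simp add: ok_elt_0)
  moreover have "cmod ?x \<le> sqrt (of_int p) * (1 + cmod (xi d))"
  proof -
    have "\<bar>a - a'\<bar> \<le> s" "\<bar>b - b'\<bar> \<le> s" using ab by auto
    then have "\<bar>real_of_int (a - a')\<bar> \<le> of_int s" "\<bar>real_of_int (b - b')\<bar> \<le> of_int s"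
      by linarith+
    then have 1: "\<bar>real_of_int (a - a')\<bar> \<le> sqrt (of_int p)" "\<bar>real_of_int (b - b')\<bar> \<le> sqrt (of_int p)"
      using s1(1) by linarith+
    have "cmod ?x \<le> cmod (of_int (a - a')) + cmod (of_int (b - b') * xi d)"
      unfolding ok_elt_def by (rule norm_triangle_ineq)
    also have "\<dots> \<le> sqrt (of_int p) + sqrt (of_int p) * cmod (xi d)"
      unfolding norm_mult norm_of_int using 1 by (intro add_mono mult_right_mono) auto
    finally show ?thesis by (simp add: algebra_simps)
  qed
  ultimately show ?thesis by blast
qed

text \<open>The integers from 0 to \<open>p - 1\<close> represent \<open>OK d\<close> modulo
  \<open>P\<close>, so the cells at these points form a fundamental domain of \<open>P\<close>,
  obtained without a basis of \<open>P\<close>.\<close>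

definition P_cell :: "complex set" where
  "P_cell = (\<Union>k\<in>{0..<p}. {z. z - of_int k \<in> cell d})"

lemma P_cell_iff: "z \<in> P_cell \<longleftrightarrow> (\<exists>k. 0 \<le> k \<and> k < p \<and> ok_floor d z = of_int k)"
proof -
  have "z - of_int k \<in> cell d \<longleftrightarrow> ok_floor d z = of_int k" for k
    using cell_iff[OF d_neg OK_of_int, of z k] by auto
  then show ?thesis by (auto simp: P_cell_def)
qed

lemma cell_translate_sets [measurable]: "{z. z - w \<in> cell d} \<in> sets borel"
proof -
  have "(\<lambda>z. z - w) -` cell d \<in> sets borel"
    by (intro measurable_sets_borel[where M=borel]) auto
  then show ?thesis by (simp add: vimage_def)
qed

lemma P_cell_sets [measurable]: "P_cell \<in> sets borel"
  unfolding P_cell_def by measurable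

lemma emeasure_P_cell: "emeasure lborel P_cell = ennreal (of_int p * covol d)"
proof -
  have disj: "disjoint_family_on (\<lambda>k. {z. z - of_int k \<in> cell d}) {0..<p}"
    unfolding disjoint_family_on_def
  proof (intro ballI impI)
    fix m n :: int assume "m \<noteq> n"
    then show "{z. z - of_int m \<in> cell d} \<inter> {z. z - of_int n \<in> cell d} = {}"
      using cell_iff[OF d_neg OK_of_int] by (auto, metis of_int_eq_iff)
  qed
  have "emeasure lborel P_cell = (\<Sum>k\<in>{0..<p}. emeasure lborel {z. z - of_int k \<in> cell d})"
    unfolding P_cell_def by (rule sum_emeasure[symmetric]) (auto simp: disj)
  also have "\<dots> = (\<Sum>k\<in>{0..<p}. ennreal (covol d))"
    by (simp add: emeasure_lborel_translate emeasure_cell[OF d_neg])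
  also have "\<dots> = ennreal (of_int p * covol d)"
    using p_pos by (simp add: ennreal_mult ennreal_of_nat_eq_real_of_nat covol_def)
  finally show ?thesis .
qed

lemma ok_floor_diff:
  assumes "w \<in> OK d" shows "ok_floor d (z - w) = ok_floor d z - w"
proof -
  have "z - ok_floor d z \<in> cell d" using cell_iff[OF d_neg ok_floor_mem] by blast
  then have "(z - w) - (ok_floor d z - w) \<in> cell d" by simp
  then show ?thesis using cell_iff[OF d_neg OK_diff[OF ok_floor_mem assms]] by metis
qed

lemma P_cell_ex: "\<exists>w\<in>P. z - w \<in> P_cell"
proof -
  obtain a b where ab: "ok_floor d z = ok_elt d a b" by (auto simp: ok_floor_def)
  define k where "k = (a + b * \<rho>) mod p"
  let ?w = "ok_elt d (a - k) b"
  have "p dvd a + b * \<rho> - k" by (simp add: k_def)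
  then have w: "?w \<in> P" by (simp add: ok_elt_P algebra_simps)
  have "ok_floor d (z - ?w) = ok_floor d z - ?w"
    by (rule ok_floor_diff) (auto simp: OK_def')
  also have "\<dots> = of_int k" by (simp add: ab ok_elt_diff of_int_ok_elt[of k d])
  finally have "z - ?w \<in> P_cell" unfolding P_cell_iff using p_pos by (auto simp: k_def)
  with w show ?thesis by blast
qed

lemma P_cell_unique: "w \<in> P \<Longrightarrow> w' \<in> P \<Longrightarrow> z - w \<in> P_cell \<Longrightarrow> z - w' \<in> P_cell \<Longrightarrow> w = w'"
proof -
  assume *: "w \<in> P" "w' \<in> P" "z - w \<in> P_cell" "z - w' \<in> P_cell"
  have O: "w \<in> OK d" "w' \<in> OK d" using * P_subset by auto
  obtain k k' where k: "0 \<le> k" "k < p" "ok_floor d z - w = of_int k"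
      "0 \<le> k'" "k' < p" "ok_floor d z - w' = of_int k'"
    using *(3,4) unfolding P_cell_iff ok_floor_diff[OF O(1)] ok_floor_diff[OF O(2)] by blast
  have "w - w' = of_int (k' - k)" using k by (simp add: algebra_simps)
  moreover have "w - w' \<in> P" using * P_diff by blast
  ultimately have "p dvd k' - k" using of_int_P by metis
  then have "k' mod p = k mod p" by (simp add: mod_eq_dvd_iff)
  then have "k' = k" using k by simp
  then have "ok_floor d z - w = ok_floor d z - w'" using k by simp
  then show ?thesis by simp
qed

section \<open>Lattices of one-dimensional codes and their cells\<close>

definition lat :: "nat \<Rightarrow> (nat \<Rightarrow> int) \<Rightarrow> (nat \<Rightarrow> complex) set" where
  "lat N g = {l \<in> ok_vecs d N. \<forall>i<N. l i - of_int (g i) * l 0 \<in> P}"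

text \<open>Since \<open>g 0 = 1\<close>, the message \<open>y\<close> of a codeword can be taken to be the coordinate \<open>l 0\<close>.\<close>
lemma constrA_lat:
  assumes N: "0 < N" and g: "g 0 = 1"
  shows "constrA d P N 1 (\<lambda>i j. of_int (g i)) = lat N g"
proof (intro equalityI subsetI)
  fix l assume "l \<in> constrA d P N 1 (\<lambda>i j. of_int (g i))"
  then obtain y where l: "l \<in> ok_vecs d N" "y (0::nat) \<in> OK d" "\<And>i. i < N \<Longrightarrow> l i - of_int (g i) * y 0 \<in> P"
    by (auto simp: constrA_def ok_vecs_def)
  have "l i - of_int (g i) * l 0 \<in> P" if "i < N" for i
  proof -
    have "l 0 - y 0 \<in> P" using l(3)[OF N] g by simp
    then have "(l i - of_int (g i) * y 0) - of_int (g i) * (l 0 - y 0) \<in> P"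
      by (rule P_diff[OF l(3)[OF that] P_mult[OF OK_of_int]])
    then show ?thesis by (simp add: algebra_simps)
  qed
  then show "l \<in> lat N g" using l by (simp add: lat_def)
next
  fix l assume l: "l \<in> lat N g"
  then show "l \<in> constrA d P N 1 (\<lambda>i j. of_int (g i))"
    using N by (auto simp: constrA_def lat_def ok_vecs_def intro!: exI[of _ "\<lambda>_. l 0"])
qed

lemma is_constrA_lat:
  assumes N: "0 < N" and g: "g 0 = 1"
  shows "is_constrA_lattice d N (lat N g)"
proof -
  have "lat N g = (\<lambda>lam i. complex_of_real 1 * lam i) ` constrA d P N 1 (\<lambda>i j. of_int (g i))"
    using constrA_lat[of N g] assms by simp
  then show ?thesis
    unfolding is_constrA_lattice_def using prime_ideal_P N
    by (intro exI[of _ P] exI[of _ p] exI[of _ "1::nat"] exI[of _ "\<lambda>i j. of_int (g i)"]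
          exI[of _ "1::real"] conjI) (auto simp: OK_of_int)
qed

lemma lat_subset: "lat N g \<subseteq> ok_vecs d N"
  by (auto simp: lat_def)

lemma vec_lattice_lat: "vec_lattice N (lat N g)"
proof (rule vec_lattice_subset[OF vec_lattice_ok_vecs[OF d_neg] lat_subset])
  interpret vec_lattice N "ok_vecs d N" by (rule vec_lattice_ok_vecs[OF d_neg])
  show "0 \<in> lat N g" using zero_mem P_0 by (simp add: lat_def)
  fix l l' assume l: "l \<in> lat N g" "l' \<in> lat N g"
  have "(l i - of_int (g i) * l 0) - (l' i - of_int (g i) * l' 0) \<in> P" if "i < N" for i
    by (rule P_diff) (use l that in \<open>auto simp: lat_def\<close>)
  moreover have "(l i - of_int (g i) * l 0) - (l' i - of_int (g i) * l' 0) = (l - l') i - of_int (g i) * (l - l') 0" for i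
    by (simp add: algebra_simps)
  ultimately show "l - l' \<in> lat N g"
    using diff_mem[of l l'] l by (auto simp: lat_def)
qed

text \<open>Once \<open>l 0\<close> is chosen, the other coordinates are determined modulo
  \<open>P\<close>. The product is a fundamental domain of \<open>lat N g\<close> for every
  \<open>g\<close> with \<open>g 0 = 1\<close>, so all these lattices have the same volume.\<close>

definition lat_cell :: "nat \<Rightarrow> (nat \<Rightarrow> complex) set" where
  "lat_cell N = Pi\<^sub>E {..<N} (\<lambda>i. if i = 0 then cell d else P_cell)"

lemma lat_cell_sets: "lat_cell N \<in> sets (Leb N)"
  unfolding lat_cell_def Leb_def by (intro sets_PiM_I_finite) auto

lemma emeasure_lat_cell:
  assumes N: "0 < N"
  shows "emeasure (Leb N) (lat_cell N) = ennreal (covol d ^ N * of_int p ^ (N - 1))"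
proof -
  have "emeasure (Leb N) (lat_cell N) = (\<Prod>i<N. emeasure lborel (if i = 0 then cell d else P_cell))"
    unfolding lat_cell_def Leb_def by (subst Leb.emeasure_PiM) auto
  also have "\<dots> = emeasure lborel (cell d) * (\<Prod>i\<in>{..<N} - {0}. emeasure lborel P_cell)"
    using N by (subst prod.remove[of _ 0]) (auto intro!: arg_cong2[where f="(*)"] prod.cong)
  also have "\<dots> = ennreal (covol d) * ennreal (of_int p * covol d) ^ (N - 1)"
    using N by (simp add: emeasure_cell[OF d_neg] emeasure_P_cell)
  also have "\<dots> = ennreal (covol d * (of_int p * covol d) ^ (N - 1))"
  proof -
    have nn: "0 \<le> covol d" "0 \<le> of_int p * covol d" using covol_pos[OF d_neg] p_pos by auto
    show ?thesis unfolding ennreal_power[OF nn(2)] ennreal_mult[OF nn(1) zero_le_power[OF nn(2)]] ..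
  qed
  also have "covol d * (of_int p * covol d) ^ (N - 1) = covol d ^ N * of_int p ^ (N - 1)"
    using N by (cases N) (auto simp: power_mult_distrib)
  finally show ?thesis .
qed

text \<open>Triangular rounding: first \<open>l 0\<close> in \<open>OK d\<close>, then each other
  coordinate within the coset of \<open>P\<close> that \<open>l 0\<close> prescribes.\<close>

lemma covers_lat_cell:
  assumes N: "0 < N" and g: "g 0 = 1"
  shows "vec_lattice.covers N (lat N g) (lat_cell N)"
proof -
  interpret vec_lattice N "lat N g" by (rule vec_lattice_lat)
  show ?thesis unfolding covers_def
  proof (intro conjI ballI)
    fix x assume x: "x \<in> space (Leb N)"
    define l0 where "l0 = ok_floor d (x 0)"
    have l0: "l0 \<in> OK d" "x 0 - l0 \<in> cell d"
      using ok_floor_mem cell_iff[OF d_neg ok_floor_mem] by (auto simp: l0_def)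
    have "\<forall>i. \<exists>w. w \<in> P \<and> x i - of_int (g i) * l0 - w \<in> P_cell"
      using P_cell_ex by blast
    from choice[OF this] obtain w where w: "\<And>i. w i \<in> P" "\<And>i. x i - of_int (g i) * l0 - w i \<in> P_cell"
      by blast
    define l where "l i = (if N \<le> i then 0 else if i = 0 then l0 else of_int (g i) * l0 + w i)" for i
    have "l \<in> lat N g"
    proof -
      have "l i \<in> OK d" for i
        using l0 w(1)[of i] P_subset OK_add[OF OK_mult[OF d_neg OK_of_int l0(1)]] OK_0 by (auto simp: l_def)
      moreover have "l i - of_int (g i) * l 0 \<in> P" if "i < N" for i
        using that N g w(1)[of i] P_0 by (auto simp: l_def)
      moreover have "l i = 0" if "N \<le> i" for i using that by (simp add: l_def)
      ultimately show ?thesis by (auto simp: lat_def ok_vecs_def)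
    qed
    moreover have "x - l \<in> lat_cell N"
      using x l0(2) w(2) supp[OF calculation]
      by (auto simp: lat_cell_def PiE_iff l_def space_Leb extensional_def diff_diff_eq)
    ultimately show "\<exists>l\<in>lat N g. x - l \<in> lat_cell N" by blast
  qed (rule lat_cell_sets)
qed

lemma packs_lat_cell:
  assumes N: "0 < N" and g: "g 0 = 1"
  shows "vec_lattice.packs N (lat N g) (lat_cell N)"
proof -
  interpret vec_lattice N "lat N g" by (rule vec_lattice_lat)
  show ?thesis unfolding packs_def
  proof (intro conjI ballI impI)
    fix x l l' assume l: "l \<in> lat N g" "l' \<in> lat N g" and x: "x - l \<in> lat_cell N" "x - l' \<in> lat_cell N"
    have "l 0 \<in> OK d" "l' 0 \<in> OK d" "x 0 - l 0 \<in> cell d" "x 0 - l' 0 \<in> cell d"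
      using l N PiE_mem[OF x(1)[unfolded lat_cell_def], of 0] PiE_mem[OF x(2)[unfolded lat_cell_def], of 0]
      by (auto simp: lat_def ok_vecs_def)
    then have 0: "l 0 = l' 0" using cell_iff[OF d_neg] by metis
    show "l = l'"
    proof
      fix i show "l i = l' i"
      proof (cases "i < N \<and> i \<noteq> 0")
        case True
        then have "l i - of_int (g i) * l 0 \<in> P" "l' i - of_int (g i) * l 0 \<in> P" "x i - l i \<in> P_cell" "x i - l' i \<in> P_cell"
          using l 0 PiE_mem[OF x(1)[unfolded lat_cell_def], of i] PiE_mem[OF x(2)[unfolded lat_cell_def], of i]
          by (auto simp: lat_def)
        then have "l i - of_int (g i) * l 0 = l' i - of_int (g i) * l 0"
          by (intro P_cell_unique[of _ _ "x i - of_int (g i) * l 0"]) auto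
        then show ?thesis by simp
      next
        case False
        then show ?thesis using 0 supp[OF l(1)] supp[OF l(2)] by (cases "i = 0") auto
      qed
    qed
  qed (rule lat_cell_sets)
qed

lemma emeasure_voronoi_lat:
  assumes N: "0 < N" and g: "g 0 = 1"
  shows "emeasure (Leb N) (voronoi N (lat N g)) = ennreal (covol d ^ N * of_int p ^ (N - 1))"
proof -
  interpret vec_lattice N "lat N g" by (rule vec_lattice_lat)
  have "emeasure (Leb N) (voronoi N (lat N g)) \<le> emeasure (Leb N) (lat_cell N)"
    unfolding emeasure_voronoi by (intro emeasure_packs_le_covers packs_open_voronoi covers_lat_cell N g)
  moreover have "emeasure (Leb N) (lat_cell N) \<le> emeasure (Leb N) (voronoi N (lat N g))"
    by (intro emeasure_packs_le_covers covers_voronoi packs_lat_cell N g)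
  ultimately show ?thesis by (simp add: emeasure_lat_cell[OF N])
qed

text \<open>The lattice contains all vectors with coordinates in the ideal generated by the short
  \<open>b\<close>. Rounding \<open>x / b\<close> coordinatewise gives a lattice vector near
  \<open>x\<close>, and a point of the cell is no farther from 0 than from that vector.\<close>

lemma voronoi_lat_bound:
  "voronoi N (lat N g) \<subseteq> cballN N (sqrt (real N * of_int p) * (1 + cmod (xi d))\<^sup>2)"
proof
  fix x assume x: "x \<in> voronoi N (lat N g)"
  obtain b where b: "b \<in> P" "b \<noteq> 0" "cmod b \<le> sqrt (of_int p) * (1 + cmod (xi d))"
    using P_short_vector by blast
  let ?C = "sqrt (of_int p) * (1 + cmod (xi d))\<^sup>2"
  define l where "l i = (if i < N then ok_floor d (x i / b) * b else 0)" for i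
  have lP: "l i \<in> P" for i unfolding l_def using P_mult[OF ok_floor_mem b(1)] P_0 by auto
  have "l i = 0" if "N \<le> i" for i using that by (simp add: l_def)
  then have "l \<in> lat N g"
    using lP P_subset P_diff[OF lP P_mult[OF OK_of_int lP]] by (auto simp: lat_def ok_vecs_def)
  then have "vnorm N x \<le> vnorm N (x - l)" using x by (auto simp: voronoi_def)
  have "cmod ((x - l) i) \<le> ?C" if "i < N" for i
  proof -
    have "(x - l) i = (x i / b - ok_floor d (x i / b)) * b"
      using that b(2) by (simp add: l_def algebra_simps)
    moreover have "cmod (x i / b - ok_floor d (x i / b)) \<le> 1 + cmod (xi d)"
      using cell_iff[OF d_neg ok_floor_mem] by (intro cell_bound[OF d_neg]) blast
    then have "cmod (x i / b - ok_floor d (x i / b)) * cmod b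
        \<le> (1 + cmod (xi d)) * (sqrt (of_int p) * (1 + cmod (xi d)))"
      using b(3) by (rule mult_mono) auto
    ultimately have "cmod ((x - l) i) \<le> (1 + cmod (xi d)) * (sqrt (of_int p) * (1 + cmod (xi d)))"
      by (simp only: norm_mult)
    then show ?thesis by (simp add: power2_eq_square algebra_simps)
  qed
  then have "(vnorm N (x - l))\<^sup>2 \<le> (\<Sum>i<N. ?C\<^sup>2)"
    unfolding vnorm_sq by (intro sum_mono power_mono) auto
  also have "\<dots> = (sqrt (real N * of_int p) * (1 + cmod (xi d))\<^sup>2)\<^sup>2"
    using p_pos by (simp add: power_mult_distrib)
  finally have "vnorm N (x - l) \<le> sqrt (real N * of_int p) * (1 + cmod (xi d))\<^sup>2"
    by (rule power2_le_imp_le) (use p_pos in simp)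
  with \<open>vnorm N x \<le> vnorm N (x - l)\<close> show "x \<in> cballN N (sqrt (real N * of_int p) * (1 + cmod (xi d))\<^sup>2)"
    using x by (auto simp: cballN_def voronoi_def)
qed

section \<open>Averaging over the codes\<close>

text \<open>All members agree outside \<open>{1..<N}\<close>, so two of them are equal as functions
  as soon as the entries there agree modulo \<open>p\<close>.\<close>

definition family :: "nat \<Rightarrow> (nat \<Rightarrow> int) set" where
  "family N = (\<lambda>h i. if i = 0 then 1 else h i) ` ({1..<N} \<rightarrow>\<^sub>E {0..<p})"

lemma family_0: "g \<in> family N \<Longrightarrow> g 0 = 1"
  by (auto simp: family_def)

lemma finite_family: "finite (family N)"
  unfolding family_def by (intro finite_imageI finite_PiE) auto

lemma card_family: "card (family N) = nat p ^ (N - 1)"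
proof -
  have "inj_on (\<lambda>h i. if i = 0 then 1 else h i) ({1..<N} \<rightarrow>\<^sub>E {0..<p})"
  proof (rule inj_onI)
    fix h h' :: "nat \<Rightarrow> int"
    assume h: "h \<in> {1..<N} \<rightarrow>\<^sub>E {0..<p}" "h' \<in> {1..<N} \<rightarrow>\<^sub>E {0..<p}"
      and eq: "(\<lambda>i. if i = 0 then 1 else h i) = (\<lambda>i. if i = 0 then 1 else h' i)"
    show "h = h'"
    proof
      fix i show "h i = h' i"
        using h fun_cong[OF eq, of i] by (cases "i = 0") (auto simp: PiE_iff extensional_def)
    qed
  qed
  then have "card (family N) = card ({1..<N} \<rightarrow>\<^sub>E {0..<p})" unfolding family_def by (rule card_image)
  also have "\<dots> = nat p ^ (N - 1)" using p_pos by (simp add: card_PiE)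
  finally show ?thesis .
qed

text \<open>If \<open>l 0\<close> were in \<open>P\<close>, every coordinate would be. So
  \<open>l 0\<close> is invertible modulo \<open>P\<close>, and \<open>g i\<close> is determined as
  the quotient of \<open>l i\<close> by \<open>l 0\<close>.\<close>

lemma family_unique:
  assumes N: "0 < N" and gh: "g \<in> family N" "h \<in> family N"
    and l: "l \<in> lat N g" "l \<in> lat N h" "\<not> (\<forall>i<N. l i \<in> P)"
  shows "g = h"
proof -
  have l0: "l 0 \<in> OK d" using l N by (auto simp: lat_def ok_vecs_def)
  have "l 0 \<notin> P"
  proof
    assume "l 0 \<in> P"
    then have "(l i - of_int (g i) * l 0) + of_int (g i) * l 0 \<in> P" if "i < N" for i
      using l(1) that by (intro P_add P_mult OK_of_int) (auto simp: lat_def)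
    then show False using l(3) by simp
  qed
  have dv: "p dvd g i - h i" if "i < N" for i
  proof -
    have "(l i - of_int (h i) * l 0) - (l i - of_int (g i) * l 0) \<in> P"
      by (rule P_diff) (use l that in \<open>auto simp: lat_def\<close>)
    then have "of_int (g i - h i) * l 0 \<in> P" by (simp add: algebra_simps)
    then have "of_int (g i - h i) \<in> P" using P_prime[OF OK_of_int l0] \<open>l 0 \<notin> P\<close> by blast
    then show ?thesis using of_int_P by blast
  qed
  show ?thesis
  proof
    fix i show "g i = h i"
    proof (cases "i \<in> {1..<N}")
      case True
      then have "0 \<le> g i" "g i < p" "0 \<le> h i" "h i < p" using gh by (auto simp: family_def PiE_iff)
      then show ?thesis using dv[of i] True by (metis atLeastLessThan_iff mod_eq_dvd_iff mod_pos_pos_trivial)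
    next
      case False
      then show ?thesis using gh by (cases "i = 0") (auto simp: family_def PiE_iff extensional_def)
    qed
  qed
qed

text \<open>\<open>p ^ (N - 1)\<close> is both the number of codes and the index of each lattice in
  \<open>ok_vecs d N\<close>, so the bound has the correct density: each ambient vector that counts
  is met at most once.\<close>

lemma family_average:
  assumes N: "0 < N" and f: "\<And>l. l \<in> ok_vecs d N \<Longrightarrow> l \<noteq> 0 \<Longrightarrow> \<forall>i<N. l i \<in> P \<Longrightarrow> f l = 0"
  shows "\<exists>g\<in>family N. ennreal (of_int p ^ (N - 1)) * (\<integral>\<^sup>+l. (if l = 0 then 0 else f l) \<partial>count_space (lat N g))
     \<le> (\<integral>\<^sup>+l. f l \<partial>count_space (ok_vecs d N))"
proof -
  define I where "I g = (\<integral>\<^sup>+l. (if l = 0 then 0 else f l) \<partial>count_space (lat N g))" for g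
  have ne: "family N \<noteq> {}" using card_family[of N] p_pos by auto
  have I: "I g = (\<integral>\<^sup>+l. (if l = 0 then 0 else f l) * indicator (lat N g) l \<partial>count_space (ok_vecs d N))" for g
  proof -
    have "I g = (\<integral>\<^sup>+l. (if l = 0 then 0 else f l) * indicator (lat N g) l \<partial>count_space (lat N g))"
      unfolding I_def by (intro nn_integral_cong) auto
    also have "\<dots> = (\<integral>\<^sup>+l. (if l = 0 then 0 else f l) * indicator (lat N g) l \<partial>count_space (ok_vecs d N))"
      using lat_subset by (intro nn_integral_count_space_eq) auto
    finally show ?thesis .
  qed
  \<comment> \<open>A minimiser replaces the average: \<open>card (family N)\<close> copies of the
    least value are at most the sum.\<close>
  obtain g where g: "g \<in> family N" "\<And>h. h \<in> family N \<Longrightarrow> I g \<le> I h"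
    using ex_is_arg_min_if_finite[OF finite_family ne, of I] by (auto simp: is_arg_min_linorder)
  have "ennreal (of_int p ^ (N - 1)) * I g = of_nat (card (family N)) * I g"
    unfolding card_family using p_pos by (simp add: ennreal_of_nat_eq_real_of_nat)
  also have "\<dots> \<le> (\<Sum>h\<in>family N. I h)" by (rule sum_bounded_below) (rule g(2))
  also have "\<dots> = (\<integral>\<^sup>+l. (\<Sum>h\<in>family N. (if l = 0 then 0 else f l) * indicator (lat N h) l) \<partial>count_space (ok_vecs d N))"
    unfolding I by (rule nn_integral_sum[symmetric]) simp
  also have "\<dots> \<le> (\<integral>\<^sup>+l. f l \<partial>count_space (ok_vecs d N))"
  proof (rule nn_integral_mono)
    fix l assume "l \<in> space (count_space (ok_vecs d N))"
    then have l: "l \<in> ok_vecs d N" by simp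
    show "(\<Sum>h\<in>family N. (if l = 0 then 0 else f l) * indicator (lat N h) l) \<le> f l"
    proof (cases "l = 0 \<or> (\<forall>i<N. l i \<in> P) \<or> (\<forall>h\<in>family N. l \<notin> lat N h)")
      case True
      then have "(\<Sum>h\<in>family N. (if l = 0 then 0 else f l) * indicator (lat N h) l) = 0"
        using f[OF l] by (intro sum.neutral) (auto simp: indicator_def)
      then show ?thesis by simp
    next
      case False
      then obtain h where h: "h \<in> family N" "l \<in> lat N h" by auto
      have "(\<Sum>h\<in>family N. (if l = 0 then 0 else f l) * indicator (lat N h) l)
        = (\<Sum>k\<in>family N. if k = h then f l else 0)"
        using False h family_unique[OF N] by (intro sum.cong) (auto simp: indicator_def)
      also have "\<dots> = f l" using h(1) finite_family by simp
      finally show ?thesis by simp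
    qed
  qed
  finally show ?thesis using g(1) unfolding I_def by blast
qed

end

section \<open>One lattice for both overlap sums\<close>

context split_prime
begin

text \<open>The terms of \<open>eps\<close> are, in order, the contribution of the zero vector to
  the second moment of the point count, the error of replacing an integral by a sum over
  \<open>ok_vecs d N\<close>, and a bound for the averaged union bound in the smaller ball.\<close>

lemma good_lattice_exists:
  fixes r r' s2 :: real
  defines "c N \<equiv> sqrt (real N) * (1 + cmod (xi d))"
  defines "v N \<equiv> covol d ^ N * of_int p ^ (N - 1)"
  assumes N: "0 < N" and r: "0 < bvol N r" "(2 * r)\<^sup>2 < of_int p" "r' \<le> r" "0 \<le> r'" and s2: "0 < s2"
  defines "eps \<equiv> v N / bvol N r + (bvol N (r + c N) / bvol N r - 1) + bvol N (r' + c N) / v N"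
  shows "\<exists>g. g 0 = 1 \<and>
      measure (Leb N) (voronoi N (lat N g) - cballN N r) \<le> eps * v N \<and>
      err_prob N (lat N g) s2 \<le> measure (gauss_noise N s2) {x \<in> space (Leb N). r' < vnorm N x} + eps"
proof -
  let ?G = "gauss_noise N s2" and ?R = "ok_vecs d N"
  let ?ov = "\<lambda>M r l. emeasure M {x \<in> cballN N r. x - l \<in> cballN N r}"
  define b where "b = bvol N r"
  define V where "V = v N"
  have b: "0 < b" using r by (simp add: b_def)
  have V: "0 < V" using covol_pos[OF d_neg] p_pos by (simp add: V_def v_def)
  interpret G: prob_space ?G by (rule prob_space_gauss_noise[OF s2])
  interpret R: vec_lattice N ?R by (rule vec_lattice_ok_vecs[OF d_neg])
  note sG = sets_gauss_noise[OF s2, of N]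
  \<comment> \<open>With this weight the first summand, summed over the whole lattice, is the second
    moment of the point count divided by its squared mean, typically about 1 and so comparable with
    a probability.\<close>
  define f where "f l = ennreal (V / b\<^sup>2) * ?ov (Leb N) r l + ?ov ?G r' l" for l
  have f0: "f l = 0" if l: "l \<in> ?R" "l \<noteq> 0" "\<forall>i<N. l i \<in> P" for l
  proof -
    obtain i where i: "l i \<noteq> 0" using l(2) by (auto simp: fun_eq_iff)
    with R.supp[OF l(1), of i] have "i < N" by (meson not_le_imp_less)
    have "of_int p \<le> (cmod (l i))\<^sup>2" using P_min_norm l(3) \<open>i < N\<close> i by blast
    also have "\<dots> \<le> (vnorm N l)\<^sup>2" using cmod_le_vnorm[OF \<open>i < N\<close>] by (intro power_mono) auto
    finally have "(2 * r)\<^sup>2 < (vnorm N l)\<^sup>2" using r by linarith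
    then have lt: "2 * r < vnorm N l" by (rule power2_less_imp_less) simp
    \<comment> \<open>Balls of radius at most \<open>r\<close> whose centres are more than
      \<open>2 * r\<close> apart do not meet; hence \<open>f\<close> vanishes on exactly those
      vectors that many codes may share.\<close>
    have empty: "{x \<in> cballN N t. x - l \<in> cballN N t} = {}" if "t \<le> r" for t
    proof (rule ccontr)
      assume "\<not> ?thesis"
      then obtain x where x: "vnorm N x \<le> t" "vnorm N (x - l) \<le> t" by (auto simp: cballN_def)
      have "vnorm N l \<le> vnorm N (l - x) + vnorm N x" using vnorm_triangle[of N "l - x" x] by simp
      then show False using x lt that by (simp add: vnorm_minus_commute[of N l])
    qed
    show ?thesis unfolding f_def empty[OF order_refl] empty[OF r(3)] by simp
  qed
  obtain g where g: "g \<in> family N"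
      "ennreal (of_int p ^ (N - 1)) * (\<integral>\<^sup>+l. (if l = 0 then 0 else f l) \<partial>count_space (lat N g))
         \<le> (\<integral>\<^sup>+l. f l \<partial>count_space ?R)"
    using family_average[of N f, OF N f0] by blast
  have g0: "g 0 = 1" using g(1) by (rule family_0)
  let ?L = "lat N g"
  interpret L: vec_lattice N ?L by (rule vec_lattice_lat)
  have vL: "emeasure (Leb N) (voronoi N ?L) = ennreal V"
    unfolding V_def v_def using N g0 by (rule emeasure_voronoi_lat)
  define J where "J = (\<integral>\<^sup>+l. (if l = 0 then 0 else ?ov (Leb N) r l) \<partial>count_space ?L)"
  define H where "H = (\<integral>\<^sup>+l. (if l = 0 then 0 else ?ov ?G r' l) \<partial>count_space ?L)"
  have split: "(\<integral>\<^sup>+l. (if l = 0 then 0 else f l) \<partial>count_space ?L) = ennreal (V / b\<^sup>2) * J + H"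
  proof -
    have "(\<integral>\<^sup>+l. (if l = 0 then 0 else f l) \<partial>count_space ?L)
       = (\<integral>\<^sup>+l. ennreal (V / b\<^sup>2) * (if l = 0 then 0 else ?ov (Leb N) r l) + (if l = 0 then 0 else ?ov ?G r' l) \<partial>count_space ?L)"
      by (intro nn_integral_cong) (auto simp: f_def)
    also have "\<dots> = ennreal (V / b\<^sup>2) * J + H"
      unfolding J_def H_def by (subst nn_integral_add) (auto simp: nn_integral_cmult)
    finally show ?thesis .
  qed
  define K where "K = covol d ^ N"
  have K: "0 < K" using covol_pos[OF d_neg] by (simp add: K_def)
  note cell = packs_ok_cell[OF d_neg, of N] ok_cell_bound[OF d_neg, of N, folded c_def]
  have ovJ: "ennreal K * (\<integral>\<^sup>+l. ?ov (Leb N) r l \<partial>count_space ?R) \<le> ennreal (bvol N (r + c N)) * ennreal b"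
    using R.overlap_sum_le[OF refl cell, of r]
    unfolding emeasure_ok_cell[OF d_neg] emeasure_cballN K_def b_def .
  have "ennreal K * (\<integral>\<^sup>+l. ?ov ?G r' l \<partial>count_space ?R) \<le> ennreal (bvol N (r' + c N)) * emeasure ?G (cballN N r')"
    using R.overlap_sum_le[OF sG cell, of r'] unfolding emeasure_ok_cell[OF d_neg] K_def .
  also have "\<dots> \<le> ennreal (bvol N (r' + c N)) * 1"
    using G.emeasure_le_1 by (intro mult_left_mono) auto
  finally have ovH: "ennreal K * (\<integral>\<^sup>+l. ?ov ?G r' l \<partial>count_space ?R) \<le> ennreal (bvol N (r' + c N))" by simp
  have "ennreal K * (\<integral>\<^sup>+l. f l \<partial>count_space ?R)
     = ennreal (V / b\<^sup>2) * (ennreal K * (\<integral>\<^sup>+l. ?ov (Leb N) r l \<partial>count_space ?R))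
        + ennreal K * (\<integral>\<^sup>+l. ?ov ?G r' l \<partial>count_space ?R)"
    unfolding f_def by (subst nn_integral_add) (auto simp: nn_integral_cmult distrib_left mult_ac)
  also have "\<dots> \<le> ennreal (V / b\<^sup>2) * (ennreal (bvol N (r + c N)) * ennreal b) + ennreal (bvol N (r' + c N))"
    by (intro add_mono mult_left_mono ovJ ovH) simp
  also have "\<dots> = ennreal (V * (bvol N (r + c N) / b) + bvol N (r' + c N))"
    using b V by (subst ennreal_plus) (auto simp: ennreal_mult[symmetric] power2_eq_square)
  finally have "ennreal K * (\<integral>\<^sup>+l. f l \<partial>count_space ?R)
      \<le> ennreal (V * (bvol N (r + c N) / b) + bvol N (r' + c N))" .
  then have "ennreal K * (ennreal (of_int p ^ (N - 1)) * (ennreal (V / b\<^sup>2) * J + H))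
      \<le> ennreal (V * (bvol N (r + c N) / b) + bvol N (r' + c N))"
    using mult_left_mono[OF g(2), of "ennreal K"] unfolding split by simp
  then have main: "ennreal V * (ennreal (V / b\<^sup>2) * J + H) \<le> ennreal (V * (bvol N (r + c N) / b) + bvol N (r' + c N))"
    using K p_pos by (simp add: V_def v_def K_def ennreal_mult mult.assoc)
  have fin: "ennreal V * (ennreal (V / b\<^sup>2) * J + H) < \<top>"
    using main by (rule le_less_trans) simp
  have Hf: "H < \<top>" and Jf: "J < \<top>"
    using fin V b by (auto simp: ennreal_mult_less_top ennreal_mult_eq_top_iff less_top[symmetric])
  obtain h where h: "0 \<le> h" "H = ennreal h" using Hf by (cases H) auto
  obtain j where j: "0 \<le> j" "J = ennreal j" using Jf by (cases J) auto
  have "ennreal (V * (V / b\<^sup>2 * j + h)) \<le> ennreal (V * (bvol N (r + c N) / b) + bvol N (r' + c N))"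
    using main V b h j by (simp add: ennreal_mult[symmetric] ennreal_plus[symmetric] del: ennreal_plus)
  then have "V * (V / b\<^sup>2 * j + h) \<le> V * (bvol N (r + c N) / b) + bvol N (r' + c N)"
    using V b by (subst (asm) ennreal_le_iff) auto
  then have jh: "V / b\<^sup>2 * j + h \<le> bvol N (r + c N) / b + bvol N (r' + c N) / V"
    using V by (simp add: field_simps)
  define w where "w = measure (Leb N) (voronoi N ?L \<inter> cballN N r)"
  have fw: "emeasure (Leb N) (voronoi N ?L \<inter> cballN N r) = ennreal w"
    unfolding w_def
    by (rule emeasure_eq_ennreal_measure, rule less_top[THEN iffD2],
        rule le_less_trans[OF emeasure_mono[of _ "voronoi N ?L"]]) (auto simp: vL)
  have "ennreal (2 * V) \<le> ennreal w + ennreal ((V / b)\<^sup>2) * (\<integral>\<^sup>+l. ?ov (Leb N) r l \<partial>count_space ?L)"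
    using L.voronoi_chebyshev[OF vL V r(1)] unfolding fw b_def .
  also have "(\<integral>\<^sup>+l. ?ov (Leb N) r l \<partial>count_space ?L) = ennreal (b + j)"
  proof -
    have "{x \<in> cballN N r. x - 0 \<in> cballN N r} = cballN N r" by simp
    then show ?thesis
      using b j unfolding L.count_space_split_zero[of "?ov (Leb N) r"] J_def[symmetric]
      by (simp add: emeasure_cballN b_def[symmetric])
  qed
  also have "ennreal w + ennreal ((V / b)\<^sup>2) * ennreal (b + j) = ennreal (w + (V / b)\<^sup>2 * (b + j))"
    using b j by (simp add: ennreal_mult[symmetric] ennreal_plus[symmetric] w_def del: ennreal_plus)
  finally have "2 * V \<le> w + (V / b)\<^sup>2 * (b + j)"
    using b j by (subst (asm) ennreal_le_iff) (auto simp: w_def)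
  also have "(V / b)\<^sup>2 * (b + j) = V * (V / b) + V * (V / b\<^sup>2 * j)"
    using b by (simp add: field_simps power2_eq_square)
  finally have cheb: "2 * V \<le> w + V * (V / b) + V * (V / b\<^sup>2 * j)" by simp
  have meas_diff: "measure (Leb N) (voronoi N ?L - cballN N r) = V - w"
  proof -
    have "measure (Leb N) (voronoi N ?L - (voronoi N ?L \<inter> cballN N r))
      = measure (Leb N) (voronoi N ?L) - measure (Leb N) (voronoi N ?L \<inter> cballN N r)"
      by (intro measure_Diff) (auto simp: vL)
    moreover have "voronoi N ?L - (voronoi N ?L \<inter> cballN N r) = voronoi N ?L - cballN N r" by auto
    ultimately show ?thesis using V vL by (simp add: w_def measure_def)
  qed
  have "w \<le> V"
    using meas_diff measure_nonneg[of "Leb N" "voronoi N ?L - cballN N r"] by linarith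
  have eps: "eps = V / b + (bvol N (r + c N) / b - 1) + bvol N (r' + c N) / V"
    by (simp add: eps_def b_def V_def)
  \<comment> \<open>Here the nonnegative Gaussian part \<open>h\<close> is dropped from
    \<open>jh\<close>.\<close>
  have 1: "V - w \<le> eps * V"
  proof -
    have "V * (V / b\<^sup>2 * j) \<le> V * (bvol N (r + c N) / b + bvol N (r' + c N) / V)"
      using jh h V by (intro mult_left_mono) auto
    then show ?thesis using cheb unfolding eps by (simp add: algebra_simps)
  qed
  \<comment> \<open>\<open>w \<le> V\<close> turns the Chebyshev bound into a lower bound for the
    Lebesgue part, which uses up nearly all of the total in \<open>jh\<close> and leaves at most
    \<open>eps\<close> for \<open>h\<close>.\<close>
  have 2: "h \<le> eps"
  proof -
    have "V * 1 \<le> V * (V / b + V / b\<^sup>2 * j)" using cheb \<open>w \<le> V\<close> by (simp add: algebra_simps)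
    then have "1 \<le> V / b + V / b\<^sup>2 * j" using V by (simp only: mult_le_cancel_left_pos)
    then show ?thesis using jh unfolding eps by linarith
  qed
  have sp: "space ?G = space (Leb N)" by (rule space_gauss_noise[OF s2])
  have "emeasure ?G (space ?G - voronoi N ?L) \<le> emeasure ?G {x \<in> space (Leb N). r' < vnorm N x} + H"
    unfolding H_def by (rule L.err_union_bound[OF sG])
  then have "ennreal (err_prob N ?L s2) \<le> ennreal (measure ?G {x \<in> space (Leb N). r' < vnorm N x} + h)"
    unfolding err_prob_def G.emeasure_eq_measure h(2) using h(1) by (simp add: ennreal_plus)
  then have "err_prob N ?L s2 \<le> measure ?G {x \<in> space (Leb N). r' < vnorm N x} + h"
    using h by (subst (asm) ennreal_le_iff) auto
  then have "err_prob N ?L s2 \<le> measure ?G {x \<in> space (Leb N). r' < vnorm N x} + eps"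
    using 2 by linarith
  then show ?thesis using g0 1 by (intro exI[of _ g]) (simp add: meas_diff V_def)
qed

end

section \<open>Choice of the prime; monotonicity and moments\<close>

text \<open>A prime divisor \<open>p\<close> of \<open>d * M * M - 1\<close> makes \<open>d\<close>
  a square modulo \<open>p\<close>: multiplying by \<open>d\<close> shows that the square of
  \<open>d * M\<close> is \<open>d\<close>. Such a \<open>p\<close> does not divide the factorial
  \<open>M\<close>, hence is large.\<close>

lemma split_prime_exists:
  assumes d: "d < 0" shows "\<exists>p \<rho>. int n < p \<and> split_prime d p \<rho>"
proof -
  \<comment> \<open>\<open>n + 2\<close> instead of \<open>n\<close> forces \<open>p\<close> to be
    odd, as halving modulo \<open>p\<close> requires when \<open>d mod 4 = 1\<close>.\<close>
  define M :: int where "M = fact (n + 2)"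
  define x where "x = d * M * M - 1"
  have M: "1 \<le> M" unfolding M_def by (rule fact_ge_1)
  have "d * (M * M) \<le> - 1 * (M * M)" using d by (intro mult_right_mono) auto
  moreover have "1 * 1 \<le> M * M" using M by (intro mult_mono) auto
  ultimately have "x \<le> - 2" unfolding x_def by (simp add: mult.assoc)
  then have "\<not> is_unit x" by auto
  then obtain p where p: "p dvd x" "prime p"
    using prime_divisor_exists[of x] \<open>x \<le> - 2\<close> by auto
  have p0: "0 < p" using p(2) by (rule prime_gt_0_int)
  have "\<not> p dvd M"
  proof
    assume "p dvd M"
    then have "p dvd d * M * M - x" using p(1) by (intro dvd_diff) auto
    then have "p dvd 1" by (simp add: x_def)
    then show False using p(2) by auto
  qed
  have big: "int (n + 2) < p"
  proof (rule ccontr)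
    assume "\<not> ?thesis"
    then have "nat p \<le> n + 2" by simp
    then have "nat p dvd fact (n + 2)" using p0 by (intro dvd_fact) auto
    then have "int (nat p) dvd int (fact (n + 2))" by (simp only: int_dvd_int_iff)
    moreover have "M = int (fact (n + 2))" unfolding M_def by (rule of_nat_fact[symmetric])
    ultimately have "p dvd M" using p0 by simp
    then show False using \<open>\<not> p dvd M\<close> by simp
  qed
  have "p dvd d * x" using p(1) by simp
  also have "d * x = (d * M) * (d * M) - d" by (simp add: x_def algebra_simps)
  finally have sq: "p dvd (d * M) * (d * M) - d" .
  show ?thesis
  proof (cases "d mod 4 = 1")
    case False
    then have "split_prime d p (d * M)"
      using d p(2) sq by unfold_locales (auto simp: xi_trace_def xi_norm_def)
    then show ?thesis using big by (intro exI[of _ p] exI[of _ "d * M"]) auto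
  next
    case True
    have oddp: "odd p"
      using p(2) big prime_odd_int by auto
    \<comment> \<open>Adding the odd \<open>p\<close> if necessary makes the square root of
      \<open>d\<close> odd, so that \<open>\<rho> = (s + 1) / 2\<close> is an integer.\<close>
    define s where "s = (if odd (d * M) then d * M else d * M + p)"
    have "odd s" using oddp by (auto simp: s_def)
    then obtain k where k: "s = 2 * k + 1" by (auto elim: oddE)
    define \<rho> where "\<rho> = k + 1"
    have "p dvd s * s - d"
    proof -
      have "s * s - d = ((d * M) * (d * M) - d) + p * (if odd (d * M) then 0 else 2 * d * M + p)"
        by (simp add: s_def algebra_simps)
      then show ?thesis using sq by (metis dvd_add dvd_triv_left)
    qed
    also have "s * s - d = 4 * (\<rho> * \<rho> - xi_trace d * \<rho> + xi_norm d)"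
    proof -
      have "4 * (\<rho> * \<rho> - xi_trace d * \<rho> + xi_norm d) = 4 * (\<rho> * \<rho> - \<rho>) + 4 * xi_norm d"
        using True by (simp add: xi_trace_def)
      also have "\<dots> = s * s - d" unfolding xi_norm_mod1[OF True] k \<rho>_def by (simp add: algebra_simps)
      finally show ?thesis by simp
    qed
    finally have "p dvd 2 * (2 * (\<rho> * \<rho> - xi_trace d * \<rho> + xi_norm d))" by simp
    moreover have "\<not> p dvd 2" using big zdvd_imp_le[of p 2] by auto
    ultimately have "p dvd \<rho> * \<rho> - xi_trace d * \<rho> + xi_norm d"
      using p(2) by (metis prime_dvd_multD)
    then have "split_prime d p \<rho>" using d p(2) by unfold_locales
    then show ?thesis using big by (intro exI[of _ p] exI[of _ \<rho>]) auto
  qed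
qed

text \<open>The prime comes first and the dimension is fitted to it as the greatest \<open>N\<close>
  with \<open>N ^ (2 * N) \<le> p\<close>. Nothing about gaps between such primes enters.\<close>

lemma split_prime_between_powers:
  assumes d: "d < 0"
  shows "\<exists>N\<ge>M. \<exists>p \<rho>. split_prime d p \<rho> \<and> real N ^ (2 * N) \<le> of_int p \<and> of_int p \<le> real (N + 1) ^ (2 * (N + 1))"
proof -
  obtain p \<rho> where p: "int (M ^ (2 * M)) < p" "split_prime d p \<rho>"
    using split_prime_exists[OF d] by blast
  let ?Q = "\<lambda>n. int (n ^ (2 * n)) \<le> p"
  have bd: "n \<le> nat p + 1" if "?Q n" for n
  proof (cases "n = 0")
    case False
    then have "n \<le> n ^ (2 * n)" by (intro self_le_power) auto
    then show ?thesis using that by linarith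
  qed simp
  have Q: "?Q M" using p(1) by simp
  define N where "N = (GREATEST n. ?Q n)"
  have QN: "?Q N" unfolding N_def by (rule GreatestI_nat[of ?Q M "nat p + 1", OF Q bd])
  have NM: "M \<le> N" unfolding N_def by (rule Greatest_le_nat[of ?Q M "nat p + 1", OF Q bd])
  have "\<not> ?Q (N + 1)"
  proof
    assume *: "?Q (N + 1)"
    have "N + 1 \<le> N" unfolding N_def
      by (rule Greatest_le_nat[where P="?Q" and b="nat p + 1"]) (use * bd in \<open>auto simp: N_def\<close>)
    then show False by simp
  qed
  then have "p \<le> int ((N + 1) ^ (2 * (N + 1)))" by simp
  then have "real_of_int p \<le> real_of_int (int ((N + 1) ^ (2 * (N + 1))))" by (simp only: of_int_le_iff)
  then have 1: "of_int p \<le> real (N + 1) ^ (2 * (N + 1))"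
    by (simp only: of_int_of_nat_eq of_nat_power of_int_power)
  have "real_of_int (int (N ^ (2 * N))) \<le> of_int p" using QN by (simp only: of_int_le_iff)
  then have 2: "real N ^ (2 * N) \<le> of_int p" by (simp only: of_int_of_nat_eq of_nat_power of_int_power)
  show ?thesis
    by (rule exI[of _ N], rule conjI[OF NM], rule exI[of _ p], rule exI[of _ \<rho>])
       (rule conjI[OF p(2) conjI[OF 2 1]])
qed

lemma power_powr_inverse_dim:
  assumes "0 < N" "0 < (y::real)" shows "(y ^ N) powr (2 / real (2 * N)) = y"
  using assms by (simp add: powr_powr powr_realpow[symmetric])

section \<open>Second moments, and monotonicity in the noise\<close>

context vec_lattice
begin

lemma voronoi_integrable:
  assumes V: "voronoi N \<Lambda> \<subseteq> cballN N \<rho>"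
  shows "integrable (Leb N) (\<lambda>x. indicator (voronoi N \<Lambda>) x * (vnorm N x)\<^sup>2)"
proof (rule integrableI_bounded_set[where A="voronoi N \<Lambda>" and B="\<rho>\<^sup>2"])
  have "emeasure (Leb N) (voronoi N \<Lambda>) \<le> emeasure (Leb N) (cballN N \<rho>)"
    using V by (intro emeasure_mono) auto
  also have "\<dots> < \<infinity>" by (simp add: emeasure_cballN)
  finally show "emeasure (Leb N) (voronoi N \<Lambda>) < \<infinity>" .
  show "AE x\<in>voronoi N \<Lambda> in Leb N. norm (indicator (voronoi N \<Lambda>) x * (vnorm N x)\<^sup>2) \<le> \<rho>\<^sup>2"
    using V by (intro AE_I2) (auto simp: cballN_def intro!: power_mono)
qed auto

definition moment :: real where
  "moment = (LINT x|Leb N. indicator (voronoi N \<Lambda>) x * (vnorm N x)\<^sup>2)"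

lemma second_moment_eq:
  "second_moment N \<Lambda> = (1 / real (2 * N)) * (moment / vol_vor N \<Lambda>)"
  by (simp add: second_moment_def moment_def set_lebesgue_integral_def)

lemma moment_upper:
  assumes V: "voronoi N \<Lambda> \<subseteq> cballN N \<rho>"
  shows "moment \<le> r\<^sup>2 * measure (Leb N) (voronoi N \<Lambda>) + \<rho>\<^sup>2 * measure (Leb N) (voronoi N \<Lambda> - cballN N r)"
proof -
  let ?V = "voronoi N \<Lambda>"
  have fin: "emeasure (Leb N) A < \<infinity>" if "A \<subseteq> ?V" for A
  proof -
    have "emeasure (Leb N) A \<le> emeasure (Leb N) (cballN N \<rho>)" using V that by (intro emeasure_mono) auto
    also have "\<dots> < \<infinity>" by (simp add: emeasure_cballN)
    finally show ?thesis .
  qed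
  have i: "integrable (Leb N) (\<lambda>x. indicator ?V x :: real)" "integrable (Leb N) (\<lambda>x. indicator (?V - cballN N r) x :: real)"
    using fin by (auto intro!: integrable_real_indicator)
  have "moment \<le> (LINT x|Leb N. r\<^sup>2 * indicator ?V x + \<rho>\<^sup>2 * indicator (?V - cballN N r) x)"
    unfolding moment_def
  proof (rule integral_mono)
    show "integrable (Leb N) (\<lambda>x. r\<^sup>2 * indicator ?V x + \<rho>\<^sup>2 * indicator (?V - cballN N r) x)"
      using i by auto
    fix x assume x: "x \<in> space (Leb N)"
    show "indicator ?V x * (vnorm N x)\<^sup>2 \<le> r\<^sup>2 * indicator ?V x + \<rho>\<^sup>2 * indicator (?V - cballN N r) x"
    proof (cases "x \<in> ?V")
      case True
      then have "vnorm N x \<le> \<rho>" using V by (auto simp: cballN_def)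
      then have "(vnorm N x)\<^sup>2 \<le> \<rho>\<^sup>2" by (intro power_mono) auto
      moreover have "(vnorm N x)\<^sup>2 \<le> r\<^sup>2" if "vnorm N x \<le> r" using that by (intro power_mono) auto
      ultimately show ?thesis using True x
        by (cases "vnorm N x \<le> r") (auto simp: cballN_def intro: add_increasing)
    qed simp
  qed (rule voronoi_integrable[OF V])
  also have "\<dots> = r\<^sup>2 * measure (Leb N) ?V + \<rho>\<^sup>2 * measure (Leb N) (?V - cballN N r)"
    using i by simp
  finally show ?thesis .
qed

text \<open>Gibbs' inequality: by Jensen, the Gaussian integral \<open>(pi / s) ^ N\<close> dominates
  \<open>v * exp (- s * m)\<close> with \<open>m\<close> the mean of \<open>(vnorm N x)\<^sup>2\<close> over the cell.\<close>
lemma nsm_lower: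
  assumes N: "0 < N" and V: "voronoi N \<Lambda> \<subseteq> cballN N \<rho>"
    and v: "emeasure (Leb N) (voronoi N \<Lambda>) = ennreal (A ^ N)" and A: "0 < A"
  shows "1 / (2 * pi * exp 1) \<le> nsm N \<Lambda>"
proof -
  let ?V = "voronoi N \<Lambda>"
  define m where "m = moment / A ^ N"
  have mv: "measure (Leb N) ?V = A ^ N" using v A by (simp add: measure_def)
  have m0: "0 \<le> m" unfolding m_def moment_def using A by (intro divide_nonneg_pos integral_nonneg_AE) auto
  have iV: "integrable (Leb N) (\<lambda>x. indicator ?V x :: real)" using v by (intro integrable_real_indicator) auto
  note iM = voronoi_integrable[OF V]
  \<comment> \<open>\<open>\<eta>\<close> keeps the denominator of \<open>s\<close> positive without
    showing \<open>m > 0\<close>; it is removed at the end. The choice of \<open>s\<close> makes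
    \<open>s * m\<close> essentially \<open>real N\<close>.\<close>
  have key: "A \<le> pi * exp 1 * (m + \<eta>) / real N" if \<eta>: "0 < \<eta>" for \<eta>
  proof -
    define s where "s = real N / (m + \<eta>)"
    have s: "0 < s" using N m0 \<eta> by (simp add: s_def)
    have ig: "integrable (Leb N) (\<lambda>x. exp (- (s * (vnorm N x)\<^sup>2)))"
      using nn_integral_gaussian_Leb[OF s, of N] by (intro integrableI_nonneg) auto
    \<comment> \<open>The tangent of the exponential at the mean \<open>m\<close>, cut down to the
      cell: the pointwise form of Jensen's inequality.\<close>
    have lin: "exp (- (s * m)) * (1 + s * m) * indicator ?V x - exp (- (s * m)) * s * (indicator ?V x * (vnorm N x)\<^sup>2)
        \<le> exp (- (s * (vnorm N x)\<^sup>2))" for x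
    proof (cases "x \<in> ?V")
      case True
      have "1 + (s * m - s * (vnorm N x)\<^sup>2) \<le> exp (s * m - s * (vnorm N x)\<^sup>2)" by (rule exp_ge_add_one_self)
      then have "exp (- (s * m)) * (1 + (s * m - s * (vnorm N x)\<^sup>2)) \<le> exp (- (s * m)) * exp (s * m - s * (vnorm N x)\<^sup>2)"
        by (intro mult_left_mono) auto
      also have "\<dots> = exp (- (s * (vnorm N x)\<^sup>2))" by (simp add: exp_add[symmetric])
      finally show ?thesis using True by (simp add: algebra_simps)
    qed simp
    have "exp (- (s * m)) * A ^ N = exp (- (s * m)) * (1 + s * m) * A ^ N - exp (- (s * m)) * s * moment"
      using A by (simp add: m_def field_simps)
    also have "\<dots> = (LINT x|Leb N. exp (- (s * m)) * (1 + s * m) * indicator ?V x - exp (- (s * m)) * s * (indicator ?V x * (vnorm N x)\<^sup>2))"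
      using iV iM by (simp add: moment_def mv)
    also have "\<dots> \<le> (LINT x|Leb N. exp (- (s * (vnorm N x)\<^sup>2)))"
      using iV iM by (intro integral_mono ig lin Bochner_Integration.integrable_diff integrable_mult_right) auto
    also have "\<dots> = (pi / s) ^ N"
      using nn_integral_gaussian_Leb[OF s, of N] s nn_integral_eq_integral[OF ig]
      by (simp add: integral_nonneg_AE)
    finally have le: "exp (- (s * m)) * A ^ N \<le> (pi / s) ^ N" .
    have "s * m \<le> real N" using m0 \<eta> N by (simp add: s_def field_simps)
    then have "exp (- real N) * A ^ N \<le> exp (- (s * m)) * A ^ N" using A by (intro mult_right_mono) auto
    with le have "exp (- real N) * A ^ N \<le> (pi / s) ^ N" by linarith
    then have "exp (real N) * (exp (- real N) * A ^ N) \<le> exp (real N) * (pi / s) ^ N"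
      by (intro mult_left_mono) auto
    then have "A ^ N \<le> exp (real N) * (pi / s) ^ N"
      by (simp add: mult.assoc[symmetric] exp_add[symmetric])
    also have "exp (real N) * (pi / s) ^ N = (exp 1 * (pi / s)) ^ N"
      using exp_of_nat_mult[of N "1::real"] unfolding power_mult_distrib by simp
    finally have "A \<le> exp 1 * (pi / s)" using s N A power_mono_iff[of A "exp 1 * (pi / s)" N] by auto
    then show ?thesis using N m0 \<eta> by (simp add: s_def field_simps)
  qed
  have "A \<le> pi * exp 1 * m / real N"
  proof (rule field_le_epsilon)
    fix e :: real assume "0 < e"
    then have "A \<le> pi * exp 1 * (m + e * real N / (pi * exp 1)) / real N" using N by (intro key) auto
    also have "\<dots> = pi * exp 1 * m / real N + e" using N by (simp add: field_simps)
    finally show "A \<le> pi * exp 1 * m / real N + e" .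
  qed
  moreover have "nsm N \<Lambda> = m / (2 * real N) / A"
    unfolding nsm_def second_moment_eq vol_vor_def mv power_powr_inverse_dim[OF N A] m_def by simp
  moreover have "1 \<le> 2 * pi * exp 1 * (m / (2 * real N) / A)" if "A \<le> pi * exp 1 * m / real N"
  proof -
    have "1 \<le> pi * exp 1 * m / real N / A"
      unfolding le_divide_eq_1_pos[OF A] by (rule that)
    also have "\<dots> = 2 * pi * exp 1 * (m / (2 * real N) / A)" by simp
    finally show ?thesis .
  qed
  ultimately have "1 \<le> 2 * pi * exp 1 * nsm N \<Lambda>" by simp
  then show ?thesis by (simp add: divide_le_eq mult.commute)
qed

text \<open>Noise of variance \<open>s1\<close> is \<open>c\<close> times noise of variance
  \<open>s2\<close>. The cell is star-shaped about 0, so a contracted point lies outside it only if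
  the original point does.\<close>

lemma err_prob_mono:
  assumes s: "0 < s1" "s1 \<le> s2"
  shows "err_prob N \<Lambda> s1 \<le> err_prob N \<Lambda> s2"
proof (cases "s1 = s2")
  case False
  define c where "c = sqrt (s1 / s2)"
  have c: "0 < c" "c < 1" "c\<^sup>2 = s1 / s2" and s2: "0 < s2" using s False by (auto simp: c_def)
  let ?V = "voronoi N \<Lambda>"
  let ?g = "\<lambda>s x. exp (- (vnorm N x)\<^sup>2 / (2 * s)) / (2 * pi * s) ^ N"
  have em: "emeasure (gauss_noise N s) (space (gauss_noise N s) - ?V) = (\<integral>\<^sup>+x. ennreal (?g s x) * indicator (space (Leb N) - ?V) x \<partial>Leb N)"
    if "0 < s" for s
    by (subst space_gauss_noise[OF that], subst gauss_noise_density[OF that], rule emeasure_density) measurable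
  have "emeasure (gauss_noise N s1) (space (gauss_noise N s1) - ?V)
    = ennreal (c ^ (2 * N)) * (\<integral>\<^sup>+x. ennreal (?g s1 (\<lambda>i\<in>{..<N}. of_real c * x i))
         * indicator (space (Leb N) - ?V) (\<lambda>i\<in>{..<N}. of_real c * x i) \<partial>Leb N)"
    unfolding em[OF s(1)] by (rule nn_integral_Leb_scale[OF c(1)]) measurable
  also have "\<dots> \<le> ennreal (c ^ (2 * N)) * (\<integral>\<^sup>+x. ennreal (?g s1 (\<lambda>i\<in>{..<N}. of_real c * x i))
         * indicator (space (Leb N) - ?V) x \<partial>Leb N)"
  proof (intro mult_left_mono nn_integral_mono)
    fix x assume x: "x \<in> space (Leb N)"
    have "(\<lambda>i\<in>{..<N}. of_real c * x i) \<in> ?V" if "x \<in> ?V"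
      using shrink_voronoi[OF that, of c] c open_voronoi_subset by auto
    then show "indicator (space (Leb N) - ?V) (\<lambda>i\<in>{..<N}. of_real c * x i) \<le> (indicator (space (Leb N) - ?V) x :: ennreal)"
      using x by (auto simp: indicator_def)
  qed auto
  also have "\<dots> = (\<integral>\<^sup>+x. ennreal (c ^ (2 * N)) * (ennreal (?g s1 (\<lambda>i\<in>{..<N}. of_real c * x i))
         * indicator (space (Leb N) - ?V) x) \<partial>Leb N)"
    using c by (intro nn_integral_cmult[symmetric]) (simp add: vnorm_scale)
  also have "\<dots> = emeasure (gauss_noise N s2) (space (gauss_noise N s2) - ?V)"
    unfolding em[OF s2]
  proof (rule nn_integral_cong)
    fix x
    have 1: "(vnorm N (\<lambda>i\<in>{..<N}. of_real c * x i))\<^sup>2 = s1 / s2 * (vnorm N x)\<^sup>2"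
      using c by (simp add: vnorm_scale power_mult_distrib)
    have 2: "c ^ (2 * N) = s1 ^ N / s2 ^ N" unfolding power_mult c(3) by (simp add: power_divide)
    have "c ^ (2 * N) * ?g s1 (\<lambda>i\<in>{..<N}. of_real c * x i) = ?g s2 x"
    proof -
      have e: "- (s1 / s2 * (vnorm N x)\<^sup>2) / (2 * s1) = - (vnorm N x)\<^sup>2 / (2 * s2)"
        using s s2 by (simp add: field_simps)
      have "s1 ^ N / s2 ^ N * (E / (2 * pi * s1) ^ N) = E / (2 * pi * s2) ^ N" for E
        using s s2 unfolding power_mult_distrib by (simp add: field_simps)
      then show ?thesis unfolding 1 2 e .
    qed
    then have "ennreal (c ^ (2 * N)) * ennreal (?g s1 (\<lambda>i\<in>{..<N}. of_real c * x i)) = ennreal (?g s2 x)"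
      using c by (subst ennreal_mult'[symmetric]) auto
    then show "ennreal (c ^ (2 * N)) * (ennreal (?g s1 (\<lambda>i\<in>{..<N}. of_real c * x i)) * indicator (space (Leb N) - ?V) x)
      = ennreal (?g s2 x) * indicator (space (Leb N) - ?V) x"
      by (simp add: mult.assoc[symmetric])
  qed
  finally have le: "emeasure (gauss_noise N s1) (space (gauss_noise N s1) - ?V)
     \<le> emeasure (gauss_noise N s2) (space (gauss_noise N s2) - ?V)" .
  interpret G1: prob_space "gauss_noise N s1" by (rule prob_space_gauss_noise[OF s(1)])
  interpret G2: prob_space "gauss_noise N s2" by (rule prob_space_gauss_noise[OF s2])
  from le show ?thesis unfolding err_prob_def G1.emeasure_eq_measure G2.emeasure_eq_measure
    by (simp add: ennreal_le_iff)
qed simp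

end

section \<open>Good lattices\<close>

text \<open>A bound for the \<open>eps\<close> of \<open>good_lattice_exists\<close>, term by term.
  \<open>C / 2 ^ N\<close> bounds the relative growth of a radius when one cell of
  \<open>ok_vecs d N\<close> is added.\<close>

definition loss :: "real \<Rightarrow> real \<Rightarrow> nat \<Rightarrow> real" where
  "loss \<beta> C N = 2 * exp (- \<beta> * real N) + ((1 + C / 2 ^ N) ^ (2 * N) - 1)
      + (1 + C / 2 ^ N) ^ (2 * N) * exp (- \<beta> * real N)"

context split_prime
begin

lemma good_lattice_at:
  fixes \<beta> \<delta> :: real and N :: nat
  defines "C \<equiv> 1 + cmod (xi d)" and "\<mu> \<equiv> exp (2 * \<beta>)"
  defines "C1 \<equiv> C * sqrt (pi * exp 1 * exp \<beta> / covol d)"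
  assumes N: "4 \<le> N"
    and p_low: "real N ^ (2 * N) \<le> of_int p" and p_up: "of_int p \<le> real (N + 1) ^ (2 * (N + 1))"
    and \<beta>: "0 < \<beta>" and \<delta>: "0 < \<delta>" "\<delta> < 1" "exp \<delta> * (1 + \<delta>) \<le> exp \<beta>"
    and half: "((1 + \<delta>) * exp (- \<delta>)) ^ N + ((1 - \<delta>) * exp \<delta>) ^ N \<le> 1 / 2"
    and sep: "4 * covol d * \<mu> < pi * exp 1 * real N"
  shows "\<exists>L. is_constrA_lattice d N L \<and> vec_lattice N L \<and> 0 < vol_vor N L \<and>
     err_prob N L (vol_vor N L powr (2 / real (2 * N)) / (2 * pi * exp 1 * \<mu>))
        \<le> exp (\<beta> + 1 - exp \<beta>) ^ N + loss \<beta> C1 N \<and>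
     1 / (2 * pi * exp 1) \<le> nsm N L \<and>
     nsm N L \<le> \<mu> / (2 * pi * exp 1) + C ^ 4 / (2 * covol d) * (real (N + 1) ^ 4 * loss \<beta> C1 N)"
proof -
  define \<kappa> where "\<kappa> = covol d"
  define q where "q = root N (of_int p)"
  define A where "A = \<kappa> * q ^ (N - 1)"
  have N0: "0 < N" using N by simp
  have \<kappa>: "0 < \<kappa>" using covol_pos[OF d_neg] by (simp add: \<kappa>_def)
  have C: "1 \<le> C" by (simp add: C_def)
  have q: "0 < q" "q ^ N = of_int p" using N0 p_pos by (auto simp: q_def)
  have qp: "of_int p = q * q ^ (N - 1)" using q N0 by (simp add: power_eq_if)
  have q_low: "(real N)\<^sup>2 \<le> q"
  proof -
    have "((real N)\<^sup>2) ^ N \<le> q ^ N" using p_low q by (simp add: power_mult)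
    then show ?thesis using power_mono_iff[of "(real N)\<^sup>2" q N] q N0 by simp
  qed
  \<comment> \<open>The exponent 4 reappears as the polynomial factor in the upper bound for
    \<open>nsm\<close>.\<close>
  have q_up: "q \<le> real (N + 1) ^ 4"
  proof -
    have "q ^ N \<le> real (N + 1) ^ (2 * (N + 1))" using p_up q by simp
    also have "\<dots> \<le> real (N + 1) ^ (4 * N)" using N by (intro power_increasing) auto
    finally have "q ^ N \<le> (real (N + 1) ^ 4) ^ N" by (simp add: power_mult)
    then show ?thesis using power_mono_iff[of q "real (N + 1) ^ 4" N] q N0 by simp
  qed
  have A: "0 < A" using \<kappa> q by (simp add: A_def)
  have AN: "covol d ^ N * of_int p ^ (N - 1) = A ^ N"
    unfolding A_def \<kappa>_def q(2)[symmetric] power_mult_distrib by (simp add: power_mult[symmetric] mult.commute)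
  \<comment> \<open>The volume per complex dimension grows exponentially, so the fixed cell of
    \<open>OK d\<close> becomes negligible against both balls; \<open>N \<ge> 4\<close> enters
    through \<open>q \<ge> 16\<close>.\<close>
  have A_low: "\<kappa> * 4 ^ N \<le> A"
  proof -
    have "(4::real) ^ N \<le> 4 ^ (2 * (N - 1))" using N by (intro power_increasing) auto
    also have "\<dots> = 16 ^ (N - 1)" by (simp add: power_mult)
    also have "\<dots> \<le> q ^ (N - 1)"
    proof (rule power_mono)
      have "(4::real)\<^sup>2 \<le> (real N)\<^sup>2" using N by (intro power_mono) auto
      then show "16 \<le> q" using q_low by simp
    qed simp
    finally show ?thesis unfolding A_def using \<kappa> by (intro mult_left_mono) auto
  qed
  \<comment> \<open>A ball with the volume of the cell has squared radius about
    \<open>real N * A / (pi * exp 1)\<close>. \<open>r\<close> exceeds it by two factors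
    \<open>exp \<beta>\<close> in the square: one pays for \<open>\<delta>\<close> in
    \<open>bvol_lower\<close>, the other makes the volume ratio exponential. \<open>r'\<close> is
    smaller by one such factor and still larger by one than the typical squared noise norm
    \<open>2 * real N * s2\<close>.\<close>
  define r where "r = sqrt (real N * A * \<mu> / (pi * exp 1))"
  define r' where "r' = sqrt (real N * A / (pi * exp 1 * exp \<beta>))"
  define s2 where "s2 = A / (2 * pi * exp 1 * \<mu>)"
  define cN where "cN = sqrt (real N) * C"
  \<comment> \<open>Adding the cell radius \<open>cN\<close> to any radius of at least
    \<open>r'\<close> multiplies it by at most \<open>1 + t\<close>.\<close>
  define t where "t = cN / r'"
  define E where "E = (1 + C1 / 2 ^ N) ^ (2 * N)"
  have \<mu>: "0 < \<mu>" "\<mu> = exp \<beta> * exp \<beta>" by (auto simp: \<mu>_def exp_add[symmetric])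
  have r: "0 < r" "r\<^sup>2 = real N * A * \<mu> / (pi * exp 1)" using A \<mu> N0 by (auto simp: r_def)
  have r': "0 < r'" "r'\<^sup>2 = real N * A / (pi * exp 1 * exp \<beta>)" using A N0 by (auto simp: r'_def)
  have s2: "0 < s2" using A \<mu> by (simp add: s2_def)
  have t0: "0 < t" using r' C N0 by (simp add: t_def cN_def)
  have rr: "r' \<le> r"
  proof -
    have "1 \<le> exp \<beta>" "1 \<le> \<mu>" using \<beta> by (auto simp: \<mu>_def)
    then have "1 \<le> \<mu> * exp \<beta>" using mult_mono[of 1 \<mu> 1 "exp \<beta>"] by simp
    then have "real N * A / (pi * exp 1) * 1 \<le> real N * A / (pi * exp 1) * (\<mu> * exp \<beta>)"
      using A by (intro mult_left_mono) auto
    then have "r'\<^sup>2 \<le> r\<^sup>2" unfolding r r' by (simp add: divide_le_eq mult_ac)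
    then show ?thesis using r by (auto intro: power2_le_imp_le)
  qed
  have tC: "t \<le> C1 / 2 ^ N"
  proof (rule power2_le_imp_le)
    have "t\<^sup>2 = C\<^sup>2 * (pi * exp 1 * exp \<beta>) / A"
      using A N0 by (simp add: t_def cN_def power_divide power_mult_distrib r')
    also have "\<dots> \<le> C\<^sup>2 * (pi * exp 1 * exp \<beta>) / (\<kappa> * 4 ^ N)"
      using A A_low \<kappa> C by (intro divide_left_mono) auto
    also have "\<dots> = (C1 / 2 ^ N)\<^sup>2"
    proof -
      have "(2 ^ N)\<^sup>2 = (4::real) ^ N" by (simp add: power_mult[symmetric] mult.commute[of N]) (simp add: power_mult)
      then show ?thesis using \<kappa> by (simp add: C1_def power_divide power_mult_distrib \<kappa>_def)
    qed
    finally show "t\<^sup>2 \<le> (C1 / 2 ^ N)\<^sup>2" .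
    show "0 \<le> C1 / 2 ^ N" using \<kappa> C by (simp add: C1_def \<kappa>_def)
  qed
  have tE: "(1 + t) ^ (2 * N) \<le> E" unfolding E_def using tC t0 by (intro power_mono) auto
  have E1: "1 \<le> E" using tE t0 one_le_power[of "1 + t" "2 * N"] by linarith
  have b_up: "bvol N r' \<le> (A * exp (- \<beta>)) ^ N"
  proof -
    have "bvol N r' \<le> (pi * exp 1 * r'\<^sup>2 / real N) ^ N" by (rule bvol_upper[OF N0 r'(1)])
    also have "pi * exp 1 * r'\<^sup>2 / real N = A * exp (- \<beta>)"
      using N0 unfolding r'(2) by (simp add: exp_minus field_simps)
    finally show ?thesis .
  qed
  have b_low: "(A * exp \<beta>) ^ N / 2 \<le> bvol N r"
  proof -
    have "(A * exp \<beta>) ^ N \<le> (pi * exp (1 - \<delta>) * r\<^sup>2 / (real N * (1 + \<delta>))) ^ N"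
    proof (rule power_mono)
      have e: "pi * exp (1 - \<delta>) * r\<^sup>2 / (real N * (1 + \<delta>)) = A * exp \<beta> * (exp \<beta> / (exp \<delta> * (1 + \<delta>)))"
        using N0 unfolding r(2) \<mu>(2) by (simp add: exp_diff)
      have "1 \<le> exp \<beta> / (exp \<delta> * (1 + \<delta>))" using \<delta> by (subst le_divide_eq_1_pos) auto
      then have "A * exp \<beta> * 1 \<le> A * exp \<beta> * (exp \<beta> / (exp \<delta> * (1 + \<delta>)))"
        using A by (intro mult_left_mono) auto
      then show "A * exp \<beta> \<le> pi * exp (1 - \<delta>) * r\<^sup>2 / (real N * (1 + \<delta>))" unfolding e by simp
    qed (use A in simp)
    then show ?thesis using bvol_lower[OF N0 r(1) \<delta>(1,2) half] by linarith
  qed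
  have b_pos: "0 < bvol N r"
    using b_low A by (intro less_le_trans[OF _ b_low]) auto
  have enl: "bvol N (\<rho> + cN) \<le> E * bvol N \<rho>" if "r' \<le> \<rho>" for \<rho>
  proof -
    have "cN = t * r'" using r' by (simp add: t_def)
    also have "\<dots> \<le> t * \<rho>" using that t0 by (intro mult_left_mono) auto
    finally have "bvol N (\<rho> + cN) \<le> bvol N ((1 + t) * \<rho>)" by (intro bvol_mono) (simp add: algebra_simps)
    also have "\<dots> = (1 + t) ^ (2 * N) * bvol N \<rho>" using t0 by (intro bvol_scale) simp
    also have "\<dots> \<le> E * bvol N \<rho>" by (intro mult_right_mono tE) simp
    finally show ?thesis .
  qed
  \<comment> \<open>After cancelling \<open>q ^ (N - 1)\<close> the claim is
    \<open>4 * \<kappa> * \<mu> * real N / (pi * exp 1) < q\<close>; here \<open>q\<close> is at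
    least the square of \<open>N\<close>, and \<open>sep\<close> covers the constants.\<close>
  have r_sep: "(2 * r)\<^sup>2 < of_int p"
  proof -
    have "(4 * covol d * \<mu>) * real N < (pi * exp 1 * real N) * real N"
      using sep N0 by (intro mult_strict_right_mono) auto
    also have "\<dots> = pi * exp 1 * (real N)\<^sup>2" by (simp add: power2_eq_square)
    also have "\<dots> \<le> pi * exp 1 * q" using q_low by (intro mult_left_mono) auto
    finally have "4 * \<kappa> * \<mu> * real N / (pi * exp 1) < q"
      by (simp add: \<kappa>_def divide_less_eq mult_ac)
    then have "4 * \<kappa> * \<mu> * real N / (pi * exp 1) * q ^ (N - 1) < q * q ^ (N - 1)"
      using q by (intro mult_strict_right_mono) auto
    also have "4 * \<kappa> * \<mu> * real N / (pi * exp 1) * q ^ (N - 1) = (2 * r)\<^sup>2"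
      unfolding power_mult_distrib r(2) A_def by simp
    finally show ?thesis by (simp add: qp)
  qed
  define eps where "eps = A ^ N / bvol N r + (bvol N (r + cN) / bvol N r - 1) + bvol N (r' + cN) / A ^ N"
  obtain g where g: "g 0 = 1"
      "measure (Leb N) (voronoi N (lat N g) - cballN N r) \<le> eps * A ^ N"
      "err_prob N (lat N g) s2 \<le> measure (gauss_noise N s2) {x \<in> space (Leb N). r' < vnorm N x} + eps"
    using good_lattice_exists[OF N0 b_pos r_sep rr less_imp_le[OF r'(1)] s2]
    unfolding AN C_def[symmetric] cN_def[symmetric] eps_def by blast
  let ?L = "lat N g"
  interpret L: vec_lattice N ?L by (rule vec_lattice_lat)
  have vL: "emeasure (Leb N) (voronoi N ?L) = ennreal (A ^ N)"
    unfolding AN[symmetric] by (rule emeasure_voronoi_lat) (use N0 g in auto)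
  have vol: "vol_vor N ?L = A ^ N" using vL A by (simp add: vol_vor_def measure_def)
  have Vb: "voronoi N ?L \<subseteq> cballN N (sqrt (real N * of_int p) * C\<^sup>2)"
    unfolding C_def by (rule voronoi_lat_bound)
  have expN: "exp (- \<beta>) ^ N = exp (- \<beta> * real N)" "exp \<beta> ^ N = exp (\<beta> * real N)"
    by (simp_all only: exp_of_nat_mult[symmetric] mult.commute)
  have eps_le: "eps \<le> loss \<beta> C1 N"
  proof -
    have "A ^ N / bvol N r \<le> A ^ N / ((A * exp \<beta>) ^ N / 2)"
      using b_low A b_pos by (intro divide_left_mono) auto
    also have "\<dots> = 2 * exp (- \<beta> * real N)"
      using A unfolding power_mult_distrib expN by (simp add: exp_minus field_simps)
    finally have 1: "A ^ N / bvol N r \<le> 2 * exp (- \<beta> * real N)" .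
    have 2: "bvol N (r + cN) / bvol N r \<le> E" using enl[OF rr] b_pos by (simp add: divide_le_eq)
    have "bvol N (r' + cN) / A ^ N \<le> (E * (A * exp (- \<beta>)) ^ N) / A ^ N"
      using order_trans[OF enl[OF order_refl] mult_left_mono[OF b_up, of E]] E1 A
      by (intro divide_right_mono) auto
    also have "\<dots> = E * exp (- \<beta> * real N)"
      using A unfolding power_mult_distrib expN by simp
    finally show ?thesis using 1 2 unfolding eps_def loss_def E_def[symmetric] by linarith
  qed
  have loss0: "0 \<le> loss \<beta> C1 N" unfolding loss_def E_def[symmetric] using E1 by (auto intro!: add_nonneg_nonneg)
  have tail: "measure (gauss_noise N s2) {x \<in> space (Leb N). r' < vnorm N x} \<le> exp (\<beta> + 1 - exp \<beta>) ^ N"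
  proof -
    interpret G: prob_space "gauss_noise N s2" by (rule prob_space_gauss_noise[OF s2])
    have "emeasure (gauss_noise N s2) {x \<in> space (Leb N). r' < vnorm N x} \<le> ennreal ((exp \<beta> * exp (1 - exp \<beta>)) ^ N)"
    proof (rule gauss_noise_chernoff[OF s2])
      fix y assume "y \<in> {x \<in> space (Leb N). r' < vnorm N x}"
      then have "r'\<^sup>2 \<le> (vnorm N y)\<^sup>2" using r' by (intro power_mono) auto
      moreover have "r'\<^sup>2 = 2 * real N * s2 * exp \<beta>" unfolding r'(2) s2_def \<mu>(2) by simp
      moreover have "0 \<le> 1 - 1 / exp \<beta>" using \<beta> by simp
      ultimately show "0 \<le> (1 - 1 / exp \<beta>) * ((vnorm N y)\<^sup>2 - 2 * real N * s2 * exp \<beta>)"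
        by (intro mult_nonneg_nonneg) auto
    qed (simp, measurable)
    then have "measure (gauss_noise N s2) {x \<in> space (Leb N). r' < vnorm N x} \<le> (exp \<beta> * exp (1 - exp \<beta>)) ^ N"
      unfolding G.emeasure_eq_measure by (simp add: ennreal_le_iff)
    also have "exp \<beta> * exp (1 - exp \<beta>) = exp (\<beta> + 1 - exp \<beta>)" by (simp add: exp_add[symmetric])
    finally show ?thesis .
  qed
  \<comment> \<open>The part of the cell beyond \<open>r\<close> has at most the fraction
    \<open>loss\<close> of the volume, and the squared covering radius divided by
    \<open>2 * real N * A\<close> is a constant times \<open>q\<close>, hence polynomial in
    \<open>N\<close>.\<close>
  have "nsm N ?L \<le> \<mu> / (2 * pi * exp 1) + C ^ 4 / (2 * covol d) * (real (N + 1) ^ 4 * loss \<beta> C1 N)"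
  proof -
    let ?l = "loss \<beta> C1 N"
    have "L.moment \<le> r\<^sup>2 * A ^ N + (sqrt (real N * of_int p) * C\<^sup>2)\<^sup>2 * measure (Leb N) (voronoi N ?L - cballN N r)"
      using L.moment_upper[OF Vb, of r] vol unfolding vol_vor_def by simp
    also have "\<dots> \<le> r\<^sup>2 * A ^ N + (sqrt (real N * of_int p) * C\<^sup>2)\<^sup>2 * (?l * A ^ N)"
      using order_trans[OF g(2) mult_right_mono[OF eps_le]] A by (intro add_left_mono mult_left_mono) auto
    also have "(sqrt (real N * of_int p) * C\<^sup>2)\<^sup>2 = real N * of_int p * C ^ 4"
      using p_pos by (simp add: power_mult_distrib)
    finally have "L.moment / A ^ N \<le> r\<^sup>2 + real N * of_int p * C ^ 4 * ?l"
      using A by (simp add: divide_le_eq algebra_simps)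
    then have "L.moment / A ^ N / (2 * real N * A) \<le> (r\<^sup>2 + real N * of_int p * C ^ 4 * ?l) / (2 * real N * A)"
      using A by (intro divide_right_mono) auto
    also have "\<dots> = \<mu> / (2 * pi * exp 1) + C ^ 4 / (2 * \<kappa>) * (q * ?l)"
      using A N0 q \<kappa> unfolding r(2) add_divide_distrib qp by (simp add: A_def mult_ac)
    also have "\<dots> \<le> \<mu> / (2 * pi * exp 1) + C ^ 4 / (2 * \<kappa>) * (real (N + 1) ^ 4 * ?l)"
      using q_up loss0 \<kappa> C by (intro add_left_mono mult_left_mono mult_right_mono) auto
    also have "L.moment / A ^ N / (2 * real N * A) = nsm N ?L"
      unfolding nsm_def L.second_moment_eq vol power_powr_inverse_dim[OF N0 A] by simp
    finally show ?thesis unfolding \<kappa>_def .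
  qed
  moreover have "1 / (2 * pi * exp 1) \<le> nsm N ?L" by (rule L.nsm_lower[OF N0 Vb vL A])
  moreover have "err_prob N ?L (vol_vor N ?L powr (2 / real (2 * N)) / (2 * pi * exp 1 * \<mu>))
      \<le> exp (\<beta> + 1 - exp \<beta>) ^ N + loss \<beta> C1 N"
    unfolding vol power_powr_inverse_dim[OF N0 A] s2_def[symmetric] using g(3) tail eps_le by linarith
  moreover have "is_constrA_lattice d N ?L" using N0 g(1) by (rule is_constrA_lat)
  moreover have "0 < vol_vor N ?L" unfolding vol using A by simp
  ultimately show ?thesis using vec_lattice_lat[of N g] by blast
qed

end

section \<open>Limits and the diagonal sequence\<close>

lemma loss_tendsto:
  assumes "0 < \<beta>" "0 < C"
  shows "(\<lambda>N. real (N + 1) ^ 4 * loss \<beta> C N) \<longlonglongrightarrow> 0" "loss \<beta> C \<longlonglongrightarrow> 0"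
  unfolding loss_def using assms by real_asymp+

text \<open>Squaring \<open>1 + x / 2 \<le> exp (x / 2)\<close>, whose left side is nonnegative,
  leaves the surplus \<open>(x / 2)\<^sup>2\<close>. Strictness puts the bases of the tail powers
  below 1.\<close>

lemma exp_gt_add_one:
  assumes "x \<noteq> 0" "\<bar>x\<bar> < 2" shows "1 + x < exp (x::real)"
proof -
  have "(1 + x / 2)\<^sup>2 = 1 + x + (x / 2)\<^sup>2" by (simp add: power2_eq_square algebra_simps)
  moreover have "0 < (x / 2)\<^sup>2" using assms by simp
  ultimately have "1 + x < (1 + x / 2)\<^sup>2" by linarith
  also have "\<dots> \<le> (exp (x / 2))\<^sup>2" using assms by (intro power_mono exp_ge_add_one_self) auto
  also have "\<dots> = exp x" by (simp add: power2_eq_square exp_add[symmetric])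
  finally show ?thesis .
qed

text \<open>For fixed \<open>\<beta>\<close> and \<open>e\<close> all conditions hold from some
  dimension \<open>M0\<close> on. This threshold is fixed before the prime, because the dimension is
  not free but dictated by the prime.\<close>

lemma exists_good_lattice:
  fixes \<beta> e :: real
  assumes d: "d < 0" and \<beta>: "0 < \<beta>" "\<beta> \<le> 1" and e: "0 < e"
  shows "\<exists>N L. M \<le> N \<and> is_constrA_lattice d N L \<and> vec_lattice N L \<and> 0 < vol_vor N L \<and>
     err_prob N L (vol_vor N L powr (2 / real (2 * N)) / (2 * pi * exp 1 * exp (2 * \<beta>))) \<le> e \<and>
     1 / (2 * pi * exp 1) \<le> nsm N L \<and> nsm N L \<le> exp (2 * \<beta>) / (2 * pi * exp 1) + e"
proof -
  define C where "C = 1 + cmod (xi d)"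
  define C1 where "C1 = C * sqrt (pi * exp 1 * exp \<beta> / covol d)"
  define \<delta> where "\<delta> = \<beta> / 2"
  have C: "1 \<le> C" by (simp add: C_def)
  have C1: "0 < C1" using C covol_pos[OF d] by (simp add: C1_def)
  have \<delta>: "0 < \<delta>" "\<delta> < 1" using \<beta> by (auto simp: \<delta>_def)
  have "exp \<delta> * (1 + \<delta>) \<le> exp \<delta> * exp \<delta>" by (intro mult_left_mono exp_ge_add_one_self) simp
  also have "\<dots> = exp \<beta>" by (simp add: \<delta>_def exp_add[symmetric])
  finally have \<delta>3: "exp \<delta> * (1 + \<delta>) \<le> exp \<beta>" .
  have lt1: "(1 + \<delta>) * exp (- \<delta>) < 1" "(1 - \<delta>) * exp \<delta> < 1"
    using exp_gt_add_one[of \<delta>] exp_gt_add_one[of "- \<delta>"] \<delta> by (simp_all add: exp_minus field_simps)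
  have "(\<lambda>N. ((1 + \<delta>) * exp (- \<delta>)) ^ N + ((1 - \<delta>) * exp \<delta>) ^ N) \<longlonglongrightarrow> 0 + 0"
    using lt1 \<delta> by (intro tendsto_add LIMSEQ_power_zero) auto
  then have ev1: "\<forall>\<^sub>F N in sequentially. ((1 + \<delta>) * exp (- \<delta>)) ^ N + ((1 - \<delta>) * exp \<delta>) ^ N < 1 / 2"
    by (rule order_tendstoD) simp
  have "(\<lambda>N. exp (\<beta> + 1 - exp \<beta>) ^ N + loss \<beta> C1 N) \<longlonglongrightarrow> 0 + 0"
    using exp_gt_add_one[of \<beta>] \<beta> loss_tendsto(2)[OF \<beta>(1) C1] by (intro tendsto_add LIMSEQ_power_zero) auto
  then have ev2: "\<forall>\<^sub>F N in sequentially. exp (\<beta> + 1 - exp \<beta>) ^ N + loss \<beta> C1 N < e"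
    by (rule order_tendstoD) (use e in simp)
  have "(\<lambda>N. C ^ 4 / (2 * covol d) * (real (N + 1) ^ 4 * loss \<beta> C1 N)) \<longlonglongrightarrow> C ^ 4 / (2 * covol d) * 0"
    by (intro tendsto_mult tendsto_const loss_tendsto(1)[OF \<beta>(1) C1])
  then have ev3: "\<forall>\<^sub>F N in sequentially. C ^ 4 / (2 * covol d) * (real (N + 1) ^ 4 * loss \<beta> C1 N) < e"
    by (rule order_tendstoD) (use e in simp)
  have ev4: "\<forall>\<^sub>F N in sequentially. 4 * covol d * exp (2 * \<beta>) / (pi * exp 1) < real N"
    using filterlim_real_sequentially by (simp add: filterlim_at_top_dense)
  obtain M0 where M0: "\<And>N. M0 \<le> N \<Longrightarrow> ((1 + \<delta>) * exp (- \<delta>)) ^ N + ((1 - \<delta>) * exp \<delta>) ^ N < 1 / 2 \<and>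
      exp (\<beta> + 1 - exp \<beta>) ^ N + loss \<beta> C1 N < e \<and>
      C ^ 4 / (2 * covol d) * (real (N + 1) ^ 4 * loss \<beta> C1 N) < e \<and>
      4 * covol d * exp (2 * \<beta>) / (pi * exp 1) < real N"
    using eventually_conj[OF ev1 eventually_conj[OF ev2 eventually_conj[OF ev3 ev4]]]
    unfolding eventually_sequentially by blast
  obtain N p \<rho> where N: "max (max M 4) M0 \<le> N" and sp: "split_prime d p \<rho>"
      and pb: "real N ^ (2 * N) \<le> of_int p" "of_int p \<le> real (N + 1) ^ (2 * (N + 1))"
    using split_prime_between_powers[OF d] by blast
  from N have N': "M \<le> N" "4 \<le> N" "M0 \<le> N" by auto
  note ev = M0[OF N'(3)]
  have sep: "4 * covol d * exp (2 * \<beta>) < pi * exp 1 * real N"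
    using ev by (simp add: divide_less_eq mult_ac)
  have half: "((1 + \<delta>) * exp (- \<delta>)) ^ N + ((1 - \<delta>) * exp \<delta>) ^ N \<le> 1 / 2" using ev by linarith
  obtain L where L: "is_constrA_lattice d N L" "vec_lattice N L" "0 < vol_vor N L"
     "err_prob N L (vol_vor N L powr (2 / real (2 * N)) / (2 * pi * exp 1 * exp (2 * \<beta>)))
        \<le> exp (\<beta> + 1 - exp \<beta>) ^ N + loss \<beta> C1 N"
     "1 / (2 * pi * exp 1) \<le> nsm N L"
     "nsm N L \<le> exp (2 * \<beta>) / (2 * pi * exp 1) + C ^ 4 / (2 * covol d) * (real (N + 1) ^ 4 * loss \<beta> C1 N)"
    using split_prime.good_lattice_at[OF sp N'(2) pb \<beta>(1) \<delta> \<delta>3 half sep]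
    unfolding C_def[symmetric] C1_def[symmetric] by blast
  have "err_prob N L (vol_vor N L powr (2 / real (2 * N)) / (2 * pi * exp 1 * exp (2 * \<beta>))) \<le> e"
    using L(4) ev by linarith
  moreover have "nsm N L \<le> exp (2 * \<beta>) / (2 * pi * exp 1) + e" using L(6) ev by linarith
  ultimately show ?thesis using L N'(1) by blast
qed

theorem theorem3:
  fixes d :: int
  assumes "d < 0" and "squarefree d"
  shows "\<exists>(N::nat \<Rightarrow> nat) (L::nat \<Rightarrow> (nat \<Rightarrow> complex) set).
           filterlim N at_top sequentially \<and>
           (\<forall>k. is_constrA_lattice d (N k) (L k)) \<and>
           poltyrev_good N L \<and> mse_good N L"
proof -
  \<comment> \<open>Serves at once as the exponent of the noise margin and as the tolerance; both
    have to vanish in the limit.\<close>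
  define \<beta> where "\<beta> k = 1 / real (Suc k)" for k
  have \<beta>: "0 < \<beta> k" "\<beta> k \<le> 1" for k by (auto simp: \<beta>_def)
  have \<beta>_lim: "\<beta> \<longlonglongrightarrow> 0" unfolding \<beta>_def by real_asymp
  define Q where "Q k N L \<longleftrightarrow> k \<le> N \<and> is_constrA_lattice d N L \<and> vec_lattice N L \<and> 0 < vol_vor N L \<and>
     err_prob N L (vol_vor N L powr (2 / real (2 * N)) / (2 * pi * exp 1 * exp (2 * \<beta> k))) \<le> \<beta> k \<and>
     1 / (2 * pi * exp 1) \<le> nsm N L \<and> nsm N L \<le> exp (2 * \<beta> k) / (2 * pi * exp 1) + \<beta> k" for k N L
  have "\<forall>k. \<exists>NL. Q k (fst NL) (snd NL)"
    using exists_good_lattice[OF assms(1) \<beta> \<beta>(1)] unfolding Q_def by simp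
  from choice[OF this] obtain F where F: "\<And>k. Q k (fst (F k)) (snd (F k))" by blast
  define N where "N k = fst (F k)" for k
  define L where "L k = snd (F k)" for k
  have Q: "k \<le> N k" "is_constrA_lattice d (N k) (L k)" "vec_lattice (N k) (L k)" "0 < vol_vor (N k) (L k)"
     "err_prob (N k) (L k) (vol_vor (N k) (L k) powr (2 / real (2 * N k)) / (2 * pi * exp 1 * exp (2 * \<beta> k))) \<le> \<beta> k"
     "1 / (2 * pi * exp 1) \<le> nsm (N k) (L k)" "nsm (N k) (L k) \<le> exp (2 * \<beta> k) / (2 * pi * exp 1) + \<beta> k" for k
    using F[of k] unfolding Q_def N_def L_def by auto
  have "filterlim N at_top sequentially"
    by (rule filterlim_at_top_mono[OF filterlim_ident]) (simp add: Q(1))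
  moreover have "poltyrev_good N L" unfolding poltyrev_good_def
  proof (intro allI impI)
    fix \<mu> :: real assume \<mu>: "1 < \<mu>"
    let ?err = "\<lambda>\<mu> k. err_prob (N k) (L k) (vol_vor (N k) (L k) powr (2 / real (2 * N k)) / (2 * pi * exp 1 * \<mu>))"
    \<comment> \<open>\<open>L k\<close> was built for the margin
      \<open>exp (2 * \<beta> k)\<close>, which eventually drops below the fixed
      \<open>\<mu>\<close>; a larger margin means less noise and no more errors.\<close>
    have "(\<lambda>k. exp (2 * \<beta> k)) \<longlonglongrightarrow> exp (2 * 0)" by (intro tendsto_intros \<beta>_lim)
    then have "\<forall>\<^sub>F k in sequentially. exp (2 * \<beta> k) < \<mu>" by (rule order_tendstoD) (use \<mu> in simp)
    then have le: "\<forall>\<^sub>F k in sequentially. ?err \<mu> k \<le> \<beta> k"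
    proof eventually_elim
      case (elim k)
      have "?err \<mu> k \<le> ?err (exp (2 * \<beta> k)) k"
      proof (rule vec_lattice.err_prob_mono[OF Q(3)])
        show "0 < vol_vor (N k) (L k) powr (2 / real (2 * N k)) / (2 * pi * exp 1 * \<mu>)"
          using Q(4)[of k] \<mu> by simp
        show "vol_vor (N k) (L k) powr (2 / real (2 * N k)) / (2 * pi * exp 1 * \<mu>)
          \<le> vol_vor (N k) (L k) powr (2 / real (2 * N k)) / (2 * pi * exp 1 * exp (2 * \<beta> k))"
          using elim \<mu> by (intro divide_left_mono mult_left_mono) auto
      qed
      with Q(5)[of k] show ?case by linarith
    qed
    show "?err \<mu> \<longlonglongrightarrow> 0"
      by (rule tendsto_sandwich[OF _ le tendsto_const \<beta>_lim]) (simp add: err_prob_def)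
  qed
  moreover have "mse_good N L" unfolding mse_good_def
  proof (rule tendsto_sandwich[OF _ _ tendsto_const])
    have "(\<lambda>k. exp (2 * \<beta> k) / (2 * pi * exp 1) + \<beta> k) \<longlonglongrightarrow> exp (2 * 0) / (2 * pi * exp 1) + 0"
      by (intro tendsto_intros \<beta>_lim) auto
    then show "(\<lambda>k. exp (2 * \<beta> k) / (2 * pi * exp 1) + \<beta> k) \<longlonglongrightarrow> 1 / (2 * pi * exp 1)" by simp
  qed (use Q(6,7) in auto)
  ultimately show ?thesis using Q(2) by blast
qed

end
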